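(* Let $V$ be an $\ell$-dimensional unitary space over $\mathbf{C}$, let $W\subset \mathbf{GL}(V)$ be a finite group generated by unitary reflections, and let $\mathcal{A}$ be the set of reflecting hyperplanes of $W$. Let $S$ be the algebra of polynomial functions on $V$, $R=S^W$, and $Q=\prod_{H\in\mathcal{A}}\alpha_H$. Then for $0\le p\le \ell$, $$\Omega^p(\mathcal{A}) = \frac{1}{Q}(\Omega^p)^{\det^{-1}}\otimes_R S .$$ Here the equality means that the natural multiplication map $\frac{1}{Q}(\Omega^p)^{\det^{-1}}\otimes_R S\to \frac1Q\Omega^p$, $\omega\otimes f\mapsto f\omega$, is injective with image $\Omega^p(\mathcal{A})$.
   Context: For each $H\in\mathcal{A}$, $\alpha_H\in V^*$ is a chosen linear form with $H=\ker(\alpha_H)$; thus $Q$ is determined up to a nonzero constant. Let $x_1,\dots,x_\ell$ be a basis of $V^*$. $\mathrm{Der}_S$ is the $S$-module of $\mathbf{C}$-derivations of $S$; $\Omega^1=\mathrm{Hom}_S(\mathrm{Der}_S,S)$ is the free $S$-module with basis $dx_1,\dots,dx_\ell$; $\Omega^0=S$ and $\Omega^p=\bigwedge^p_S\Omega^1$ (polynomial differential $p$-forms), naturally isomorphic to $S\otimes_{\mathbf{C}}\bigwedge^pV^*$. Let $d$ be the exterior differentiation, extended to rational differential forms. The $S$-module of logarithmic $p$-forms with poles along $\mathcal{A}$ is $$\Omega^p(\mathcal{A})=\Big\{\tfrac{\eta}{Q}\ \Big|\ \eta\in\Omega^p,\ d\big(\tfrac{\eta}{Q}\big)\in\tfrac1Q\Omega^{p+1}\Big\}.$$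 $W$ acts contragrediently on $V^*$, hence on $S$, and on $\Omega^p$ compatibly with $\Omega^p\cong S\otimes\bigwedge^pV^*$. For a $\mathbf{C}[W]$-module $M$, $M^W=\{x\in M\mid wx=x\ \text{for all } w\in W\}$ and $M^{\det^{-1}}=\{x\in M\mid wx=\det(w)^{-1}x\ \text{for all } w\in W\}$ (the anti-invariant elements), where $\det(w)$ is the determinant of $w$ acting on $V$. *)

theory Defs
  imports
    "HOL-Analysis.Analysis"
    "HOL-Library.Function_Algebras"
    "HOL-Algebra.Free_Abelian_Groups"
begin

text \<open>
  Finite dimension is part of the class; the zero space is allowed.
\<close>

class unitary_space = ab_group_add +
  fixes scaleC :: "complex \<Rightarrow> 'a \<Rightarrow> 'a" (infixr \<open>*\<^sub>C\<close> 75)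
    and cinner :: "'a \<Rightarrow> 'a \<Rightarrow> complex"
  assumes scaleC_add_right: "c *\<^sub>C (x + y) = c *\<^sub>C x + c *\<^sub>C y"
    and scaleC_add_left: "(b + c) *\<^sub>C x = b *\<^sub>C x + c *\<^sub>C x"
    and scaleC_scaleC: "b *\<^sub>C (c *\<^sub>C x) = (b * c) *\<^sub>C x"
    and scaleC_one: "1 *\<^sub>C x = x"
    and cinner_add_left: "cinner (x + y) z = cinner x z + cinner y z"
    and cinner_scaleC_left: "cinner (c *\<^sub>C x) y = c * cinner x y"
    and cinner_commute: "cinner x y = cnj (cinner y x)"
    and cinner_pos: "x \<noteq> 0 \<Longrightarrow> Re (cinner x x) > 0"
    and finite_dimensional: "\<exists>B. finite B \<and> (\<forall>x. \<exists>c. x = (\<Sum>b\<in>B. c b *\<^sub>C b))"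

global_interpretation complex_vector:
  vector_space "scaleC :: complex \<Rightarrow> 'a \<Rightarrow> 'a::unitary_space"
  by unfold_locales (simp_all add: scaleC_add_right scaleC_add_left scaleC_scaleC scaleC_one)

abbreviation clinear :: "('v::unitary_space \<Rightarrow> 'v) \<Rightarrow> bool" where
  "clinear \<equiv> Vector_Spaces.linear scaleC scaleC"

abbreviation clinear_form :: "('v::unitary_space \<Rightarrow> complex) \<Rightarrow> bool" where
  "clinear_form \<equiv> Vector_Spaces.linear scaleC (*)"

definition basis_of_space :: "'v::unitary_space set \<Rightarrow> bool" where
  "basis_of_space B \<longleftrightarrow> complex_vector.independent B \<and> complex_vector.span B = UNIV"

text \<open>
  The determinant of an endomorphism: the Leibniz formula for its matrix in some basis; the value
  does not depend on the basis.
\<close>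

definition cdet :: "('v::unitary_space \<Rightarrow> 'v) \<Rightarrow> complex" where
  "cdet f = (let B = (SOME B. basis_of_space B) in
     \<Sum>p | p permutes B. of_int (sign p) * (\<Prod>b\<in>B. complex_vector.representation B (f b) (p b)))"

definition GL :: "('v::unitary_space \<Rightarrow> 'v) monoid" where
  "GL = \<lparr>carrier = {f. clinear f \<and> bij f}, monoid.mult = (\<circ>), one = id\<rparr>"

definition fixed_space :: "('v \<Rightarrow> 'v) \<Rightarrow> 'v set" where
  "fixed_space f = {v. f v = v}"

definition unitary_map :: "('v::unitary_space \<Rightarrow> 'v) \<Rightarrow> bool" where
  "unitary_map f \<longleftrightarrow> f \<in> carrier GL \<and> (\<forall>x y. cinner (f x) (f y) = cinner x y)"

text \<open>The finite order usually demanded of a reflection is automatic inside a finite group.\<close>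

definition unitary_reflection :: "('v::unitary_space \<Rightarrow> 'v) \<Rightarrow> bool" where
  "unitary_reflection s \<longleftrightarrow> unitary_map s \<and>
     complex_vector.dim (fixed_space s) + 1 = complex_vector.dim (UNIV :: 'v set)"

definition finite_unitary_reflection_group :: "('v::unitary_space \<Rightarrow> 'v) set \<Rightarrow> bool" where
  "finite_unitary_reflection_group W \<longleftrightarrow>
     finite W \<and> (\<exists>T. (\<forall>s\<in>T. unitary_reflection s) \<and> W = generate GL T)"

definition reflecting_hyperplanes :: "('v::unitary_space \<Rightarrow> 'v) set \<Rightarrow> 'v set set" where
  "reflecting_hyperplanes W = fixed_space ` {s \<in> W. unitary_reflection s}"

definition defining_forms :: "'v::unitary_space set set \<Rightarrow> ('v set \<Rightarrow> 'v \<Rightarrow> complex) \<Rightarrow> bool" where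
  "defining_forms \<A> \<alpha> \<longleftrightarrow> (\<forall>H\<in>\<A>. clinear_form (\<alpha> H) \<and> {v. \<alpha> H v = 0} = H)"

definition defining_polynomial :: "'v set set \<Rightarrow> ('v set \<Rightarrow> 'v \<Rightarrow> complex) \<Rightarrow> 'v \<Rightarrow> complex" where
  "defining_polynomial \<A> \<alpha> = (\<lambda>v. \<Prod>H\<in>\<A>. \<alpha> H v)"

inductive_set poly_funs :: "('v::unitary_space \<Rightarrow> complex) set" where
  const: "(\<lambda>_. c) \<in> poly_funs"
| linear: "clinear_form f \<Longrightarrow> f \<in> poly_funs"
| add: "f \<in> poly_funs \<Longrightarrow> g \<in> poly_funs \<Longrightarrow> (\<lambda>v. f v + g v) \<in> poly_funs"
| mult: "f \<in> poly_funs \<Longrightarrow> g \<in> poly_funs \<Longrightarrow> (\<lambda>v. f v * g v) \<in> poly_funs"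

text \<open>
  An element of the \<open>p\<close>-th exterior power of the dual space is an alternating \<open>p\<close>-linear form, with
  the \<open>p\<close> arguments passed as a list; lists of any other length are sent to \<open>0\<close>, so that equal
  forms are equal functions.
\<close>

definition alternating_form :: "nat \<Rightarrow> ('v::unitary_space list \<Rightarrow> complex) \<Rightarrow> bool" where
  "alternating_form p \<phi> \<longleftrightarrow>
     (\<forall>us. length us \<noteq> p \<longrightarrow> \<phi> us = 0) \<and>
     (\<forall>us i. length us = p \<longrightarrow> i < p \<longrightarrow> clinear_form (\<lambda>x. \<phi> (us[i := x]))) \<and>
     (\<forall>us i j. length us = p \<longrightarrow> i < j \<longrightarrow> j < p \<longrightarrow> us ! i = us ! j \<longrightarrow> \<phi> us = 0)"

text \<open>
  A differential \<open>p\<close>-form maps a point to an alternating form on the tangent space at this point.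
  It is polynomial if its value on constant vector fields is polynomial in the point.
\<close>

type_synonym 'v dform = "'v \<Rightarrow> 'v list \<Rightarrow> complex"

definition poly_forms :: "nat \<Rightarrow> 'v::unitary_space dform set" where
  "poly_forms p =
     {\<omega>. (\<forall>v. alternating_form p (\<omega> v)) \<and> (\<forall>us. (\<lambda>v. \<omega> v us) \<in> poly_funs)}"

definition scale_form :: "('v \<Rightarrow> complex) \<Rightarrow> 'v dform \<Rightarrow> 'v dform" where
  "scale_form f \<omega> = (\<lambda>v us. f v * \<omega> v us)"

text \<open>
  The invariant formula for the exterior derivative on constant vector fields, where all brackets
  vanish; the omitted argument is the one used for the directional derivative.
\<close>

definition ext_deriv :: "'v::unitary_space dform \<Rightarrow> 'v dform" where
  "ext_deriv \<omega> = (\<lambda>v us. \<Sum>i<length us.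
     (-1) ^ i * deriv (\<lambda>t. \<omega> (v + t *\<^sub>C (us ! i)) (take i us @ drop (Suc i) us)) 0)"

text \<open>
  The rational form \<open>\<eta>/Q\<close> is represented by its values on the complement \<open>Q \<noteq> 0\<close> of the
  arrangement; where \<open>Q\<close> vanishes, the function below is \<open>0\<close> by the convention for division.
  The complement is open and dense, so for polynomial \<open>\<eta>\<close> and nonzero \<open>Q\<close> this representation is
  faithful, and identities between such forms are required on the complement only.
\<close>

definition over :: "('v \<Rightarrow> complex) \<Rightarrow> 'v dform \<Rightarrow> 'v dform" where
  "over Q \<eta> = (\<lambda>v us. \<eta> v us / Q v)"

definition log_forms :: "('v::unitary_space \<Rightarrow> complex) \<Rightarrow> nat \<Rightarrow> 'v dform set" where
  "log_forms Q p = {over Q \<eta> | \<eta>. \<eta> \<in> poly_forms p \<and>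
     (\<exists>\<theta>\<in>poly_forms (Suc p). \<forall>v. Q v \<noteq> 0 \<longrightarrow> ext_deriv (over Q \<eta>) v = over Q \<theta> v)}"

definition act_fun :: "('v \<Rightarrow> 'v) \<Rightarrow> ('v \<Rightarrow> complex) \<Rightarrow> 'v \<Rightarrow> complex" where
  "act_fun w f = (\<lambda>v. f (Hilbert_Choice.inv w v))"

definition act_form :: "('v \<Rightarrow> 'v) \<Rightarrow> 'v dform \<Rightarrow> 'v dform" where
  "act_form w \<omega> = (\<lambda>v us. \<omega> (Hilbert_Choice.inv w v) (map (Hilbert_Choice.inv w) us))"

definition invariant_polys :: "('v::unitary_space \<Rightarrow> 'v) set \<Rightarrow> ('v \<Rightarrow> complex) set" where
  "invariant_polys W = {f \<in> poly_funs. \<forall>w\<in>W. act_fun w f = f}"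

definition anti_invariant_forms :: "('v::unitary_space \<Rightarrow> 'v) set \<Rightarrow> nat \<Rightarrow> 'v dform set" where
  "anti_invariant_forms W p =
     {\<omega> \<in> poly_forms p. \<forall>w\<in>W. act_form w \<omega> = scale_form (\<lambda>_. inverse (cdet w)) \<omega>}"

text \<open>
  For a commutative ring \<open>R\<close> acting on the abelian groups \<open>M\<close> and \<open>N\<close> by \<open>sM\<close> and \<open>sN\<close>, the tensor
  product of \<open>M\<close> and \<open>N\<close> over \<open>R\<close> is the free abelian group on \<open>M \<times> N\<close> modulo the bilinearity
  relations; the pure tensors are the cosets of the generators.
\<close>

definition tensor_relations ::
  "'r set \<Rightarrow> ('r \<Rightarrow> 'm \<Rightarrow> 'm) \<Rightarrow> ('r \<Rightarrow> 'n \<Rightarrow> 'n) \<Rightarrow>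
   'm::ab_group_add set \<Rightarrow> 'n::ab_group_add set \<Rightarrow> ('m \<times> 'n \<Rightarrow>\<^sub>0 int) set" where
  "tensor_relations R sM sN M N =
     {frag_of (x + x', y) - frag_of (x, y) - frag_of (x', y) | x x' y. x \<in> M \<and> x' \<in> M \<and> y \<in> N} \<union>
     {frag_of (x, y + y') - frag_of (x, y) - frag_of (x, y') | x y y'. x \<in> M \<and> y \<in> N \<and> y' \<in> N} \<union>
     {frag_of (sM r x, y) - frag_of (x, sN r y) | r x y. r \<in> R \<and> x \<in> M \<and> y \<in> N}"

definition tensor_product ::
  "'r set \<Rightarrow> ('r \<Rightarrow> 'm \<Rightarrow> 'm) \<Rightarrow> ('r \<Rightarrow> 'n \<Rightarrow> 'n) \<Rightarrow>
   'm::ab_group_add set \<Rightarrow> 'n::ab_group_add set \<Rightarrow> ('m \<times> 'n \<Rightarrow>\<^sub>0 int) set monoid" where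
  "tensor_product R sM sN M N =
     free_Abelian_group (M \<times> N) Mod
       generate (free_Abelian_group (M \<times> N)) (tensor_relations R sM sN M N)"

definition mult_combination :: "('v dform \<times> ('v \<Rightarrow> complex) \<Rightarrow>\<^sub>0 int) \<Rightarrow> 'v dform" where
  "mult_combination c =
     (\<lambda>v us. \<Sum>(\<omega>, f)\<in>Poly_Mapping.keys c.
        of_int (Poly_Mapping.lookup c (\<omega>, f)) * scale_form f \<omega> v us)"

text \<open>
  The map induced on cosets by \<open>mult_combination\<close>, which is constant on each of them; it sends the
  pure tensor of \<open>\<omega>\<close> and \<open>f\<close> to \<open>scale_form f \<omega>\<close>.
\<close>

definition mult_map :: "('v dform \<times> ('v \<Rightarrow> complex) \<Rightarrow>\<^sub>0 int) set \<Rightarrow> 'v dform" where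
  "mult_map X = the_elem (mult_combination ` X)"

definition anti_invariant_tensor ::
  "('v::unitary_space \<Rightarrow> 'v) set \<Rightarrow> ('v \<Rightarrow> complex) \<Rightarrow> nat \<Rightarrow>
   ('v dform \<times> ('v \<Rightarrow> complex) \<Rightarrow>\<^sub>0 int) set monoid" where
  "anti_invariant_tensor W Q p =
     tensor_product (invariant_polys W) scale_form (*) (over Q ` anti_invariant_forms W p) poly_funs"

end

theory Submission
  imports Defs
begin

text \<open>
  Since \<open>Q \<circ> w = det w \<cdot> Q\<close> (\<open>Q_semi_invariant\<close>), the forms \<open>\<eta>/Q\<close> with \<open>\<eta>\<close> anti-invariant are the
  \<open>W\<close>-invariant ones among the forms with denominator \<open>Q\<close>. So the theorem describes the logarithmic
  forms by descent: they are generated over \<open>S\<close> by their invariants, with no relations beyond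
  those that come from \<open>R\<close>.

  The descent rests on a trace form. Let \<open>e\<^sub>H\<close> be the order of the pointwise stabilizer of \<open>H\<close> and
  let \<open>J\<close> be the product of the powers \<open>\<alpha>\<^sub>H ^ (e\<^sub>H - 1)\<close>. The trace \<open>g \<mapsto> \<Sum>w. w (g / J)\<close>, here
  called \<open>jtrace\<close>, maps \<open>S\<close> into \<open>R\<close>. It admits dual bases (\<open>dual_bases_exist\<close>): there are
  finitely many polynomials \<open>a\<^sub>i\<close>, \<open>b\<^sub>i\<close> such that \<open>f = \<Sum>i. b\<^sub>i jtrace (a\<^sub>i f)\<close> for all \<open>f\<close> in \<open>S\<close>.
  Comparing the coefficients of the automorphisms \<open>w\<close> in this identity of operators shows that
  \<open>\<Sum>i. b\<^sub>i w (a\<^sub>i)\<close> is \<open>J\<close> for \<open>w = 1\<close> and \<open>0\<close> otherwise (\<open>dual_bases_orthogonality\<close>).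

  Surjectivity. By the orthogonality, \<open>\<omega> = \<Sum>i. b\<^sub>i \<theta>\<^sub>i\<close> with the invariant forms
  \<open>\<theta>\<^sub>i = \<Sum>w. w (a\<^sub>i \<omega> / J)\<close>. A form \<open>\<eta>/Q\<close> is logarithmic if and only if the restriction of \<open>\<eta>\<close> to the
  tangent spaces of each hyperplane vanishes (\<open>logarithmic_iff_tangentially_zero\<close>). Anti-invariant
  forms have this property because a reflection fixes its hyperplane and all vectors tangent to it,
  but its determinant is not \<open>1\<close>. Conversely, if \<open>\<omega>\<close> is logarithmic, then \<open>\<theta>\<^sub>i\<close> has only simple poles:
  near a generic point of \<open>H\<close>, invariance under the cyclic stabilizer forces the orders of the poles
  into a fixed residue class modulo \<open>e\<^sub>H\<close> (\<open>invariant_tangentially_zero_divisible\<close>).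

  Injectivity. Modulo the bilinear relations, \<open>\<Sum>k. \<omega>\<^sub>k \<otimes> f\<^sub>k\<close> equals
  \<open>\<Sum>i. (\<Sum>k. jtrace (a\<^sub>i f\<^sub>k) \<omega>\<^sub>k) \<otimes> b\<^sub>i\<close>. As \<open>\<omega>\<^sub>k\<close> is invariant, the left factor is
  \<open>\<Sum>w. w (a\<^sub>i \<Sum>k. f\<^sub>k \<omega>\<^sub>k / J)\<close>, which is zero when \<open>\<Sum>k. f\<^sub>k \<omega>\<^sub>k\<close> is
  (\<open>mult_combination_kernel\<close>).

  Dual bases exist because the bilinear form \<open>jtrace (f g)\<close> is nondegenerate modulo the Hilbert
  ideal, the ideal of \<open>S\<close> that is generated by the homogeneous invariants of positive degree
  (\<open>trace_form_nondegenerate\<close>). This is where generation by reflections enters: the divided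
  differences \<open>(f - s f) / \<alpha>\<^sub>H\<close> are adjoint to each other, so they preserve the radical; by
  induction on the degree an element of the radical is congruent to all its images under
  reflections, hence to its average over \<open>W\<close>, which lies in the Hilbert ideal. The form pairs degree
  \<open>d\<close> with degree \<open>deg J - d\<close>, so only finitely many degrees matter, and linear algebra degree by
  degree (\<open>trace_operator_fixing_low_degrees\<close>) yields the \<open>a\<^sub>i\<close> and \<open>b\<^sub>i\<close>.
\<close>

section \<open>Polynomial functions\<close>

lemma poly_funs_diff:
  assumes "f \<in> poly_funs" "g \<in> poly_funs"
  shows "(\<lambda>v. f v - g v) \<in> poly_funs"
proof -
  have "(\<lambda>v. f v + (-1) * g v) \<in> poly_funs"
    by (intro poly_funs.add poly_funs.mult poly_funs.const assms)
  then show ?thesis by simp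
qed

lemma poly_funs_cmult: "f \<in> poly_funs \<Longrightarrow> (\<lambda>v. c * f v) \<in> poly_funs"
  by (intro poly_funs.mult poly_funs.const)

lemma poly_funs_sum:
  "(\<And>i. i \<in> I \<Longrightarrow> f i \<in> poly_funs) \<Longrightarrow> (\<lambda>v. \<Sum>i\<in>I. f i v) \<in> poly_funs"
  by (induction I rule: infinite_finite_induct) (auto intro: poly_funs.add poly_funs.const)

lemma poly_funs_prod:
  "(\<And>i. i \<in> I \<Longrightarrow> f i \<in> poly_funs) \<Longrightarrow> (\<lambda>v. \<Prod>i\<in>I. f i v) \<in> poly_funs"
  by (induction I rule: infinite_finite_induct) (auto intro: poly_funs.mult poly_funs.const)

lemma poly_funs_power: "f \<in> poly_funs \<Longrightarrow> (\<lambda>v. f v ^ n) \<in> poly_funs"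
  by (induction n) (auto intro: poly_funs.mult poly_funs.const)

lemma clinear_form_add: "clinear_form f \<Longrightarrow> f (x + y) = f x + f y"
  by (simp add: linear_add module_hom.add Vector_Spaces.linear.axioms linear_iff_module_hom)

lemma clinear_form_scale: "clinear_form f \<Longrightarrow> f (c *\<^sub>C x) = c * f x"
  by (simp add: module_hom.scale linear_iff_module_hom)

lemma clinear_form_diff: "clinear_form f \<Longrightarrow> f (x - y) = f x - f y"
  by (simp add: module_hom.diff linear_iff_module_hom)

lemma clinear_form_zero: "clinear_form f \<Longrightarrow> f 0 = 0"
  by (simp add: module_hom.zero linear_iff_module_hom)

lemma clinear_formI:
  assumes "\<And>x y. f (x + y) = f x + f y" "\<And>c x. f (c *\<^sub>C x) = c * f x"
  shows "clinear_form f"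
proof -
  interpret vs: vector_space "(*) :: complex \<Rightarrow> complex \<Rightarrow> complex"
    by unfold_locales (auto simp: algebra_simps)
  show ?thesis
    by unfold_locales (auto simp: assms)
qed

lemma clinearI:
  assumes "\<And>x y. f (x + y) = f x + f y" "\<And>c x. f (c *\<^sub>C x) = c *\<^sub>C f x"
  shows "clinear f"
  by unfold_locales (auto simp: assms)

lemma clinear_add: "clinear f \<Longrightarrow> f (x + y) = f x + f y"
  by (simp add: module_hom.add linear_iff_module_hom)

lemma clinear_scale: "clinear f \<Longrightarrow> f (c *\<^sub>C x) = c *\<^sub>C f x"
  by (simp add: module_hom.scale linear_iff_module_hom)

lemma clinear_diff: "clinear f \<Longrightarrow> f (x - y) = f x - f y"
  by (simp add: module_hom.diff linear_iff_module_hom)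

lemma clinear_zero: "clinear f \<Longrightarrow> f 0 = 0"
  by (simp add: module_hom.zero linear_iff_module_hom)

lemma clinear_form_compose: "clinear_form f \<Longrightarrow> clinear g \<Longrightarrow> clinear_form (\<lambda>v. f (g v))"
  by (rule clinear_formI) (simp_all add: clinear_add clinear_scale clinear_form_add clinear_form_scale)

lemma poly_funs_compose:
  assumes "f \<in> poly_funs" "clinear g"
  shows "(\<lambda>v. f (g v)) \<in> poly_funs"
  using assms by (induction rule: poly_funs.induct)
    (auto intro: poly_funs.intros clinear_form_compose)

lemma poly_funs_line:
  assumes "f \<in> poly_funs"
  shows "\<exists>p. \<forall>t. f (u + t *\<^sub>C w) = poly p t"
  using assms
proof (induction rule: poly_funs.induct)
  case (const c)
  show ?case by (rule exI[of _ "[:c:]"]) simp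
next
  case (linear f)
  show ?case
    by (rule exI[of _ "[:f u, f w:]"]) (simp add: linear clinear_form_add clinear_form_scale)
next
  case (add f g)
  then show ?case by (metis poly_add)
next
  case (mult f g)
  then show ?case by (metis poly_mult)
qed

lemma poly_nonzero_at_cofinite:
  assumes "p \<noteq> (0 :: complex poly)" "finite F"
  shows "\<exists>t. t \<notin> F \<and> poly p t \<noteq> 0"
proof -
  have "finite (F \<union> {t. poly p t = 0})"
    using assms poly_roots_finite by blast
  then show ?thesis
    by (metis (mono_tags, lifting) UnCI ex_new_if_finite infinite_UNIV_char_0 mem_Collect_eq)
qed

text \<open>
  A subspace is an irreducible variety: on the line joining two points where one of the two
  factors is nonzero, both factors are nonzero polynomials in one variable.
\<close>

lemma poly_funs_domain:
  assumes H: "complex_vector.subspace H"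
    and "f \<in> poly_funs" "g \<in> poly_funs"
    and "u \<in> H" "f u \<noteq> 0" "w \<in> H" "g w \<noteq> 0"
  shows "\<exists>v\<in>H. f v \<noteq> 0 \<and> g v \<noteq> 0"
proof -
  obtain p where p: "\<And>t. f (u + t *\<^sub>C (w - u)) = poly p t"
    using poly_funs_line[OF assms(2)] by blast
  obtain q where q: "\<And>t. g (u + t *\<^sub>C (w - u)) = poly q t"
    using poly_funs_line[OF assms(3)] by blast
  have "poly p 0 \<noteq> 0" using p[of 0] assms by simp
  moreover have "poly q 1 \<noteq> 0" using q[of 1] assms by (simp add: scaleC_one)
  ultimately have "p * q \<noteq> 0" by auto
  then obtain t where "poly (p * q) t \<noteq> 0"
    using poly_all_0_iff_0 by blast
  then have "f (u + t *\<^sub>C (w - u)) \<noteq> 0 \<and> g (u + t *\<^sub>C (w - u)) \<noteq> 0"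
    using p q by simp
  moreover have "u + t *\<^sub>C (w - u) \<in> H"
    using H assms by (intro complex_vector.subspace_add complex_vector.subspace_scale
        complex_vector.subspace_diff)
  ultimately show ?thesis by blast
qed

lemma poly_funs_prod_nonzero:
  assumes H: "complex_vector.subspace H" and "finite I"
    and "\<And>i. i \<in> I \<Longrightarrow> f i \<in> poly_funs" "\<And>i. i \<in> I \<Longrightarrow> \<exists>u\<in>H. f i u \<noteq> 0"
  shows "\<exists>v\<in>H. (\<Prod>i\<in>I. f i v) \<noteq> 0"
  using assms(2-)
proof (induction I rule: finite_induct)
  case empty
  then show ?case using complex_vector.subspace_0[OF H] by auto
next
  case (insert i I)
  then obtain u w where uw: "u \<in> H" "f i u \<noteq> 0" "w \<in> H" "(\<Prod>i\<in>I. f i w) \<noteq> 0" by blast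
  have "f i \<in> poly_funs" "(\<lambda>v. \<Prod>i\<in>I. f i v) \<in> poly_funs"
    using insert.prems by (auto intro: poly_funs_prod)
  from poly_funs_domain[OF H this uw] obtain v where
    "v \<in> H" "f i v \<noteq> 0" "(\<Prod>i\<in>I. f i v) \<noteq> 0" by blast
  then show ?case using insert by auto
qed

lemma poly_funs_eq_zero_on:
  assumes "complex_vector.subspace H" "f \<in> poly_funs" "g \<in> poly_funs"
    and "\<exists>w\<in>H. g w \<noteq> 0" "\<And>v. v \<in> H \<Longrightarrow> g v \<noteq> 0 \<Longrightarrow> f v = 0" "u \<in> H"
  shows "f u = 0"
  using poly_funs_domain[OF assms(1-3)] assms(4-) by blast

lemma poly_funs_eqI:
  assumes "f \<in> poly_funs" "g \<in> poly_funs" "h \<in> poly_funs" "\<exists>w. h w \<noteq> 0"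
    and "\<And>v. h v \<noteq> 0 \<Longrightarrow> f v = g v"
  shows "f = g"
proof
  fix u
  have "f u - g u = 0"
    by (rule poly_funs_eq_zero_on[OF complex_vector.subspace_UNIV poly_funs_diff[OF assms(1,2)] assms(3)])
      (use assms in auto)
  then show "f u = g u" by simp
qed

lemma clinear_form_kernel_subspace:
  assumes "clinear_form \<alpha>"
  shows "complex_vector.subspace {v. \<alpha> v = 0}"
  unfolding complex_vector.subspace_def
  using assms by (auto simp: clinear_form_add clinear_form_scale clinear_form_zero)

definition divides_poly :: "('v::unitary_space \<Rightarrow> complex) \<Rightarrow> ('v \<Rightarrow> complex) \<Rightarrow> bool" where
  "divides_poly f g \<longleftrightarrow> (\<exists>h\<in>poly_funs. \<forall>v. g v = f v * h v)"

text \<open>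
  Comparing a polynomial at \<open>v\<close> and at the projection of \<open>v\<close> to the hyperplane along \<open>a\<close> is an
  operation that obeys a Leibniz rule, so it suffices to divide the difference by \<open>\<alpha>\<close> for
  constants and linear forms.
\<close>

lemma poly_diff_projection:
  assumes "f \<in> poly_funs" "clinear_form \<alpha>"
  shows "\<exists>g\<in>poly_funs. \<forall>v. f v - f (v - \<alpha> v *\<^sub>C a) = \<alpha> v * g v"
  using assms(1)
proof (induction rule: poly_funs.induct)
  case (const c)
  show ?case by (rule bexI[of _ "\<lambda>_. 0"]) (auto intro: poly_funs.const)
next
  case (linear f)
  show ?case
    by (rule bexI[of _ "\<lambda>_. f a"])
      (auto intro: poly_funs.const simp: linear clinear_form_diff clinear_form_scale)
next
  case (add f g)
  then obtain f' g' where fg: "f' \<in> poly_funs" "g' \<in> poly_funs"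
    "\<And>v. f v - f (v - \<alpha> v *\<^sub>C a) = \<alpha> v * f' v"
    "\<And>v. g v - g (v - \<alpha> v *\<^sub>C a) = \<alpha> v * g' v" by blast
  show ?case
  proof (rule bexI[of _ "\<lambda>v. f' v + g' v"], intro allI)
    show "f v + g v - (f (v - \<alpha> v *\<^sub>C a) + g (v - \<alpha> v *\<^sub>C a)) = \<alpha> v * (f' v + g' v)" for v
      using fg(3)[of v] fg(4)[of v] by (simp add: algebra_simps)
  qed (auto intro: fg poly_funs.add)
next
  case (mult f g)
  then obtain f' g' where fg: "f' \<in> poly_funs" "g' \<in> poly_funs"
    "\<And>v. f v - f (v - \<alpha> v *\<^sub>C a) = \<alpha> v * f' v"
    "\<And>v. g v - g (v - \<alpha> v *\<^sub>C a) = \<alpha> v * g' v" by blast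
  have proj: "clinear (\<lambda>v. v - \<alpha> v *\<^sub>C a)"
    by (rule clinearI) (simp_all add: clinear_form_add clinear_form_scale assms(2) scaleC_add_left
        complex_vector.scale_right_diff_distrib scaleC_scaleC)
  have "(\<lambda>v. f (v - \<alpha> v *\<^sub>C a)) \<in> poly_funs"
    using poly_funs_compose[OF mult.hyps(1) proj] .
  then have "(\<lambda>v. f' v * g v + f (v - \<alpha> v *\<^sub>C a) * g' v) \<in> poly_funs"
    by (intro poly_funs.add poly_funs.mult fg mult.hyps)
  moreover have "f v * g v - f (v - \<alpha> v *\<^sub>C a) * g (v - \<alpha> v *\<^sub>C a) =
      \<alpha> v * (f' v * g v + f (v - \<alpha> v *\<^sub>C a) * g' v)" for v
  proof -
    have "f v = f (v - \<alpha> v *\<^sub>C a) + \<alpha> v * f' v" "g v = g (v - \<alpha> v *\<^sub>C a) + \<alpha> v * g' v"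
      using fg(3,4)[of v] by (simp_all add: algebra_simps)
    then show ?thesis by algebra
  qed
  ultimately show ?case
    by (intro bexI[of _ "\<lambda>v. f' v * g v + f (v - \<alpha> v *\<^sub>C a) * g' v"]) auto
qed

lemma vanishing_on_hyperplane_divisible:
  assumes "f \<in> poly_funs" "clinear_form \<alpha>" "\<alpha> a = 1" "\<And>v. \<alpha> v = 0 \<Longrightarrow> f v = 0"
  shows "divides_poly \<alpha> f"
proof -
  obtain g where g: "g \<in> poly_funs" "\<And>v. f v - f (v - \<alpha> v *\<^sub>C a) = \<alpha> v * g v"
    using poly_diff_projection[OF assms(1,2)] by blast
  have "\<alpha> (v - \<alpha> v *\<^sub>C a) = 0" for v
    using assms by (simp add: clinear_form_diff clinear_form_scale)
  then show ?thesis using g assms(4) unfolding divides_poly_def by fastforce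
qed

text \<open>
  Unique factorization for products of linear forms: a factor \<open>\<alpha>\<close> cannot divide the other forms,
  because these do not vanish identically on its kernel.
\<close>

lemma divides_poly_prod_powers:
  assumes "finite I" "f \<in> poly_funs"
    and lin: "\<And>i. i \<in> I \<Longrightarrow> clinear_form (\<alpha> i)" "\<And>i. i \<in> I \<Longrightarrow> \<alpha> i (a i) = 1"
    and coprime: "\<And>i j. i \<in> I \<Longrightarrow> j \<in> I \<Longrightarrow> i \<noteq> j \<Longrightarrow> \<exists>u. \<alpha> i u = 0 \<and> \<alpha> j u \<noteq> 0"
    and "\<And>i. i \<in> I \<Longrightarrow> divides_poly (\<lambda>v. \<alpha> i v ^ m i) f"
  shows "divides_poly (\<lambda>v. \<Prod>i\<in>I. \<alpha> i v ^ m i) f"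
  using assms
proof (induction I arbitrary: rule: finite_induct)
  case empty
  then show ?case by (auto simp: divides_poly_def)
next
  case (insert j I)
  let ?P = "\<lambda>v. \<Prod>i\<in>I. \<alpha> i v ^ m i"
  have "divides_poly ?P f" using insert by auto
  then obtain g where g: "g \<in> poly_funs" "\<And>v. f v = ?P v * g v" by (auto simp: divides_poly_def)
  have P: "?P \<in> poly_funs"
    using insert.prems by (intro poly_funs_prod poly_funs_power poly_funs.linear) auto
  have sub: "complex_vector.subspace {v. \<alpha> j v = 0}"
    using insert.prems by (intro clinear_form_kernel_subspace) auto
  have nz: "\<exists>w\<in>{v. \<alpha> j v = 0}. ?P w \<noteq> 0"
  proof (rule poly_funs_prod_nonzero[OF sub insert.hyps(1)])
    fix i assume i: "i \<in> I"
    show "(\<lambda>v. \<alpha> i v ^ m i) \<in> poly_funs"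
      using insert.prems i by (intro poly_funs_power poly_funs.linear) auto
    show "\<exists>u\<in>{v. \<alpha> j v = 0}. \<alpha> i u ^ m i \<noteq> 0"
      using insert.prems(4)[of j i] i insert.hyps by auto
  qed
  have dP: "\<exists>h\<in>poly_funs. \<forall>v. g v = \<alpha> j v ^ k * h v" if "k \<le> m j" for k
    using that
  proof (induction k)
    case 0
    then show ?case using g by auto
  next
    case (Suc k)
    then obtain h where h: "h \<in> poly_funs" "\<And>v. g v = \<alpha> j v ^ k * h v" by auto
    obtain f' where f': "f' \<in> poly_funs" "\<And>v. f v = \<alpha> j v ^ m j * f' v"
      using insert.prems(5)[of j] by (auto simp: divides_poly_def)
    have aj: "\<alpha> j \<in> poly_funs" "\<exists>w. \<alpha> j w \<noteq> 0"
      using insert.prems(2)[of j] insert.prems(3)[of j] by (auto intro: poly_funs.linear exI[of _ "a j"])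
    have "(\<lambda>v. ?P v * h v) = (\<lambda>v. \<alpha> j v * (\<alpha> j v ^ (m j - Suc k) * f' v))"
    proof (rule poly_funs_eqI[OF _ _ aj])
      fix v assume nz: "\<alpha> j v \<noteq> 0"
      have "\<alpha> j v ^ k * (?P v * h v) = f v" using g(2)[of v] h(2)[of v] by simp
      also have "\<dots> = \<alpha> j v ^ k * (\<alpha> j v * (\<alpha> j v ^ (m j - Suc k) * f' v))"
      proof -
        have "m j = k + (1 + (m j - Suc k))" using Suc.prems by simp
        then have "\<alpha> j v ^ m j = \<alpha> j v ^ k * (\<alpha> j v * \<alpha> j v ^ (m j - Suc k))"
          by (metis power_add power_one_right)
        then show ?thesis using f'(2)[of v] by simp
      qed
      finally show "?P v * h v = \<alpha> j v * (\<alpha> j v ^ (m j - Suc k) * f' v)"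
        using nz by simp
    qed (intro poly_funs.mult poly_funs_power P h f' aj)+
    then have eq: "?P v * h v = \<alpha> j v * (\<alpha> j v ^ (m j - Suc k) * f' v)" for v by (rule fun_cong)
    have "?P v = 0 \<or> h v = 0" if "\<alpha> j v = 0" for v
    proof -
      have "?P v * h v = 0" using eq[of v] unfolding that mult_zero_left .
      then show ?thesis by (simp only: mult_eq_0_iff)
    qed
    then have "h v = 0" if "\<alpha> j v = 0" for v
      by (intro poly_funs_eq_zero_on[OF sub h(1) P nz, of v]) (use that in auto)
    then have "divides_poly (\<alpha> j) h"
      using vanishing_on_hyperplane_divisible[OF h(1), of "\<alpha> j" "a j"] insert.prems by auto
    then obtain h' where "h' \<in> poly_funs" "\<And>v. h v = \<alpha> j v * h' v" by (auto simp: divides_poly_def)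
    then show ?case using h by (intro bexI[of _ h']) (auto simp: mult_ac)
  qed
  obtain h where "h \<in> poly_funs" "\<And>v. g v = \<alpha> j v ^ m j * h v" using dP[of "m j"] by auto
  then show ?case using g insert.hyps unfolding divides_poly_def
    by (intro bexI[of _ h]) (auto simp: mult_ac)
qed

text \<open>Points are separated by linear forms, for instance by inner products.\<close>

lemma clinear_form_cinner: "clinear_form (\<lambda>v. cinner v w)"
  by (rule clinear_formI) (simp_all add: cinner_add_left cinner_scaleC_left)

lemma cinner_self_eq_0: "cinner x x = 0 \<Longrightarrow> x = (0::'v::unitary_space)"
  using cinner_pos by fastforce

section \<open>The grading of the polynomial ring\<close>

lemma basis_of_space_exists: "\<exists>B::'v::unitary_space set. basis_of_space B"
proof -
  obtain B :: "'v set" where "complex_vector.independent B" "UNIV \<subseteq> complex_vector.span B"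
    by (rule complex_vector.maximal_independent_subset)
  then have "basis_of_space B" by (simp add: basis_of_space_def top_le)
  then show ?thesis ..
qed

lemma basis_of_space_finite:
  assumes "basis_of_space (B::'v::unitary_space set)"
  shows "finite B"
proof -
  obtain A :: "'v set" where A: "finite A" "\<forall>x. \<exists>c. x = (\<Sum>b\<in>A. c b *\<^sub>C b)"
    using finite_dimensional by blast
  have "x \<in> complex_vector.span A" for x
  proof -
    obtain c where "x = (\<Sum>b\<in>A. c b *\<^sub>C b)" using A by blast
    then show ?thesis
      by (auto intro: complex_vector.span_sum complex_vector.span_scale complex_vector.span_base)
  qed
  then show ?thesis
    using complex_vector.independent_span_bound[OF A(1)] assms
    unfolding basis_of_space_def by blast
qed

lemma basis_of_space_expansion:
  assumes "basis_of_space B"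
  shows "v = (\<Sum>b\<in>B. complex_vector.representation B v b *\<^sub>C b)"
  using assms complex_vector.sum_representation_eq[of B v B] basis_of_space_finite[OF assms]
  unfolding basis_of_space_def by simp

lemma coordinate_linear:
  assumes "basis_of_space B"
  shows "clinear_form (\<lambda>v. complex_vector.representation B v b)"
  using assms unfolding basis_of_space_def
  by (intro clinear_formI) (simp_all add: complex_vector.representation_add
      complex_vector.representation_scale)

lemma clinear_form_sum: "clinear_form f \<Longrightarrow> f (\<Sum>i\<in>I. g i) = (\<Sum>i\<in>I. f (g i))"
  by (induction I rule: infinite_finite_induct) (auto simp: clinear_form_zero clinear_form_add)

lemma clinear_sum: "clinear f \<Longrightarrow> f (\<Sum>i\<in>I. g i) = (\<Sum>i\<in>I. f (g i))"
  by (induction I rule: infinite_finite_induct) (auto simp: clinear_zero clinear_add)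

definition hom_polys :: "nat \<Rightarrow> ('v::unitary_space \<Rightarrow> complex) set" where
  "hom_polys d = {f \<in> poly_funs. \<forall>c v. f (c *\<^sub>C v) = c ^ d * f v}"

lemma hom_polysD: "f \<in> hom_polys d \<Longrightarrow> f (c *\<^sub>C v) = c ^ d * f v"
  and hom_polys_poly: "f \<in> hom_polys d \<Longrightarrow> f \<in> poly_funs"
  by (auto simp: hom_polys_def)

lemma hom_polys_zero: "(\<lambda>_. 0) \<in> hom_polys d"
  by (auto simp: hom_polys_def intro: poly_funs.const)

lemma hom_polys_const: "(\<lambda>_. c) \<in> hom_polys 0"
  by (auto simp: hom_polys_def intro: poly_funs.const)

lemma hom_polys_linear: "clinear_form f \<Longrightarrow> f \<in> hom_polys 1"
  by (auto simp: hom_polys_def clinear_form_scale intro: poly_funs.linear)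

lemma hom_polys_add: "f \<in> hom_polys d \<Longrightarrow> g \<in> hom_polys d \<Longrightarrow> (\<lambda>v. f v + g v) \<in> hom_polys d"
  by (auto simp: hom_polys_def algebra_simps intro: poly_funs.add)

lemma hom_polys_diff: "f \<in> hom_polys d \<Longrightarrow> g \<in> hom_polys d \<Longrightarrow> (\<lambda>v. f v - g v) \<in> hom_polys d"
  by (auto simp: hom_polys_def algebra_simps intro: poly_funs_diff)

lemma hom_polys_mult:
  "f \<in> hom_polys d \<Longrightarrow> g \<in> hom_polys e \<Longrightarrow> (\<lambda>v. f v * g v) \<in> hom_polys (d + e)"
  by (auto simp: hom_polys_def power_add intro: poly_funs.mult)

lemma hom_polys_cmult: "f \<in> hom_polys d \<Longrightarrow> (\<lambda>v. c * f v) \<in> hom_polys d"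
  using hom_polys_mult[OF hom_polys_const] by fastforce

lemma hom_polys_sum:
  "(\<And>i. i \<in> I \<Longrightarrow> f i \<in> hom_polys d) \<Longrightarrow> (\<lambda>v. \<Sum>i\<in>I. f i v) \<in> hom_polys d"
  by (induction I rule: infinite_finite_induct) (auto intro: hom_polys_add hom_polys_zero)

lemma hom_polys_power: "f \<in> hom_polys d \<Longrightarrow> (\<lambda>v. f v ^ n) \<in> hom_polys (d * n)"
  by (auto simp: hom_polys_def power_mult_distrib power_mult intro: poly_funs_power)

lemma hom_polys_prod:
  "(\<And>i. i \<in> I \<Longrightarrow> f i \<in> hom_polys (d i)) \<Longrightarrow> (\<lambda>v. \<Prod>i\<in>I. f i v) \<in> hom_polys (\<Sum>i\<in>I. d i)"
  by (induction I rule: infinite_finite_induct) (auto intro: hom_polys_mult hom_polys_const)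

lemma hom_polys_compose: "f \<in> hom_polys d \<Longrightarrow> clinear g \<Longrightarrow> (\<lambda>v. f (g v)) \<in> hom_polys d"
  by (auto simp: hom_polys_def clinear_scale intro: poly_funs_compose)

lemma hom_polys_0_const: "f \<in> hom_polys 0 \<Longrightarrow> f v = f 0"
  using hom_polysD[of f 0 0 v] by simp

text \<open>
  A quotient of homogeneous polynomials is homogeneous. The scaling law first holds for nonzero
  scalars at points where the divisor does not vanish; the rest is continuation of polynomial
  identities.
\<close>

lemma hom_polys_divide:
  assumes h: "h \<in> hom_polys (d + n)" and j: "j \<in> hom_polys n" and q: "q \<in> poly_funs"
    and eq: "\<And>v. h v = j v * q v" and nz: "\<exists>v. j v \<noteq> 0"
  shows "q \<in> hom_polys d"
proof -
  have *: "q (c *\<^sub>C v) = c ^ d * q v" if "c \<noteq> 0" for c v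
  proof -
    have "(\<lambda>v. q (c *\<^sub>C v)) = (\<lambda>v. c ^ d * q v)"
    proof (rule poly_funs_eqI[OF _ _ hom_polys_poly[OF j] nz])
      show "(\<lambda>v. q (c *\<^sub>C v)) \<in> poly_funs"
        by (rule poly_funs_compose[OF q], rule clinearI)
          (simp_all add: scaleC_add_right scaleC_scaleC mult.commute)
      fix v assume "j v \<noteq> 0"
      moreover have "c ^ n * (j v * q (c *\<^sub>C v)) = c ^ n * (j v * (c ^ d * q v))"
      proof -
        have "c ^ n * (j v * q (c *\<^sub>C v)) = h (c *\<^sub>C v)"
          using eq[of "c *\<^sub>C v"] hom_polysD[OF j, of c v] by (metis mult.assoc)
        also have "\<dots> = c ^ (d + n) * (j v * q v)"
          using eq[of v] hom_polysD[OF h, of c v] by metis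
        finally show ?thesis by (simp only: power_add mult_ac)
      qed
      ultimately show "q (c *\<^sub>C v) = c ^ d * q v"
        using that by (metis mult_left_cancel power_not_zero)
    qed (rule poly_funs_cmult[OF q])
    then show ?thesis by metis
  qed
  have "q (c *\<^sub>C v) = c ^ d * q v" for c v
  proof -
    obtain p where p: "\<And>t. q (0 + t *\<^sub>C v) = poly p t" using poly_funs_line[OF q] by blast
    have "p = monom (q v) d"
    proof (rule ccontr)
      assume "p \<noteq> monom (q v) d"
      then obtain t where "t \<notin> {0}" "poly (p - monom (q v) d) t \<noteq> 0"
        using poly_nonzero_at_cofinite[of "p - monom (q v) d" "{0}"] by auto
      then show False using p[of t] *[of t v] by (simp add: poly_monom mult.commute)
    qed
    then show ?thesis using p[of c] by (simp add: poly_monom mult.commute)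
  qed
  then show ?thesis using q by (auto simp: hom_polys_def)
qed

text \<open>
  The same graded pieces, built up from products of linear forms; in this description it is clear
  that they are finite-dimensional and that they span the polynomial ring.
\<close>

inductive form_expression :: "nat \<Rightarrow> ('v::unitary_space \<Rightarrow> complex) \<Rightarrow> bool" where
  const: "form_expression 0 (\<lambda>_. c)"
| mult: "clinear_form l \<Longrightarrow> form_expression d f \<Longrightarrow> form_expression (Suc d) (\<lambda>v. l v * f v)"
| add: "form_expression d f \<Longrightarrow> form_expression d g \<Longrightarrow> form_expression d (\<lambda>v. f v + g v)"

definition hom_span :: "nat \<Rightarrow> ('v::unitary_space \<Rightarrow> complex) set" where
  "hom_span d = {f. form_expression d f}"

lemma hom_span_const: "(\<lambda>_. c) \<in> hom_span 0"
  and hom_span_lmult: "clinear_form l \<Longrightarrow> f \<in> hom_span d \<Longrightarrow> (\<lambda>v. l v * f v) \<in> hom_span (Suc d)"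
  and hom_span_add: "f \<in> hom_span d \<Longrightarrow> g \<in> hom_span d \<Longrightarrow> (\<lambda>v. f v + g v) \<in> hom_span d"
  by (auto simp: hom_span_def intro: form_expression.intros)

lemma hom_span_induct [consumes 1, case_names const mult add]:
  assumes "f \<in> hom_span d"
    and "\<And>c. P 0 (\<lambda>_. c)"
    and "\<And>l f d. clinear_form l \<Longrightarrow> f \<in> hom_span d \<Longrightarrow> P d f \<Longrightarrow> P (Suc d) (\<lambda>v. l v * f v)"
    and "\<And>d f g. f \<in> hom_span d \<Longrightarrow> P d f \<Longrightarrow> g \<in> hom_span d \<Longrightarrow> P d g \<Longrightarrow> P d (\<lambda>v. f v + g v)"
  shows "P d f"
  using assms(1) unfolding hom_span_def mem_Collect_eq
  by (induction rule: form_expression.induct) (use assms in \<open>auto simp: hom_span_def\<close>)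

lemma hom_span_hom: "f \<in> hom_span d \<Longrightarrow> f \<in> hom_polys d"
proof (induction rule: hom_span_induct)
  case (mult l f d)
  then show ?case using hom_polys_mult[OF hom_polys_linear, of l f d] by simp
qed (auto intro: hom_polys_const hom_polys_add)

lemma clinear_form_0: "clinear_form (\<lambda>_. 0)"
  by (rule clinear_formI) auto

lemma hom_span_zero: "(\<lambda>_. 0) \<in> hom_span d"
proof (induction d)
  case 0
  then show ?case by (rule hom_span_const)
next
  case (Suc d)
  then show ?case using hom_span_lmult[OF clinear_form_0] by fastforce
qed

lemma hom_span_mult:
  assumes "f \<in> hom_span d" "g \<in> hom_span e"
  shows "(\<lambda>v. f v * g v) \<in> hom_span (d + e)"
  using assms
proof (induction rule: hom_span_induct)
  case (const c)
  from const show ?case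
  proof (induction rule: hom_span_induct)
    case (const c')
    show ?case using hom_span_const[of "c * c'"] by simp
  next
    case (mult l f d)
    then show ?case using hom_span_lmult[of l "\<lambda>v. c * f v" d] by (simp add: mult_ac)
  next
    case (add d f g)
    then show ?case using hom_span_add[of "\<lambda>v. c * f v" d "\<lambda>v. c * g v"] by (simp add: algebra_simps)
  qed
next
  case (mult l f d)
  then show ?case using hom_span_lmult[of l "\<lambda>v. f v * g v" "d + e"] by (simp add: mult_ac)
next
  case (add d f f')
  then show ?case
    using hom_span_add[of "\<lambda>v. f v * g v" "d + e" "\<lambda>v. f' v * g v"] by (simp add: algebra_simps)
qed

lemma hom_span_sum:
  "(\<And>i. i \<in> I \<Longrightarrow> f i \<in> hom_span d) \<Longrightarrow> (\<lambda>v. \<Sum>i\<in>I. f i v) \<in> hom_span d"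
  by (induction I rule: infinite_finite_induct) (auto intro: hom_span_add hom_span_zero)

text \<open>
  The homogeneous components of \<open>f\<close> are the coefficients of \<open>t \<mapsto> f (t v)\<close>, a polynomial in one
  variable whose coefficients depend on \<open>v\<close>.
\<close>

lemma homogeneous_components:
  fixes f :: "'v::unitary_space \<Rightarrow> complex"
  assumes "f \<in> poly_funs"
  shows "\<exists>F n. (\<forall>k. F k \<in> hom_span k) \<and> (\<forall>k\<ge>n. F k = (\<lambda>_. 0)) \<and>
    (\<forall>v. \<exists>p. (\<forall>c. f (c *\<^sub>C v) = poly p c) \<and> (\<forall>k. coeff p k = F k v))"
  using assms
proof (induction rule: poly_funs.induct)
  case (const c)
  show ?case
  proof (intro exI conjI allI impI)
    fix v :: 'v and k and x :: complex
    show "(if k = 0 then (\<lambda>_. c) else (\<lambda>_. 0)) \<in> (hom_span k :: ('v \<Rightarrow> complex) set)"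
      by (auto intro: hom_span_const hom_span_zero)
    show "1 \<le> k \<Longrightarrow> (if k = 0 then (\<lambda>_. c) else (\<lambda>_. 0)) = ((\<lambda>_. 0) :: 'v \<Rightarrow> complex)" by simp
    show "c = poly [:c:] x" by simp
    show "coeff [:c:] k = (if k = 0 then (\<lambda>_. c) else (\<lambda>_. 0)) v" by (cases k) auto
  qed
next
  case (linear f)
  show ?case
  proof (intro exI conjI allI impI)
    fix v :: 'v and k and x :: complex
    show "(if k = 1 then f else (\<lambda>_. 0)) \<in> hom_span k"
      using hom_span_lmult[OF linear hom_span_const[of 1]] hom_span_zero by auto
    show "2 \<le> k \<Longrightarrow> (if k = 1 then f else (\<lambda>_. 0)) = (\<lambda>_. 0)" by simp
    show "f (x *\<^sub>C v) = poly (monom (f v) 1) x"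
      by (simp add: poly_monom clinear_form_scale[OF linear])
    show "coeff (monom (f v) 1) k = (if k = 1 then f else (\<lambda>_. 0)) v" by simp
  qed
next
  case (add f g)
  then obtain F G m n where F: "\<And>k. F k \<in> hom_span k" "\<And>k. k \<ge> m \<Longrightarrow> F k = (\<lambda>_. 0)"
      "\<forall>v. \<exists>p. (\<forall>c. f (c *\<^sub>C v) = poly p c) \<and> (\<forall>k. coeff p k = F k v)"
    and G: "\<And>k. G k \<in> hom_span k" "\<And>k. k \<ge> n \<Longrightarrow> G k = (\<lambda>_. 0)"
      "\<forall>v. \<exists>p. (\<forall>c. g (c *\<^sub>C v) = poly p c) \<and> (\<forall>k. coeff p k = G k v)" by blast
  show ?case
  proof (intro exI[of _ "\<lambda>k v. F k v + G k v"] exI[of _ "max m n"] conjI allI impI)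
    show "(\<lambda>v. F k v + G k v) \<in> hom_span k" for k using F(1) G(1) by (rule hom_span_add)
    show "max m n \<le> k \<Longrightarrow> (\<lambda>v. F k v + G k v) = (\<lambda>_. 0)" for k using F(2) G(2) by simp
    fix v
    obtain p q where "\<And>c. f (c *\<^sub>C v) = poly p c" "\<And>k. coeff p k = F k v"
      "\<And>c. g (c *\<^sub>C v) = poly q c" "\<And>k. coeff q k = G k v" using F(3) G(3) by metis
    then show "\<exists>p. (\<forall>c. f (c *\<^sub>C v) + g (c *\<^sub>C v) = poly p c) \<and> (\<forall>k. coeff p k = F k v + G k v)"
      by (intro exI[of _ "p + q"]) simp
  qed
next
  case (mult f g)
  then obtain F G m n where F: "\<And>k. F k \<in> hom_span k" "\<And>k. k \<ge> m \<Longrightarrow> F k = (\<lambda>_. 0)"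
      "\<forall>v. \<exists>p. (\<forall>c. f (c *\<^sub>C v) = poly p c) \<and> (\<forall>k. coeff p k = F k v)"
    and G: "\<And>k. G k \<in> hom_span k" "\<And>k. k \<ge> n \<Longrightarrow> G k = (\<lambda>_. 0)"
      "\<forall>v. \<exists>p. (\<forall>c. g (c *\<^sub>C v) = poly p c) \<and> (\<forall>k. coeff p k = G k v)" by blast
  show ?case
  proof (intro exI[of _ "\<lambda>k v. \<Sum>i\<le>k. F i v * G (k - i) v"] exI[of _ "m + n"] conjI allI impI)
    show "(\<lambda>v. \<Sum>i\<le>k. F i v * G (k - i) v) \<in> hom_span k" for k
    proof (rule hom_span_sum)
      fix i assume "i \<in> {..k}"
      then show "(\<lambda>v. F i v * G (k - i) v) \<in> hom_span k"
        using hom_span_mult[OF F(1)[of i] G(1)[of "k - i"]] by simp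
    qed
    show "(\<lambda>v. \<Sum>i\<le>k. F i v * G (k - i) v) = (\<lambda>_. 0)" if "m + n \<le> k" for k
    proof (intro ext sum.neutral ballI)
      fix v i
      have "i \<ge> m \<or> k - i \<ge> n" using that by linarith
      then show "F i v * G (k - i) v = 0" using F(2) G(2) by auto
    qed
    fix v
    obtain p q where "\<And>c. f (c *\<^sub>C v) = poly p c" "\<And>k. coeff p k = F k v"
      "\<And>c. g (c *\<^sub>C v) = poly q c" "\<And>k. coeff q k = G k v" using F(3) G(3) by metis
    then show "\<exists>p. (\<forall>c. f (c *\<^sub>C v) * g (c *\<^sub>C v) = poly p c) \<and>
        (\<forall>k. coeff p k = (\<Sum>i\<le>k. F i v * G (k - i) v))"
      by (intro exI[of _ "p * q"]) (simp add: coeff_mult)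
  qed
qed

lemma hom_polys_eq_hom_span: "hom_polys d = (hom_span d :: ('v::unitary_space \<Rightarrow> complex) set)"
proof
  show "hom_span d \<subseteq> (hom_polys d :: ('v::unitary_space \<Rightarrow> complex) set)" using hom_span_hom by blast
  show "hom_polys d \<subseteq> (hom_span d :: ('v::unitary_space \<Rightarrow> complex) set)"
  proof
    fix f :: "'v::unitary_space \<Rightarrow> complex" assume f: "f \<in> hom_polys d"
    obtain F where F: "\<And>k. F k \<in> hom_span k"
      "\<And>v. \<exists>p. (\<forall>c. f (c *\<^sub>C v) = poly p c) \<and> (\<forall>k. coeff p k = F k v)"
      using homogeneous_components[OF hom_polys_poly[OF f]] by blast
    have "f v = F d v" for v
    proof -
      obtain p where p: "\<And>c. f (c *\<^sub>C v) = poly p c" "\<And>k. coeff p k = F k v" using F(2) by metis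
      have "poly p c = poly (monom (f v) d) c" for c
        using p(1)[of c] hom_polysD[OF f, of c v] by (simp add: poly_monom mult.commute)
      then have "p = monom (f v) d" by (simp add: poly_eq_poly_eq_iff[symmetric] fun_eq_iff)
      then show ?thesis using p(2)[of d] by simp
    qed
    then have "f = F d" by blast
    then show "f \<in> hom_span d" using F(1) by simp
  qed
qed

lemma poly_funs_sum_homogeneous:
  assumes "f \<in> poly_funs"
  shows "\<exists>F n. (\<forall>k. F k \<in> hom_polys k) \<and> f = (\<lambda>v. \<Sum>k<n. F k v)"
proof -
  obtain F n where F: "\<And>k. F k \<in> hom_span k" "\<And>k. k \<ge> n \<Longrightarrow> F k = (\<lambda>_. 0)"
    "\<forall>v. \<exists>p. (\<forall>c. f (c *\<^sub>C v) = poly p c) \<and> (\<forall>k. coeff p k = F k v)"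
    using homogeneous_components[OF assms] by blast
  have "f v = (\<Sum>k<n. F k v)" for v
  proof -
    obtain p where p: "\<And>c. f (c *\<^sub>C v) = poly p c" "\<And>k. coeff p k = F k v" using F(3) by metis
    have "f v = poly p 1" using p(1)[of 1] by (simp add: scaleC_one)
    also have "\<dots> = (\<Sum>k\<le>degree p. coeff p k)" by (simp add: poly_altdef)
    also have "\<dots> = (\<Sum>k<n. coeff p k)"
    proof (rule sum.mono_neutral_cong)
      show "coeff p k = 0" if "k \<in> {..degree p} - {..<n}" for k
        using that p(2) F(2) by simp
      show "coeff p k = 0" if "k \<in> {..<n} - {..degree p}" for k
        using that by (simp add: coeff_eq_0)
    qed auto
    finally show ?thesis using p(2) by simp
  qed
  then show ?thesis using F(1) hom_polys_eq_hom_span by blast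
qed

text \<open>
  The products of coordinate functions with the generators of one degree generate the next degree.
\<close>

lemma hom_polys_finite_dimensional:
  "\<exists>G. finite G \<and> G \<subseteq> hom_polys d \<and>
    (\<forall>f\<in>hom_polys d. \<exists>c. f = (\<lambda>v::'v::unitary_space. \<Sum>g\<in>G. c g * g v))"
proof -
  define lc :: "('v \<Rightarrow> complex) set \<Rightarrow> ('v \<Rightarrow> complex) set"
    where "lc = (\<lambda>G. {f. \<exists>c. f = (\<lambda>v. \<Sum>g\<in>G. c g * g v)})"
  have lc_add: "(\<lambda>v. f v + g v) \<in> lc G" if fg: "f \<in> lc G" "g \<in> lc G" for f g G
  proof -
    obtain a where "f = (\<lambda>v. \<Sum>g\<in>G. a g * g v)" using fg(1) unfolding lc_def by blast
    moreover obtain b where "g = (\<lambda>v. \<Sum>g\<in>G. b g * g v)" using fg(2) unfolding lc_def by blast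
    ultimately show ?thesis unfolding lc_def
      by (intro CollectI exI[of _ "\<lambda>g. a g + b g"]) (simp add: sum.distrib algebra_simps)
  qed
  have lc_cmult: "(\<lambda>v. x * f v) \<in> lc G" if f: "f \<in> lc G" for f x G
  proof -
    obtain a where "f = (\<lambda>v. \<Sum>g\<in>G. a g * g v)" using f unfolding lc_def by blast
    then show ?thesis unfolding lc_def
      by (intro CollectI exI[of _ "\<lambda>g. x * a g"]) (simp add: sum_distrib_left algebra_simps)
  qed
  have lc_sum: "(\<lambda>v. \<Sum>i\<in>I. f i v) \<in> lc G" if "\<And>i. i \<in> I \<Longrightarrow> f i \<in> lc G"
    for f and I :: "'i set" and G
    using that
  proof (induction I rule: infinite_finite_induct)
    case (infinite A)
    then show ?case by (auto simp: lc_def intro: exI[of _ "\<lambda>_. 0"])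
  next
    case empty
    then show ?case by (auto simp: lc_def intro: exI[of _ "\<lambda>_. 0"])
  next
    case (insert x F)
    then show ?case using lc_add by auto
  qed
  have lc_base: "f \<in> lc G" if "f \<in> G" "finite G" for f G
  proof -
    have "(\<Sum>g\<in>G. (if g = f then 1 else 0) * g v) = f v" for v
    proof -
      have "(\<Sum>g\<in>G. (if g = f then 1 else 0) * g v) = (\<Sum>g\<in>G. if g = f then f v else 0)"
        by (rule sum.cong) auto
      then show ?thesis using that by simp
    qed
    then show ?thesis unfolding lc_def
      by (intro CollectI exI[of _ "\<lambda>g. if g = f then 1 else 0"]) (simp add: fun_eq_iff)
  qed
  obtain B :: "'v set" where B: "basis_of_space B" using basis_of_space_exists by blast
  let ?x = "\<lambda>b v. complex_vector.representation B v b"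
  have "\<exists>G. finite G \<and> G \<subseteq> hom_polys d \<and> hom_span d \<subseteq> lc G"
  proof (induction d)
    case 0
    have "f \<in> lc {\<lambda>_. 1}" if "f \<in> hom_polys 0" for f
      using hom_polys_0_const[OF that] unfolding lc_def
      by (intro CollectI exI[of _ "\<lambda>_. f 0"]) (simp add: fun_eq_iff)
    then show ?case using hom_polys_const[of 1] hom_span_hom
      by (intro exI[of _ "{\<lambda>_. 1}"]) auto
  next
    case (Suc d)
    then obtain G where G: "finite G" "G \<subseteq> hom_polys d" "hom_span d \<subseteq> lc G" by blast
    let ?m = "\<lambda>(b, g) v. ?x b v * g v"
    let ?G = "?m ` (B \<times> G)"
    have fin: "finite ?G" using G basis_of_space_finite[OF B] by auto
    have "f \<in> lc ?G" if "f \<in> hom_span n" "n = Suc d" for f n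
      using that
    proof (induction rule: hom_span_induct)
      case (const c)
      then show ?case by simp
    next
      case (mult l f e)
      then obtain c where c: "f = (\<lambda>v. \<Sum>g\<in>G. c g * g v)" using G(3) by (auto simp: lc_def)
      have l: "l v = (\<Sum>b\<in>B. ?x b v * l b)" for v
        by (subst basis_of_space_expansion[OF B, of v])
          (simp add: clinear_form_sum[OF mult(1)] clinear_form_scale[OF mult(1)])
      have "(\<lambda>v. l v * f v) = (\<lambda>v. \<Sum>b\<in>B. \<Sum>g\<in>G. (l b * c g) * (?x b v * g v))"
      proof
        fix v
        have "l v * f v = (\<Sum>b\<in>B. ?x b v * l b) * (\<Sum>g\<in>G. c g * g v)"
          by (rule arg_cong2[where f = "(*)", OF l fun_cong[OF c]])
        also have "\<dots> = (\<Sum>b\<in>B. \<Sum>g\<in>G. (?x b v * l b) * (c g * g v))"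
          by (rule sum_product)
        finally show "l v * f v = (\<Sum>b\<in>B. \<Sum>g\<in>G. (l b * c g) * (?x b v * g v))"
          by (simp only: mult_ac)
      qed
      also have "\<dots> \<in> lc ?G"
      proof (intro lc_sum lc_cmult)
        fix b g assume "b \<in> B" "g \<in> G"
        then have "?m (b, g) \<in> ?G" by blast
        then show "(\<lambda>v. ?x b v * g v) \<in> lc ?G" using lc_base[OF _ fin] by auto
      qed
      finally show ?case .
    next
      case (add d f g)
      then show ?case using lc_add by blast
    qed
    moreover have "?G \<subseteq> hom_polys (Suc d)"
      using hom_polys_mult[OF hom_polys_linear[OF coordinate_linear[OF B]], of _ d] G(2) by fastforce
    ultimately show ?case using fin by blast
  qed
  then show ?thesis unfolding hom_polys_eq_hom_span lc_def by blast
qed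

section \<open>Determinants of endomorphisms\<close>

text \<open>
  The product rule for determinants. Expanding the product of the row sums gives a sum over all maps
  \<open>\<phi>\<close> of the index set to itself; if \<open>\<phi>\<close> is not injective, the remaining sum over permutations
  changes its sign under the transposition of two indices with the same image.
\<close>

lemma leibniz_sum_mult:
  fixes F G :: "'b \<Rightarrow> 'b \<Rightarrow> complex"
  assumes B: "finite B"
  shows "(\<Sum>p | p permutes B. of_int (sign p) * (\<Prod>b\<in>B. \<Sum>c\<in>B. G b c * F c (p b))) =
    (\<Sum>p | p permutes B. of_int (sign p) * (\<Prod>b\<in>B. G b (p b))) *
    (\<Sum>p | p permutes B. of_int (sign p) * (\<Prod>b\<in>B. F b (p b)))"
proof -
  let ?P = "{p. p permutes B}"
  let ?E = "B \<rightarrow>\<^sub>E B"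
  define D where "D = (\<lambda>\<phi>. \<Sum>p\<in>?P. of_int (sign p) * (\<Prod>b\<in>B. F (\<phi> b) (p b)))"
  have perm: "permutation p" if "p permutes B" for p
    using that B by (auto simp: permutation_permutes)
  have D_noninj: "D \<phi> = 0" if "\<not> inj_on \<phi> B" for \<phi>
  proof -
    obtain i j where ij: "i \<in> B" "j \<in> B" "i \<noteq> j" "\<phi> i = \<phi> j"
      using \<open>\<not> inj_on \<phi> B\<close> by (auto simp: inj_on_def)
    let ?t = "Transposition.transpose i j"
    have t: "?t permutes B" using ij by (simp add: permutes_swap_id)
    have "D \<phi> = (\<Sum>p\<in>?P. of_int (sign (p \<circ> ?t)) * (\<Prod>b\<in>B. F (\<phi> b) ((p \<circ> ?t) b)))"
      unfolding D_def by (rule sum_permutations_compose_right[OF t])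
    also have "\<dots> = (\<Sum>p\<in>?P. - (of_int (sign p) * (\<Prod>b\<in>B. F (\<phi> b) (p b))))"
    proof (rule sum.cong[OF refl])
      fix p assume "p \<in> ?P"
      then have p: "permutation p" using perm by blast
      have sgn: "sign (p \<circ> ?t) = - sign p"
        using sign_compose[OF p perm[OF t]] ij by (simp add: sign_swap_id)
      have "(\<Prod>b\<in>B. F (\<phi> b) (p b)) = (\<Prod>b\<in>B. F (\<phi> (?t b)) (p (?t b)))"
        using prod.permute[OF t, of "\<lambda>b. F (\<phi> b) (p b)"] by (simp add: o_def)
      also have "\<dots> = (\<Prod>b\<in>B. F (\<phi> b) ((p \<circ> ?t) b))"
      proof (rule prod.cong[OF refl])
        fix b
        have "\<phi> (?t b) = \<phi> b" using ij by (simp add: Transposition.transpose_def)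
        then show "F (\<phi> (?t b)) (p (?t b)) = F (\<phi> b) ((p \<circ> ?t) b)" by simp
      qed
      finally show "of_int (sign (p \<circ> ?t)) * (\<Prod>b\<in>B. F (\<phi> b) ((p \<circ> ?t) b)) =
          - (of_int (sign p) * (\<Prod>b\<in>B. F (\<phi> b) (p b)))"
        unfolding sgn by simp
    qed
    also have "\<dots> = - D \<phi>" by (simp add: D_def sum_negf)
    finally show ?thesis by simp
  qed
  have D_perm: "D (restrict q B) = of_int (sign q) * D id" if q: "q permutes B" for q
  proof -
    have "D (restrict q B) = (\<Sum>p\<in>?P. of_int (sign p) * (\<Prod>b\<in>B. F (q b) (p b)))"
      unfolding D_def by simp
    also have "\<dots> = (\<Sum>p\<in>?P. of_int (sign (p \<circ> q)) * (\<Prod>b\<in>B. F (q b) ((p \<circ> q) b)))"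
      by (rule sum_permutations_compose_right[OF q])
    also have "\<dots> = (\<Sum>p\<in>?P. of_int (sign q) * (of_int (sign p) * (\<Prod>b\<in>B. F (id b) (p b))))"
    proof (rule sum.cong[OF refl])
      fix p assume "p \<in> ?P"
      then have "sign (p \<circ> q) = sign p * sign q"
        using sign_compose[OF perm perm[OF q]] by blast
      moreover have "(\<Prod>b\<in>B. F (q b) ((p \<circ> q) b)) = (\<Prod>b\<in>B. F (id b) (p b))"
        using prod.permute[OF q, of "\<lambda>b. F b (p b)"] by (simp add: o_def)
      ultimately show "of_int (sign (p \<circ> q)) * (\<Prod>b\<in>B. F (q b) ((p \<circ> q) b)) =
          of_int (sign q) * (of_int (sign p) * (\<Prod>b\<in>B. F (id b) (p b)))" by simp
    qed
    also have "\<dots> = of_int (sign q) * D id"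
      by (simp add: D_def sum_distrib_left)
    finally show ?thesis .
  qed
  have "(\<Sum>p\<in>?P. of_int (sign p) * (\<Prod>b\<in>B. \<Sum>c\<in>B. G b c * F c (p b))) =
      (\<Sum>p\<in>?P. \<Sum>\<phi>\<in>?E. (\<Prod>b\<in>B. G b (\<phi> b)) * (of_int (sign p) * (\<Prod>b\<in>B. F (\<phi> b) (p b))))"
    by (subst prod_sum_PiE) (auto simp: B sum_distrib_left prod.distrib mult_ac)
  also have "\<dots> = (\<Sum>\<phi>\<in>?E. (\<Prod>b\<in>B. G b (\<phi> b)) * D \<phi>)"
    by (subst sum.swap) (simp add: D_def sum_distrib_left)
  also have "\<dots> = (\<Sum>\<phi>\<in>(\<lambda>q. restrict q B) ` ?P. (\<Prod>b\<in>B. G b (\<phi> b)) * D \<phi>)"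
  proof (rule sum.mono_neutral_right)
    show "finite ?E" using B by (simp add: finite_PiE)
    show "(\<lambda>q. restrict q B) ` ?P \<subseteq> ?E" by (auto simp: permutes_in_image)
    show "\<forall>\<phi>\<in>?E - (\<lambda>q. restrict q B) ` ?P. (\<Prod>b\<in>B. G b (\<phi> b)) * D \<phi> = 0"
    proof
      fix \<phi> assume \<phi>: "\<phi> \<in> ?E - (\<lambda>q. restrict q B) ` ?P"
      have "\<not> inj_on \<phi> B"
      proof
        assume "inj_on \<phi> B"
        moreover have "\<phi> ` B \<subseteq> B" using \<phi> by auto
        ultimately have "bij_betw \<phi> B B" using B by (simp add: bij_betw_def endo_inj_surj)
        then have "(\<lambda>x. if x \<in> B then \<phi> x else x) permutes B"
          by (intro bij_imp_permutes) (auto cong: bij_betw_cong)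
        moreover have "\<phi> = restrict (\<lambda>x. if x \<in> B then \<phi> x else x) B"
          using \<phi> by (intro ext) (simp add: PiE_def extensional_def)
        ultimately show False using \<phi> by blast
      qed
      then show "(\<Prod>b\<in>B. G b (\<phi> b)) * D \<phi> = 0" using D_noninj by simp
    qed
  qed
  also have "\<dots> = (\<Sum>q\<in>?P. (\<Prod>b\<in>B. G b (q b)) * D (restrict q B))"
  proof (subst sum.reindex)
    show "inj_on (\<lambda>q. restrict q B) ?P"
    proof (rule inj_onI, rule ext)
      fix p q x assume "p \<in> ?P" "q \<in> ?P" "restrict p B = restrict q B"
      then show "p x = q x"
        by (cases "x \<in> B") (metis restrict_apply', auto simp: permutes_not_in)
    qed
  qed auto
  also have "\<dots> = (\<Sum>q\<in>?P. of_int (sign q) * (\<Prod>b\<in>B. G b (q b))) * D id"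
    unfolding sum_distrib_right by (rule sum.cong) (simp_all add: D_perm mult_ac)
  finally show ?thesis by (simp add: D_def)
qed

definition det_basis :: "'v::unitary_space set" where
  "det_basis = (SOME B. basis_of_space B)"

lemma det_basis: "basis_of_space det_basis"
  unfolding det_basis_def by (rule someI_ex) (rule basis_of_space_exists)

lemma cdet_alt: "cdet f = (\<Sum>p | p permutes det_basis. of_int (sign p) *
    (\<Prod>b\<in>det_basis. complex_vector.representation det_basis (f b) (p b)))"
  by (simp add: cdet_def det_basis_def Let_def)

lemma cdet_compose:
  assumes f: "clinear f" and g: "clinear g"
  shows "cdet (\<lambda>v. f (g v)) = cdet f * cdet g"
proof -
  let ?B = det_basis
  let ?r = "complex_vector.representation (?B :: 'a set)"
  have "?r (f (g b)) d = (\<Sum>c\<in>?B. ?r (g b) c * ?r (f c) d)" for b d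
  proof -
    have "f (g b) = f (\<Sum>c\<in>?B. ?r (g b) c *\<^sub>C c)"
      using basis_of_space_expansion[OF det_basis, of "g b"] by simp
    also have "\<dots> = (\<Sum>c\<in>?B. ?r (g b) c *\<^sub>C f c)"
      by (simp add: clinear_sum[OF f] clinear_scale[OF f])
    finally show ?thesis
      by (simp add: clinear_form_sum[OF coordinate_linear[OF det_basis]]
          clinear_form_scale[OF coordinate_linear[OF det_basis]])
  qed
  then show ?thesis
    unfolding cdet_alt
    using leibniz_sum_mult[OF basis_of_space_finite[OF det_basis],
        of "\<lambda>b c. ?r (g b) c" "\<lambda>c d. ?r (f c) d"] by (simp add: mult.commute)
qed

lemma cdet_diagonal:
  assumes f: "\<And>b. b \<in> det_basis \<Longrightarrow> f b = c b *\<^sub>C b"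
  shows "cdet f = (\<Prod>b\<in>det_basis. c b)"
proof -
  let ?B = "det_basis :: 'a set"
  let ?r = "complex_vector.representation ?B"
  have fin: "finite ?B" by (rule basis_of_space_finite[OF det_basis])
  have ind: "complex_vector.independent ?B" "\<And>v. v \<in> complex_vector.span ?B"
    using det_basis unfolding basis_of_space_def by auto
  have r: "?r (f b) d = (if b = d then c b else 0)" if "b \<in> ?B" for b d
    using that f ind by (simp add: complex_vector.representation_scale complex_vector.representation_basis)
  have "cdet f = (\<Sum>p\<in>{id}. of_int (sign p) * (\<Prod>b\<in>?B. ?r (f b) (p b)))"
    unfolding cdet_alt
  proof (rule sum.mono_neutral_right)
    show "finite {p. p permutes ?B}" using fin by (rule finite_permutations)
    show "{id} \<subseteq> {p. p permutes ?B}" by (simp add: permutes_id)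
    show "\<forall>p\<in>{p. p permutes ?B} - {id}. of_int (sign p) * (\<Prod>b\<in>?B. ?r (f b) (p b)) = 0"
    proof
      fix p assume p: "p \<in> {p. p permutes ?B} - {id}"
      then obtain b where "b \<in> ?B" "p b \<noteq> b" by (auto simp: permutes_def fun_eq_iff)
      then have "\<exists>b\<in>?B. ?r (f b) (p b) = 0" using r by (intro bexI[of _ b]) auto
      then show "of_int (sign p) * (\<Prod>b\<in>?B. ?r (f b) (p b)) = 0" using fin by (simp add: prod_zero)
    qed
  qed
  then show ?thesis using r by simp
qed

lemma cdet_id: "cdet (\<lambda>v. v) = 1"
  by (subst cdet_diagonal[where c = "\<lambda>_. 1"]) (auto simp: scaleC_one)

text \<open>
  The determinant is multiplicative, hence invariant under conjugation; so the map may be moved by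
  a linear automorphism \<open>g\<close> that takes one basis vector to \<open>a\<close> and the others into the kernel of
  \<open>\<alpha>\<close>, and then it is diagonal.
\<close>

lemma cdet_complex_reflection:
  fixes a :: "'v::unitary_space"
  assumes \<alpha>: "clinear_form \<alpha>" and a: "\<alpha> a = 1"
    and s: "\<And>v. s v = v + (\<alpha> v * (z - 1)) *\<^sub>C a"
  shows "cdet s = z"
proof -
  let ?B = "det_basis :: 'v set"
  let ?r = "complex_vector.representation ?B"
  have fin: "finite ?B" by (rule basis_of_space_finite[OF det_basis])
  note expand = basis_of_space_expansion[OF det_basis]
  have ind: "complex_vector.independent ?B" "\<And>v. v \<in> complex_vector.span ?B"
    using det_basis unfolding basis_of_space_def by auto
  have rb: "?r b d = (if b = d then 1 else 0)" if "b \<in> ?B" for b d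
    using that ind by (simp add: complex_vector.representation_basis)
  have "\<exists>b0\<in>?B. ?r a b0 \<noteq> 0"
  proof (rule ccontr)
    assume "\<not> ?thesis"
    then have "a = 0" using expand[of a] by simp
    then show False using a clinear_form_zero[OF \<alpha>] by simp
  qed
  then obtain b0 where b0: "b0 \<in> ?B" "?r a b0 \<noteq> 0" by blast
  have lin_ext: "clinear (\<lambda>v. \<Sum>b\<in>?B. ?r v b *\<^sub>C x b)" for x :: "'v \<Rightarrow> 'v"
    by (rule clinearI)
      (simp_all add: ind complex_vector.representation_add complex_vector.representation_scale
        scaleC_add_left scaleC_scaleC sum.distrib complex_vector.scale_sum_right)
  have lin_ext_basis: "(\<Sum>c\<in>?B. ?r b c *\<^sub>C x c) = x b" if "b \<in> ?B" for x :: "'v \<Rightarrow> 'v" and b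
  proof -
    have "(\<Sum>c\<in>?B. ?r b c *\<^sub>C x c) = (\<Sum>c\<in>?B. if b = c then x c else 0)"
      by (rule sum.cong) (auto simp: rb that scaleC_one)
    then show ?thesis using that fin by simp
  qed
  define g where "g = (\<lambda>v. \<Sum>b\<in>?B. ?r v b *\<^sub>C (if b = b0 then a else b - \<alpha> b *\<^sub>C a))"
  define D where "D = (\<lambda>v. \<Sum>b\<in>?B. ?r v b *\<^sub>C (if b = b0 then z *\<^sub>C b else b))"
  have g: "clinear g" and D: "clinear D" unfolding g_def D_def by (rule lin_ext)+
  have gb: "g b = (if b = b0 then a else b - \<alpha> b *\<^sub>C a)" if "b \<in> ?B" for b
    unfolding g_def by (rule lin_ext_basis[OF that])
  have Db: "D b = (if b = b0 then z *\<^sub>C b else b)" if "b \<in> ?B" for b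
    unfolding D_def by (rule lin_ext_basis[OF that])
  have lin_s: "clinear s"
    unfolding s using \<alpha>
    by (intro clinearI)
      (simp_all add: clinear_form_add clinear_form_scale scaleC_add_right scaleC_scaleC
        distrib_right scaleC_add_left mult.assoc)
  interpret pair: vector_space_pair "scaleC :: complex \<Rightarrow> 'v \<Rightarrow> 'v" "scaleC :: complex \<Rightarrow> 'v \<Rightarrow> 'v"
    by unfold_locales
  have "surj g"
  proof -
    have sub: "complex_vector.subspace (range g)"
      by (rule pair.linear_subspace_image[OF g complex_vector.subspace_UNIV])
    have ra: "a \<in> range g" using gb[OF b0(1)] by (metis rangeI)
    have rb': "b \<in> range g" if "b \<in> ?B" "b \<noteq> b0" for b
    proof -
      have "b = g b + \<alpha> b *\<^sub>C a" using gb[of b] that by simp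
      then show ?thesis
        using complex_vector.subspace_add[OF sub rangeI complex_vector.subspace_scale[OF sub ra]] by metis
    qed
    have "a = ?r a b0 *\<^sub>C b0 + (\<Sum>b\<in>?B - {b0}. ?r a b *\<^sub>C b)"
      using expand[of a] sum.remove[OF fin b0(1), of "\<lambda>b. ?r a b *\<^sub>C b"] by simp
    then have "?r a b0 *\<^sub>C b0 = a - (\<Sum>b\<in>?B - {b0}. ?r a b *\<^sub>C b)" by (simp add: eq_diff_eq)
    also have "\<dots> \<in> range g"
      by (intro complex_vector.subspace_diff[OF sub] ra complex_vector.subspace_sum[OF sub]
          complex_vector.subspace_scale[OF sub] rb') auto
    finally have "inverse (?r a b0) *\<^sub>C (?r a b0 *\<^sub>C b0) \<in> range g"
      by (rule complex_vector.subspace_scale[OF sub])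
    then have "b0 \<in> range g" using b0 by (simp add: scaleC_scaleC scaleC_one)
    then have "?B \<subseteq> range g" using rb' by blast
    then have "complex_vector.span ?B \<subseteq> range g"
      using sub by (rule complex_vector.span_minimal)
    then show ?thesis using ind by blast
  qed
  obtain h where h: "clinear h" "g \<circ> h = id"
    using pair.linear_surjective_right_inverse[OF g \<open>surj g\<close>] by blast
  have "(\<lambda>v. g (h v)) = (\<lambda>v. v)" using h(2) by (auto simp: fun_eq_iff)
  then have unit: "cdet g * cdet h = 1" using cdet_compose[OF g h(1)] cdet_id by metis
  have basis: "s (g b) = g (D b)" if b: "b \<in> ?B" for b
  proof (cases "b = b0")
    case True
    have "s a = z *\<^sub>C a"
      using s[of a] a by (simp add: complex_vector.scale_left_diff_distrib scaleC_one)
    then show ?thesis using True gb[OF b] Db[OF b] by (simp add: clinear_scale[OF g])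
  next
    case False
    have "\<alpha> (b - \<alpha> b *\<^sub>C a) = 0" using \<alpha> a by (simp add: clinear_form_diff clinear_form_scale)
    then show ?thesis using False gb[OF b] Db[OF b] s by simp
  qed
  have "s (g v) = g (D v)" for v
    using arg_cong[OF expand[of v], of "\<lambda>v. s (g v)"] arg_cong[OF expand[of v], of "\<lambda>v. g (D v)"] basis
    by (simp add: clinear_sum[OF g] clinear_sum[OF D] clinear_sum[OF lin_s]
        clinear_scale[OF g] clinear_scale[OF D] clinear_scale[OF lin_s])
  then have "cdet s * cdet g = cdet g * cdet D"
    using cdet_compose[OF lin_s g] cdet_compose[OF g D] by presburger
  moreover have "cdet g \<noteq> 0" using unit by auto
  ultimately have "cdet s = cdet D" by (simp add: mult.commute)
  also have "\<dots> = (\<Prod>b\<in>?B. if b = b0 then z else 1)"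
    by (rule cdet_diagonal) (simp add: Db scaleC_one)
  also have "\<dots> = z" using b0 fin by simp
  finally show ?thesis .
qed

section \<open>Finite unitary reflection groups\<close>

text \<open>
  A name for the inverse of a map, as the symbol \<open>inv\<close> also denotes inverses in groups.
\<close>

abbreviation map_inv :: "('a \<Rightarrow> 'b) \<Rightarrow> 'b \<Rightarrow> 'a" where
  "map_inv \<equiv> Hilbert_Choice.inv"

lemma clinear_inv:
  assumes "clinear f" "bij f"
  shows "clinear (map_inv f)"
proof (rule clinearI)
  note [simp] = bij_is_surj[OF assms(2), THEN surj_f_inv_f] bij_is_inj[OF assms(2), THEN inv_f_f]
  fix x y c
  have "map_inv f (f (map_inv f x + map_inv f y)) = map_inv f (x + y)"
    by (subst clinear_add[OF assms(1)]) simp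
  then show "map_inv f (x + y) = map_inv f x + map_inv f y" by simp
  have "map_inv f (f (c *\<^sub>C map_inv f x)) = map_inv f (c *\<^sub>C x)"
    by (subst clinear_scale[OF assms(1)]) simp
  then show "map_inv f (c *\<^sub>C x) = c *\<^sub>C map_inv f x" by simp
qed

lemma group_GL: "group (GL :: ('v::unitary_space \<Rightarrow> 'v) monoid)"
proof (rule groupI)
  fix f g h :: "'v \<Rightarrow> 'v"
  assume f: "f \<in> carrier GL"
  show "\<exists>y\<in>carrier GL. y \<otimes>\<^bsub>GL\<^esub> f = \<one>\<^bsub>GL\<^esub>"
    using f by (intro bexI[of _ "map_inv f"])
      (auto simp: GL_def clinear_inv bij_imp_bij_inv fun_eq_iff inv_f_f[OF bij_is_inj])
  show "\<one>\<^bsub>GL\<^esub> \<otimes>\<^bsub>GL\<^esub> f = f" by (simp add: GL_def)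
  assume g: "g \<in> carrier GL"
  show "f \<otimes>\<^bsub>GL\<^esub> g \<in> carrier GL"
    using f g by (auto simp: GL_def bij_comp intro!: clinearI simp: clinear_add clinear_scale)
  show "f \<otimes>\<^bsub>GL\<^esub> g \<otimes>\<^bsub>GL\<^esub> h = f \<otimes>\<^bsub>GL\<^esub> (g \<otimes>\<^bsub>GL\<^esub> h)" by (simp add: GL_def o_assoc)
next
  show "\<one>\<^bsub>GL\<^esub> \<in> carrier GL" by (auto simp: GL_def intro!: clinearI)
qed

lemma inv_GL: "f \<in> carrier GL \<Longrightarrow> inv\<^bsub>GL\<^esub> f = Hilbert_Choice.inv f"
  by (rule group.inv_equality[OF group_GL])
    (auto simp: GL_def bij_is_inj clinear_inv bij_imp_bij_inv)

locale reflection_group =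
  fixes W :: "('v::unitary_space \<Rightarrow> 'v) set" and \<alpha> :: "'v set \<Rightarrow> 'v \<Rightarrow> complex"
  assumes reflection_group: "finite_unitary_reflection_group W"
    and forms: "defining_forms (reflecting_hyperplanes W) \<alpha>"
begin

definition arrangement :: "'v set set" where
  "arrangement = reflecting_hyperplanes W"

definition Q :: "'v \<Rightarrow> complex" where
  "Q = defining_polynomial arrangement \<alpha>"

lemma finite_W: "finite W"
  using reflection_group by (simp add: finite_unitary_reflection_group_def)

lemma W_subgroup: "subgroup W GL"
proof -
  obtain T where T: "\<forall>s\<in>T. unitary_reflection s" "W = generate GL T"
    using reflection_group by (auto simp: finite_unitary_reflection_group_def)
  then have "T \<subseteq> carrier GL" by (auto simp: unitary_reflection_def unitary_map_def)
  then show ?thesis using T group.generate_is_subgroup[OF group_GL] by blast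
qed

lemma W_GL: "w \<in> W \<Longrightarrow> w \<in> carrier GL"
  using subgroup.subset[OF W_subgroup] by blast

lemma W_linear: "w \<in> W \<Longrightarrow> clinear w"
  and W_bij: "w \<in> W \<Longrightarrow> bij w"
  using W_GL by (auto simp: GL_def)

lemma W_id: "(\<lambda>v. v) \<in> W"
  using subgroup.one_closed[OF W_subgroup] by (simp add: GL_def id_def)

lemma W_comp: "u \<in> W \<Longrightarrow> w \<in> W \<Longrightarrow> (\<lambda>v. u (w v)) \<in> W"
  using subgroup.m_closed[OF W_subgroup, of u w] by (simp add: GL_def o_def)

lemma W_inv: "w \<in> W \<Longrightarrow> map_inv w \<in> W"
  using subgroup.m_inv_closed[OF W_subgroup, of w] by (simp add: inv_GL W_GL)

lemma W_inv_right [simp]: "w \<in> W \<Longrightarrow> w (map_inv w v) = v"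
  using W_bij bij_is_surj surj_f_inv_f by metis

lemma W_inv_left [simp]: "w \<in> W \<Longrightarrow> map_inv w (w v) = v"
  using W_bij bij_is_inj inv_f_f by metis

lemma W_induct [consumes 1, case_names id reflection inv comp]:
  assumes "w \<in> W" and "P (\<lambda>v. v)"
    and "\<And>s. s \<in> W \<Longrightarrow> unitary_reflection s \<Longrightarrow> P s"
    and "\<And>u. u \<in> W \<Longrightarrow> P u \<Longrightarrow> P (map_inv u)"
    and "\<And>u w. u \<in> W \<Longrightarrow> w \<in> W \<Longrightarrow> P u \<Longrightarrow> P w \<Longrightarrow> P (\<lambda>v. u (w v))"
  shows "P w"
proof -
  obtain T where T: "\<forall>s\<in>T. unitary_reflection s" "W = generate GL T"
    using reflection_group by (auto simp: finite_unitary_reflection_group_def)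
  have TW: "s \<in> W" if "s \<in> T" for s using T that generate.incl by metis
  have "w \<in> generate GL T" using assms(1) T by simp
  then show ?thesis
  proof (induction rule: generate.induct)
    case one
    show ?case using assms(2) by (simp add: GL_def id_def)
  next
    case (incl h)
    show ?case using assms(3) TW[OF incl] T incl by blast
  next
    case (inv h)
    show ?case using assms(3,4) TW[OF inv] T inv by (metis W_GL inv_GL)
  next
    case (eng h1 h2)
    then show ?case using assms(5)[of h1 h2] T by (simp add: GL_def o_def)
  qed
qed

lemma sum_W_translate:
  assumes u: "u \<in> W"
  shows "(\<Sum>w\<in>W. F (\<lambda>v. w (u v))) = (\<Sum>w\<in>W. F w)"
    and "(\<Sum>w\<in>W. F (\<lambda>v. u (w v))) = (\<Sum>w\<in>W. F w)"
proof -
  show "(\<Sum>w\<in>W. F (\<lambda>v. w (u v))) = (\<Sum>w\<in>W. F w)"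
    by (rule sum.reindex_bij_witness[of _ "\<lambda>w v. w (map_inv u v)" "\<lambda>w v. w (u v)"])
      (auto simp: u W_comp W_inv)
  show "(\<Sum>w\<in>W. F (\<lambda>v. u (w v))) = (\<Sum>w\<in>W. F w)"
    by (rule sum.reindex_bij_witness[of _ "\<lambda>w v. map_inv u (w v)" "\<lambda>w v. u (w v)"])
      (auto simp: u W_comp W_inv)
qed

lemma W_unitary: "w \<in> W \<Longrightarrow> cinner (w x) (w y) = cinner x y"
proof (induction arbitrary: x y rule: W_induct)
  case (inv u)
  have "cinner (u (map_inv u x)) (u (map_inv u y)) = cinner (map_inv u x) (map_inv u y)" by (rule inv.IH)
  then show ?case using inv by simp
qed (auto simp: unitary_reflection_def unitary_map_def)

lemma cdet_comp: "u \<in> W \<Longrightarrow> w \<in> W \<Longrightarrow> cdet (\<lambda>v. u (w v)) = cdet u * cdet w"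
  by (simp add: cdet_compose W_linear)

lemma cdet_inv_mult: "w \<in> W \<Longrightarrow> cdet (map_inv w) * cdet w = 1"
  using cdet_comp[OF W_inv, of w w] by (simp add: cdet_id)

lemma cdet_nonzero: "w \<in> W \<Longrightarrow> cdet w \<noteq> 0"
  using cdet_inv_mult by fastforce

lemma cdet_inv: "w \<in> W \<Longrightarrow> cdet (map_inv w) = inverse (cdet w)"
  by (metis cdet_inv_mult inverse_unique mult.commute)

lemma finite_arrangement: "finite arrangement"
  unfolding arrangement_def reflecting_hyperplanes_def using finite_W by simp

lemma arrangement_form:
  assumes "H \<in> arrangement"
  shows "clinear_form (\<alpha> H)" "{v. \<alpha> H v = 0} = H"
  using forms assms by (auto simp: defining_forms_def arrangement_def)

lemma arrangement_subspace: "H \<in> arrangement \<Longrightarrow> complex_vector.subspace H"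
  using clinear_form_kernel_subspace arrangement_form by metis

lemma mem_arrangement: "H \<in> arrangement \<Longrightarrow> v \<in> H \<longleftrightarrow> \<alpha> H v = 0"
  using arrangement_form(2) by blast

definition stabilizer :: "'v set \<Rightarrow> ('v \<Rightarrow> 'v) set" where
  "stabilizer H = {w \<in> W. \<forall>v\<in>H. w v = v}"

text \<open>
  Unitarity makes the line orthogonal to \<open>H\<close> a common eigenspace of the pointwise stabilizer of
  \<open>H\<close>, which therefore acts through the determinant.
\<close>

lemma normal_vector_exists:
  assumes H: "H \<in> arrangement"
  shows "\<exists>a. \<alpha> H a = 1 \<and>
    (\<forall>w\<in>stabilizer H. \<exists>z. \<forall>v. w v = v + (\<alpha> H v * (z - 1)) *\<^sub>C a)"
proof -
  note lin = arrangement_form(1)[OF H]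
  obtain s where s: "s \<in> W" "unitary_reflection s" "H = fixed_space s"
    using H by (auto simp: arrangement_def reflecting_hyperplanes_def)
  have "H \<noteq> UNIV" using s(2,3) by (auto simp: unitary_reflection_def)
  then obtain x0 where "\<alpha> H x0 \<noteq> 0" using mem_arrangement[OF H] by blast
  then obtain x where x: "\<alpha> H x = 1"
    using clinear_form_scale[OF lin, of "inverse (\<alpha> H x0)" x0] by auto
  have orth: "cinner (w x - x) h = 0" if "w \<in> stabilizer H" "h \<in> H" for w h x
  proof -
    have w: "w \<in> W" "w h = h" using that by (auto simp: stabilizer_def)
    have "cinner (w x) h = cinner x h" using W_unitary[OF w(1), of x h] w(2) by simp
    then have "cinner (x + (w x - x)) h = cinner x h" by simp
    then show ?thesis unfolding cinner_add_left by simp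
  qed
  have sH: "s \<in> stabilizer H" using s by (auto simp: stabilizer_def fixed_space_def)
  define y where "y = s x - x"
  have "y \<noteq> 0" using x s mem_arrangement[OF H, of x] by (auto simp: y_def fixed_space_def)
  have "\<alpha> H y \<noteq> 0"
  proof
    assume "\<alpha> H y = 0"
    then have "cinner y y = 0" using orth[OF sH, of y x] mem_arrangement[OF H] by (simp add: y_def)
    then show False using cinner_self_eq_0 \<open>y \<noteq> 0\<close> by blast
  qed
  define a where "a = inverse (\<alpha> H y) *\<^sub>C y"
  have a: "\<alpha> H a = 1" using \<open>\<alpha> H y \<noteq> 0\<close> by (simp add: a_def clinear_form_scale[OF lin])
  have a_orth: "cinner a h = 0" if "h \<in> H" for h
    using orth[OF sH that, of x] by (simp add: a_def y_def cinner_scaleC_left)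
  have "w v = v + (\<alpha> H v * ((1 + \<alpha> H (w a - a)) - 1)) *\<^sub>C a" if w: "w \<in> stabilizer H" for w v
  proof -
    define h where "h = (w a - a) - \<alpha> H (w a - a) *\<^sub>C a"
    have "\<alpha> H h = 0" by (simp add: h_def clinear_form_diff[OF lin] clinear_form_scale[OF lin] a)
    then have hH: "h \<in> H" using mem_arrangement[OF H] by simp
    have "cinner (h + \<alpha> H (w a - a) *\<^sub>C a) h = 0"
      using orth[OF w hH, of a] by (simp add: h_def)
    then have "cinner h h = 0"
      by (simp add: cinner_add_left cinner_scaleC_left a_orth[OF hH])
    then have "h = 0" by (rule cinner_self_eq_0)
    then have wa: "w a = a + \<alpha> H (w a - a) *\<^sub>C a" by (simp add: h_def eq_diff_eq add.commute)
    have wl: "clinear w" using w W_linear by (auto simp: stabilizer_def)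
    have "\<alpha> H (v - \<alpha> H v *\<^sub>C a) = 0"
      by (simp add: clinear_form_diff[OF lin] clinear_form_scale[OF lin] a)
    then have "w (v - \<alpha> H v *\<^sub>C a) = v - \<alpha> H v *\<^sub>C a"
      using w mem_arrangement[OF H] by (auto simp: stabilizer_def)
    then have "w v = v - \<alpha> H v *\<^sub>C a + \<alpha> H v *\<^sub>C w a"
      by (simp add: clinear_diff[OF wl] clinear_scale[OF wl] diff_eq_eq)
    also have "\<dots> = v + (\<alpha> H v * \<alpha> H (w a - a)) *\<^sub>C a"
      by (subst wa) (simp add: scaleC_add_right scaleC_scaleC)
    finally show ?thesis by simp
  qed
  then show ?thesis using a by blast
qed

definition normal_vector :: "'v set \<Rightarrow> 'v" where
  "normal_vector H = (SOME a. \<alpha> H a = 1 \<and>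
    (\<forall>w\<in>stabilizer H. \<exists>z. \<forall>v. w v = v + (\<alpha> H v * (z - 1)) *\<^sub>C a))"

lemma form_normal_vector: "H \<in> arrangement \<Longrightarrow> \<alpha> H (normal_vector H) = 1"
  using someI_ex[OF normal_vector_exists, of H] by (simp add: normal_vector_def)

lemma form_nonzero: "H \<in> arrangement \<Longrightarrow> \<exists>v. \<alpha> H v \<noteq> 0"
  using form_normal_vector by (intro exI[of _ "normal_vector H"]) simp

lemma stabilizer_W: "w \<in> stabilizer H \<Longrightarrow> w \<in> W"
  by (simp add: stabilizer_def)

lemma stabilizer_apply:
  assumes "H \<in> arrangement" "w \<in> stabilizer H"
  shows "w v = v + (\<alpha> H v * (cdet w - 1)) *\<^sub>C normal_vector H"
proof -
  have "\<exists>z. \<forall>v. w v = v + (\<alpha> H v * (z - 1)) *\<^sub>C normal_vector H"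
    using someI_ex[OF normal_vector_exists, of H] assms by (simp add: normal_vector_def)
  then obtain z where z: "\<And>v. w v = v + (\<alpha> H v * (z - 1)) *\<^sub>C normal_vector H" by blast
  then show ?thesis
    using cdet_complex_reflection[OF arrangement_form(1) form_normal_vector, of H w z] assms by metis
qed

lemma form_stabilizer:
  assumes "H \<in> arrangement" "w \<in> stabilizer H"
  shows "\<alpha> H (w v) = cdet w * \<alpha> H v"
  by (subst stabilizer_apply[OF assms])
    (simp add: clinear_form_add[OF arrangement_form(1)] clinear_form_scale[OF arrangement_form(1)]
      form_normal_vector assms right_diff_distrib mult.commute)

lemma stabilizer_normal_vector:
  assumes "H \<in> arrangement" "w \<in> stabilizer H"
  shows "w (normal_vector H) = cdet w *\<^sub>C normal_vector H"
  by (subst stabilizer_apply[OF assms])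
    (simp add: form_normal_vector assms complex_vector.scale_left_diff_distrib scaleC_one)

lemma stabilizer_id: "(\<lambda>v. v) \<in> stabilizer H"
  by (simp add: stabilizer_def W_id)

lemma stabilizer_comp: "u \<in> stabilizer H \<Longrightarrow> w \<in> stabilizer H \<Longrightarrow> (\<lambda>v. u (w v)) \<in> stabilizer H"
  by (simp add: stabilizer_def W_comp)

lemma stabilizer_inv:
  assumes "w \<in> stabilizer H" shows "map_inv w \<in> stabilizer H"
proof -
  have "map_inv w v = v" if "v \<in> H" for v
    using assms that W_inv_left[of w v] by (simp add: stabilizer_def)
  then show ?thesis using assms by (simp add: stabilizer_def W_inv)
qed

lemma finite_stabilizer: "finite (stabilizer H)"
  by (rule finite_subset[OF _ finite_W]) (auto simp: stabilizer_def)

lemma cdet_inj_on_stabilizer: "H \<in> arrangement \<Longrightarrow> inj_on cdet (stabilizer H)"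
  by (rule inj_onI, rule ext) (metis stabilizer_apply)

text \<open>
  The number \<open>e\<^sub>H\<close>, the ramification index of the quotient map \<open>V \<rightarrow> V/W\<close> along \<open>H\<close>.
\<close>

definition ramification :: "'v set \<Rightarrow> nat" where
  "ramification H = card (stabilizer H)"

lemma cdet_power_ramification:
  assumes H: "H \<in> arrangement" and w: "w \<in> stabilizer H"
  shows "cdet w ^ ramification H = 1"
proof -
  let ?p = "\<Prod>u\<in>stabilizer H. cdet u"
  have "?p = (\<Prod>u\<in>stabilizer H. cdet (\<lambda>v. w (u v)))"
    by (rule prod.reindex_bij_witness[of _ "\<lambda>u v. w (u v)" "\<lambda>u v. map_inv w (u v)"])
      (use w stabilizer_W in \<open>auto simp: stabilizer_comp stabilizer_inv\<close>)
  also have "\<dots> = (\<Prod>u\<in>stabilizer H. cdet w * cdet u)"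
    by (rule prod.cong) (use w in \<open>auto simp: cdet_comp stabilizer_W\<close>)
  also have "\<dots> = cdet w ^ ramification H * ?p"
    by (simp add: prod.distrib ramification_def)
  finally have "?p = cdet w ^ ramification H * ?p" .
  moreover have "?p \<noteq> 0" using finite_stabilizer by (simp add: cdet_nonzero stabilizer_W)
  ultimately show ?thesis by simp
qed

lemma reflection_stabilizer:
  assumes "s \<in> W" "unitary_reflection s"
  shows "fixed_space s \<in> arrangement" "s \<in> stabilizer (fixed_space s)"
  using assms by (auto simp: arrangement_def reflecting_hyperplanes_def stabilizer_def fixed_space_def)

lemma ramification_pos: "H \<in> arrangement \<Longrightarrow> ramification H > 0"
  using finite_stabilizer stabilizer_id by (auto simp: ramification_def card_gt_0_iff)

lemma stabilizer_nontrivial: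
  assumes H: "H \<in> arrangement"
  shows "\<exists>s\<in>stabilizer H. cdet s \<noteq> 1"
proof -
  obtain s where s: "s \<in> W" "unitary_reflection s" "H = fixed_space s"
    using H by (auto simp: arrangement_def reflecting_hyperplanes_def)
  have "H \<noteq> UNIV" using s(2,3) by (auto simp: unitary_reflection_def)
  have "cdet s \<noteq> 1"
  proof
    assume "cdet s = 1"
    then have "s v = v" for v
      using stabilizer_apply[OF H, of s v] reflection_stabilizer[OF s(1,2)] s(3) by simp
    then show False using \<open>H \<noteq> UNIV\<close> s(3) by (auto simp: fixed_space_def)
  qed
  then show ?thesis using reflection_stabilizer[OF s(1,2)] s(3) by blast
qed

text \<open>
  The determinants on the pointwise stabilizer are \<open>ramification H\<close> many distinct numbers, too many
  to be all \<open>m\<close>-th roots of unity for a smaller positive \<open>m\<close>.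
\<close>

lemma exists_cdet_power_neq_1:
  assumes H: "H \<in> arrangement" and m: "0 < m" "m < ramification H"
  shows "\<exists>w\<in>stabilizer H. cdet w ^ m \<noteq> 1"
proof (rule ccontr)
  assume "\<not> ?thesis"
  then have "cdet ` stabilizer H \<subseteq> {z. z ^ m = 1}" by auto
  then have "card (cdet ` stabilizer H) \<le> m"
    using card_mono[OF finite_roots_unity[of m], of "cdet ` stabilizer H"]
      card_roots_unity_eq[of m] m by simp
  then show False
    using m card_image[OF cdet_inj_on_stabilizer[OF H]] by (simp add: ramification_def)
qed

text \<open>
  A semi-invariant whose character is nontrivial vanishes on \<open>H\<close>; dividing by \<open>\<alpha> H\<close> lowers the
  exponent of the character by one, and the argument can be repeated.
\<close>

lemma semi_invariant_divisible:
  assumes H: "H \<in> arrangement" and "m < ramification H" "h \<in> poly_funs"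
    and "\<And>w v. w \<in> stabilizer H \<Longrightarrow> h (w v) = cdet w ^ m * h v"
  shows "divides_poly (\<lambda>v. \<alpha> H v ^ m) h"
  using assms(2-)
proof (induction m arbitrary: h)
  case 0
  then show ?case by (auto simp: divides_poly_def)
next
  case (Suc m)
  note lin = arrangement_form(1)[OF H]
  obtain w where w: "w \<in> stabilizer H" "cdet w ^ Suc m \<noteq> 1"
    using exists_cdet_power_neq_1[OF H, of "Suc m"] Suc.prems by auto
  have "h v = 0" if "\<alpha> H v = 0" for v
  proof -
    have "w v = v" using w that mem_arrangement[OF H] by (auto simp: stabilizer_def)
    then have "h v = cdet w ^ Suc m * h v" using Suc.prems(3)[OF w(1), of v] by metis
    then show ?thesis using w(2) by (metis mult_cancel_right1)
  qed
  then have "divides_poly (\<alpha> H) h"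
    using vanishing_on_hyperplane_divisible[OF Suc.prems(2) lin form_normal_vector[OF H]] by blast
  then obtain g where g: "g \<in> poly_funs" "\<And>v. h v = \<alpha> H v * g v" by (auto simp: divides_poly_def)
  have "g (u v) = cdet u ^ m * g v" if u: "u \<in> stabilizer H" for u v
  proof -
    have "(\<lambda>v. g (u v)) = (\<lambda>v. cdet u ^ m * g v)"
    proof (rule poly_funs_eqI[where h = "\<alpha> H"])
      show "(\<lambda>v. g (u v)) \<in> poly_funs"
        by (rule poly_funs_compose[OF g(1) W_linear[OF stabilizer_W[OF u]]])
      show "(\<lambda>v. cdet u ^ m * g v) \<in> poly_funs" by (rule poly_funs_cmult[OF g(1)])
      show "\<alpha> H \<in> poly_funs" by (rule poly_funs.linear[OF lin])
      show "\<exists>w. \<alpha> H w \<noteq> 0" by (rule form_nonzero[OF H])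
      fix v assume "\<alpha> H v \<noteq> 0"
      moreover have "cdet u \<noteq> 0" using cdet_nonzero[OF stabilizer_W[OF u]] .
      moreover have "(cdet u * \<alpha> H v) * g (u v) = (cdet u * \<alpha> H v) * (cdet u ^ m * g v)"
      proof -
        have "(cdet u * \<alpha> H v) * g (u v) = h (u v)"
          using g(2)[of "u v"] form_stabilizer[OF H u, of v] by simp
        also have "\<dots> = cdet u ^ Suc m * (\<alpha> H v * g v)"
          using g(2)[of v] Suc.prems(3)[OF u, of v] by simp
        finally show ?thesis by (simp only: power_Suc mult_ac)
      qed
      ultimately show "g (u v) = cdet u ^ m * g v"
        by (metis mult_cancel_left mult_eq_0_iff)
    qed
    then show ?thesis by (rule fun_cong)
  qed
  then have "divides_poly (\<lambda>v. \<alpha> H v ^ m) g"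
    using Suc.IH[of g] Suc.prems g by simp
  then obtain g' where "g' \<in> poly_funs" "\<And>v. g v = \<alpha> H v ^ m * g' v" by (auto simp: divides_poly_def)
  then show ?case using g unfolding divides_poly_def
    by (intro bexI[of _ g']) (auto simp: mult_ac)
qed

lemma arrangement_distinct:
  assumes "H \<in> arrangement" "K \<in> arrangement" "H \<noteq> K"
  shows "\<exists>u. \<alpha> H u = 0 \<and> \<alpha> K u \<noteq> 0"
proof (rule ccontr)
  assume *: "\<not> ?thesis"
  have lin: "clinear_form (\<alpha> H)" "clinear_form (\<alpha> K)" using assms arrangement_form by auto
  let ?a = "normal_vector H"
  have a: "\<alpha> H ?a = 1" using form_normal_vector[OF assms(1)] .
  have K: "\<alpha> K v = \<alpha> H v * \<alpha> K ?a" for v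
  proof -
    have "\<alpha> H (v - \<alpha> H v *\<^sub>C ?a) = 0"
      by (simp add: clinear_form_diff[OF lin(1)] clinear_form_scale[OF lin(1)] a)
    then have "\<alpha> K (v - \<alpha> H v *\<^sub>C ?a) = 0" using * by blast
    then show ?thesis by (simp add: clinear_form_diff[OF lin(2)] clinear_form_scale[OF lin(2)])
  qed
  then have "\<alpha> K ?a \<noteq> 0" using form_normal_vector[OF assms(2)] by (metis mult_zero_right zero_neq_one)
  then have "\<alpha> K v = 0 \<longleftrightarrow> \<alpha> H v = 0" for v using K[of v] by simp
  then show False using assms mem_arrangement by blast
qed

definition arrangement_prod :: "('v set \<Rightarrow> nat) \<Rightarrow> 'v \<Rightarrow> complex" where
  "arrangement_prod m = (\<lambda>v. \<Prod>H\<in>arrangement. \<alpha> H v ^ m H)"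

lemma arrangement_prod_hom: "arrangement_prod m \<in> hom_polys (\<Sum>H\<in>arrangement. m H)"
proof -
  have "(\<lambda>v. \<Prod>H\<in>arrangement. \<alpha> H v ^ m H) \<in> hom_polys (\<Sum>H\<in>arrangement. 1 * m H)"
    by (intro hom_polys_prod hom_polys_power hom_polys_linear arrangement_form)
  then show ?thesis by (simp add: arrangement_prod_def)
qed

lemma arrangement_prod_divides:
  assumes "f \<in> poly_funs" "\<And>H. H \<in> arrangement \<Longrightarrow> divides_poly (\<lambda>v. \<alpha> H v ^ m H) f"
  shows "divides_poly (arrangement_prod m) f"
  unfolding arrangement_prod_def
  by (rule divides_poly_prod_powers[OF finite_arrangement, where a = normal_vector])
    (use assms in \<open>auto simp: arrangement_form form_normal_vector arrangement_distinct\<close>)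

lemma arrangement_generic_point:
  assumes H: "H \<in> arrangement"
  shows "\<exists>v\<in>H. (\<Prod>K\<in>arrangement - {H}. \<alpha> K v ^ m K) \<noteq> 0"
proof (rule poly_funs_prod_nonzero[OF arrangement_subspace[OF H]])
  show "finite (arrangement - {H})" using finite_arrangement by simp
  fix K assume K: "K \<in> arrangement - {H}"
  then show "(\<lambda>v. \<alpha> K v ^ m K) \<in> poly_funs"
    by (auto intro: poly_funs_power poly_funs.linear arrangement_form)
  obtain u where "\<alpha> H u = 0" "\<alpha> K u \<noteq> 0" using arrangement_distinct[OF H, of K] K by blast
  then show "\<exists>u\<in>H. \<alpha> K u ^ m K \<noteq> 0"
    using mem_arrangement[OF H] by (intro bexI[of _ u]) auto
qed

lemma arrangement_prod_nonzero: "\<exists>v. arrangement_prod m v \<noteq> 0"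
proof -
  have "\<exists>v\<in>UNIV. (\<Prod>K\<in>arrangement. \<alpha> K v ^ m K) \<noteq> 0"
  proof (rule poly_funs_prod_nonzero[OF complex_vector.subspace_UNIV finite_arrangement])
    fix K assume K: "K \<in> arrangement"
    then show "(\<lambda>v. \<alpha> K v ^ m K) \<in> poly_funs"
      by (auto intro: poly_funs_power poly_funs.linear arrangement_form)
    show "\<exists>u\<in>UNIV. \<alpha> K u ^ m K \<noteq> 0"
      using form_normal_vector[OF K] by (intro bexI[of _ "normal_vector K"]) auto
  qed
  then show ?thesis by (simp add: arrangement_prod_def)
qed

lemma vimage_arrangement:
  assumes w: "w \<in> W" and H: "H \<in> arrangement"
  shows "w -` H \<in> arrangement"
    and "stabilizer (w -` H) = (\<lambda>u v. map_inv w (u (w v))) ` stabilizer H"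
proof -
  obtain s where s: "s \<in> W" "unitary_reflection s" "H = fixed_space s"
    using H by (auto simp: arrangement_def reflecting_hyperplanes_def)
  let ?t = "\<lambda>v. map_inv w (s (w v))"
  have tW: "?t \<in> W" by (rule W_comp[OF W_inv[OF w] W_comp[OF s(1) w]])
  have fix_t: "fixed_space ?t = w -` H"
    unfolding s(3) fixed_space_def using w W_inv_left W_inv_right by (auto; metis)
  have im: "w -` H = map_inv w ` H"
    using bij_vimage_eq_inv_image[OF W_bij[OF w]] by blast
  have "complex_vector.dim (w -` H) = complex_vector.dim H"
  proof -
    interpret pair: vector_space_pair "scaleC :: complex \<Rightarrow> 'v \<Rightarrow> 'v" "scaleC :: complex \<Rightarrow> 'v \<Rightarrow> 'v"
      by unfold_locales
    obtain B :: "'v set" where B: "basis_of_space B" using basis_of_space_exists by blast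
    interpret fd: finite_dimensional_vector_space "scaleC :: complex \<Rightarrow> 'v \<Rightarrow> 'v" B
      using B basis_of_space_finite[OF B] by unfold_locales (auto simp: basis_of_space_def)
    interpret fdp: finite_dimensional_vector_space_pair_1 "scaleC :: complex \<Rightarrow> 'v \<Rightarrow> 'v" B
      "scaleC :: complex \<Rightarrow> 'v \<Rightarrow> 'v" by unfold_locales
    show ?thesis unfolding im
      by (rule fdp.dim_image_eq[OF W_linear[OF W_inv[OF w]]])
        (metis W_bij[OF W_inv[OF w]] bij_is_inj inj_on_subset subset_UNIV)
  qed
  then have "unitary_reflection ?t"
    using s W_unitary[OF tW] W_GL[OF tW]
    unfolding unitary_reflection_def unitary_map_def fix_t by simp
  then show "w -` H \<in> arrangement"
    using tW fix_t unfolding arrangement_def reflecting_hyperplanes_def by blast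
  show "stabilizer (w -` H) = (\<lambda>u v. map_inv w (u (w v))) ` stabilizer H"
  proof (intro equalityI subsetI)
    fix t assume t: "t \<in> stabilizer (w -` H)"
    have "(\<lambda>v. w (t (map_inv w v))) \<in> stabilizer H"
      using t w W_comp[OF w W_comp[OF _ W_inv[OF w]]] by (auto simp: stabilizer_def)
    moreover have "t = (\<lambda>v. map_inv w ((\<lambda>v. w (t (map_inv w v))) (w v)))" using w by simp
    ultimately show "t \<in> (\<lambda>u v. map_inv w (u (w v))) ` stabilizer H" by (intro image_eqI[of _ _ "\<lambda>v. w (t (map_inv w v))"])
  next
    fix t assume "t \<in> (\<lambda>u v. map_inv w (u (w v))) ` stabilizer H"
    then show "t \<in> stabilizer (w -` H)"
      using w W_comp[OF W_inv[OF w] W_comp[OF _ w]] by (auto simp: stabilizer_def)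
  qed
qed

lemma ramification_vimage:
  assumes w: "w \<in> W" and H: "H \<in> arrangement"
  shows "ramification (w -` H) = ramification H"
proof -
  have "inj_on (\<lambda>u v. map_inv w (u (w v))) (stabilizer H)"
  proof (rule inj_onI, rule ext)
    fix u u' v assume "(\<lambda>v. map_inv w (u (w v))) = (\<lambda>v. map_inv w (u' (w v)))"
    then have "w (map_inv w (u (w (map_inv w v)))) = w (map_inv w (u' (w (map_inv w v))))" by metis
    then show "u v = u' v" using w by simp
  qed
  then show ?thesis
    unfolding ramification_def vimage_arrangement(2)[OF assms] by (rule card_image)
qed

text \<open>
  Up to a scalar, a reflection permutes the linear factors. Removing the power of the form of its
  own hyperplane and evaluating at a generic point of that hyperplane, which is fixed, determines
  the scalar.
\<close>

lemma arrangement_prod_reflection: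
  assumes m: "\<And>H w. H \<in> arrangement \<Longrightarrow> w \<in> W \<Longrightarrow> m (w -` H) = m H"
    and s: "s \<in> W" "unitary_reflection s"
  shows "arrangement_prod m (s v) = cdet s ^ m (fixed_space s) * arrangement_prod m v"
proof -
  let ?H = "fixed_space s"
  note H = reflection_stabilizer[OF s]
  \<comment> \<open>the factor by which \<open>\<alpha> K \<circ> s\<close> differs from the chosen form of its kernel\<close>
  let ?c = "\<lambda>K. \<alpha> K (s (normal_vector (s -` K)))"
  have K: "\<alpha> K (s v) = ?c K * \<alpha> (s -` K) v" if "K \<in> arrangement" for K v
  proof -
    let ?L = "s -` K"
    let ?u = "v - \<alpha> ?L v *\<^sub>C normal_vector ?L"
    have L: "?L \<in> arrangement" using vimage_arrangement[OF s(1) that] by blast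
    have "\<alpha> ?L ?u = 0"
      by (simp add: clinear_form_diff clinear_form_scale arrangement_form[OF L] form_normal_vector[OF L])
    then have "s ?u \<in> K" using mem_arrangement[OF L, of ?u] by simp
    then have "\<alpha> K (s ?u) = 0" using mem_arrangement[OF that] by simp
    then show ?thesis
      by (simp add: clinear_diff clinear_scale W_linear s clinear_form_diff clinear_form_scale
          arrangement_form[OF that] mult.commute)
  qed
  define c where "c = (\<Prod>K\<in>arrangement. ?c K ^ m K)"
  have F: "arrangement_prod m (s v) = c * arrangement_prod m v" for v
  proof -
    have "arrangement_prod m (s v) = (\<Prod>K\<in>arrangement. ?c K ^ m K * \<alpha> (s -` K) v ^ m (s -` K))"
      unfolding arrangement_prod_def
    proof (rule prod.cong[OF refl])
      fix K assume "K \<in> arrangement"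
      then show "\<alpha> K (s v) ^ m K = ?c K ^ m K * \<alpha> (s -` K) v ^ m (s -` K)"
        by (subst K) (simp_all add: power_mult_distrib m s)
    qed
    also have "\<dots> = c * (\<Prod>K\<in>arrangement. \<alpha> (s -` K) v ^ m (s -` K))"
      by (simp add: prod.distrib c_def)
    also have "(\<Prod>K\<in>arrangement. \<alpha> (s -` K) v ^ m (s -` K)) = arrangement_prod m v"
      unfolding arrangement_prod_def
      by (rule prod.reindex_bij_witness[of _ "\<lambda>K. map_inv s -` K" "\<lambda>K. s -` K"])
        (use s in \<open>auto simp: vimage_arrangement W_inv\<close>)
    finally show ?thesis .
  qed
  let ?G = "\<lambda>v. \<Prod>K\<in>arrangement - {?H}. \<alpha> K v ^ m K"
  have split: "arrangement_prod m v = \<alpha> ?H v ^ m ?H * ?G v" for v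
    unfolding arrangement_prod_def by (rule prod.remove[OF finite_arrangement H(1)])
  have polyG: "?G \<in> poly_funs"
    by (intro poly_funs_prod poly_funs_power poly_funs.linear arrangement_form) auto
  have "(\<lambda>v. cdet s ^ m ?H * ?G (s v)) = (\<lambda>v. c * ?G v)"
  proof (rule poly_funs_eqI[where h = "\<alpha> ?H"])
    show "(\<lambda>v. cdet s ^ m ?H * ?G (s v)) \<in> poly_funs"
      by (rule poly_funs_cmult, rule poly_funs_compose[OF polyG W_linear[OF s(1)]])
    show "(\<lambda>v. c * ?G v) \<in> poly_funs" by (rule poly_funs_cmult[OF polyG])
    show "\<alpha> ?H \<in> poly_funs" by (rule poly_funs.linear[OF arrangement_form(1)[OF H(1)]])
    show "\<exists>w. \<alpha> ?H w \<noteq> 0" by (rule form_nonzero[OF H(1)])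
    fix v assume nz: "\<alpha> ?H v \<noteq> 0"
    have "(cdet s * \<alpha> ?H v) ^ m ?H * ?G (s v) = c * (\<alpha> ?H v ^ m ?H * ?G v)"
      using F[of v] split[of "s v"] split[of v] form_stabilizer[OF H, of v] by metis
    then have "\<alpha> ?H v ^ m ?H * (cdet s ^ m ?H * ?G (s v)) = \<alpha> ?H v ^ m ?H * (c * ?G v)"
      by (simp only: power_mult_distrib mult_ac)
    moreover have "\<alpha> ?H v ^ m ?H \<noteq> 0" using nz by simp
    ultimately show "cdet s ^ m ?H * ?G (s v) = c * ?G v" by (rule iffD1[OF mult_left_cancel, rotated])
  qed
  then have G: "cdet s ^ m ?H * ?G (s v) = c * ?G v" for v by (rule fun_cong)
  obtain v0 where v0: "v0 \<in> ?H" "?G v0 \<noteq> 0" using arrangement_generic_point[OF H(1)] by blast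
  then have s_v0: "s v0 = v0" by (simp add: fixed_space_def)
  have "cdet s ^ m ?H * ?G v0 = c * ?G v0" using G[of v0] by (simp only: s_v0)
  then have "c = cdet s ^ m ?H" by (rule iffD1[OF mult_right_cancel[OF v0(2)], symmetric])
  then show ?thesis using F by simp
qed

lemma Q_eq: "Q = arrangement_prod (\<lambda>_. 1)"
  by (simp add: Q_def defining_polynomial_def arrangement_prod_def)

lemma Q_poly: "Q \<in> poly_funs"
  unfolding Q_eq using arrangement_prod_hom hom_polys_poly by blast

lemma Q_nonzero: "\<exists>v. Q v \<noteq> 0"
  unfolding Q_eq by (rule arrangement_prod_nonzero)

lemma Q_eq_0_iff: "Q v = 0 \<longleftrightarrow> (\<exists>H\<in>arrangement. \<alpha> H v = 0)"
  using finite_arrangement by (simp add: Q_def defining_polynomial_def)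

lemma Q_semi_invariant: "w \<in> W \<Longrightarrow> Q (w v) = cdet w * Q v"
proof (induction arbitrary: v rule: W_induct)
  case id
  then show ?case by (simp add: cdet_id)
next
  case (reflection s)
  then show ?case using arrangement_prod_reflection[of "\<lambda>_. 1" s v] by (simp add: Q_eq)
next
  case (inv u)
  have "Q v = cdet u * Q (map_inv u v)" using inv.IH[of "map_inv u v"] inv.hyps by simp
  then show ?case using cdet_nonzero[OF inv.hyps] by (simp add: cdet_inv inv.hyps)
next
  case (comp u w)
  then show ?case by (simp add: cdet_comp)
qed

text \<open>
  Up to a constant factor, \<open>J\<close> is the Jacobian determinant of a system of basic invariants. Its
  character is inverse to that of \<open>Q\<close>, so that \<open>Q J\<close> is an invariant.
\<close>

definition J :: "'v \<Rightarrow> complex" where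
  "J = arrangement_prod (\<lambda>H. ramification H - 1)"

definition degree_J :: nat where
  "degree_J = (\<Sum>H\<in>arrangement. ramification H - 1)"

lemma J_hom: "J \<in> hom_polys degree_J"
  unfolding J_def degree_J_def by (rule arrangement_prod_hom)

lemma J_poly: "J \<in> poly_funs"
  using J_hom hom_polys_poly by blast

lemma J_nonzero: "\<exists>v. J v \<noteq> 0"
  unfolding J_def by (rule arrangement_prod_nonzero)

lemma J_nonzero_if_Q_nonzero: "Q v \<noteq> 0 \<Longrightarrow> J v \<noteq> 0"
  unfolding Q_eq_0_iff using finite_arrangement by (auto simp: J_def arrangement_prod_def)

lemma cdet_power_ramification_minus_1:
  assumes "H \<in> arrangement" "w \<in> stabilizer H"
  shows "cdet w ^ (ramification H - 1) = inverse (cdet w)"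
proof -
  have "cdet w * cdet w ^ (ramification H - 1) = cdet w ^ ramification H"
    using ramification_pos[OF assms(1)] by (metis power_eq_if neq0_conv)
  then show ?thesis using cdet_power_ramification[OF assms] by (metis inverse_unique)
qed

lemma J_semi_invariant: "w \<in> W \<Longrightarrow> cdet w * J (w v) = J v"
proof (induction arbitrary: v rule: W_induct)
  case id
  then show ?case by (simp add: cdet_id)
next
  case (reflection s)
  have "J (s v) = cdet s ^ (ramification (fixed_space s) - 1) * J v"
    unfolding J_def
    by (rule arrangement_prod_reflection) (use reflection in \<open>auto simp: ramification_vimage\<close>)
  then show ?case
    using cdet_power_ramification_minus_1[OF reflection_stabilizer[OF reflection]]
      cdet_nonzero[OF reflection(1)] by simp
next
  case (inv u)
  have "cdet u * J v = J (map_inv u v)" using inv.IH[of "map_inv u v"] inv.hyps by simp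
  then have "cdet (map_inv u) * J (map_inv u v) = cdet (map_inv u) * (cdet u * J v)" by simp
  also have "\<dots> = J v" using cdet_inv_mult[OF inv.hyps] by (metis mult.assoc mult_1)
  finally show ?case .
next
  case (comp u w)
  have "cdet (\<lambda>v. u (w v)) * J (u (w v)) = cdet w * (cdet u * J (u (w v)))"
    by (simp add: cdet_comp comp.hyps)
  then show ?case by (simp only: comp.IH)
qed

lemma J_divides:
  assumes "f \<in> poly_funs"
    and "\<And>H w v. H \<in> arrangement \<Longrightarrow> w \<in> stabilizer H \<Longrightarrow> cdet w * f (w v) = f v"
  shows "divides_poly J f"
  unfolding J_def
proof (rule arrangement_prod_divides[OF assms(1)], rule semi_invariant_divisible)
  fix H w v assume H: "H \<in> arrangement" and w: "w \<in> stabilizer H"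
  have "f (w v) = inverse (cdet w) * f v"
    using assms(2)[OF H w, of v] cdet_nonzero[OF stabilizer_W[OF w]]
    by (metis mult.assoc left_inverse mult_1)
  then show "f (w v) = cdet w ^ (ramification H - 1) * f v"
    using cdet_power_ramification_minus_1[OF H w] by simp
qed (use assms ramification_pos in auto)

end

section \<open>The trace form and dual bases of the polynomial ring\<close>

context reflection_group
begin

lemma invariant_polys_iff:
  "f \<in> invariant_polys W \<longleftrightarrow> f \<in> poly_funs \<and> (\<forall>w\<in>W. \<forall>v. f (w v) = f v)"
proof -
  have "(\<forall>w\<in>W. act_fun w f = f) \<longleftrightarrow> (\<forall>w\<in>W. \<forall>v. f (w v) = f v)"
  proof (intro iffI ballI allI)
    fix w v assume "\<forall>w\<in>W. act_fun w f = f" and w: "w \<in> W"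
    then have "act_fun w f = f" by blast
    then have "act_fun w f (w v) = f (w v)" by (rule fun_cong)
    then show "f (w v) = f v" using w by (simp add: act_fun_def)
  next
    fix w assume "\<forall>w\<in>W. \<forall>v. f (w v) = f v" and "w \<in> W"
    then have "f (map_inv w v) = f v" for v using W_inv by blast
    then show "act_fun w f = f" by (simp add: act_fun_def)
  qed
  then show ?thesis by (auto simp: invariant_polys_def)
qed

lemma invariant_polysD: "f \<in> invariant_polys W \<Longrightarrow> w \<in> W \<Longrightarrow> f (w v) = f v"
  and invariant_polys_poly: "f \<in> invariant_polys W \<Longrightarrow> f \<in> poly_funs"
  unfolding invariant_polys_iff by blast+

definition antisymmetrization :: "('v \<Rightarrow> complex) \<Rightarrow> 'v \<Rightarrow> complex" where
  "antisymmetrization g = (\<lambda>v. \<Sum>w\<in>W. cdet w * g (w v))"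

lemma antisymmetrization_poly:
  assumes "g \<in> poly_funs"
  shows "antisymmetrization g \<in> poly_funs"
  unfolding antisymmetrization_def
  by (rule poly_funs_sum, rule poly_funs_cmult, rule poly_funs_compose[OF assms W_linear])

lemma antisymmetrization_semi_invariant:
  assumes u: "u \<in> W"
  shows "cdet u * antisymmetrization g (u v) = antisymmetrization g v"
proof -
  have "cdet u * antisymmetrization g (u v) = (\<Sum>w\<in>W. cdet (\<lambda>v. w (u v)) * g (w (u v)))"
    unfolding antisymmetrization_def sum_distrib_left
    by (rule sum.cong) (use u in \<open>auto simp: cdet_comp\<close>)
  also have "\<dots> = antisymmetrization g v"
    unfolding antisymmetrization_def
    using sum_W_translate(1)[OF u, of "\<lambda>w. cdet w * g (w v)"] .
  finally show ?thesis .
qed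

text \<open>
  The value at \<open>g\<close> is \<open>\<Sum>w. w (g / J)\<close>, a trace over the invariants. It is a polynomial because
  the antisymmetrization of \<open>g\<close> is divisible by \<open>J\<close>.
\<close>

definition jtrace :: "('v \<Rightarrow> complex) \<Rightarrow> 'v \<Rightarrow> complex" where
  "jtrace g = (SOME q. q \<in> poly_funs \<and> (\<forall>v. antisymmetrization g v = J v * q v))"

lemma jtrace:
  assumes "g \<in> poly_funs"
  shows jtrace_poly: "jtrace g \<in> poly_funs"
    and J_jtrace: "J v * jtrace g v = (\<Sum>w\<in>W. cdet w * g (w v))"
proof -
  have "divides_poly J (antisymmetrization g)"
    by (rule J_divides[OF antisymmetrization_poly[OF assms]])
      (auto simp: antisymmetrization_semi_invariant stabilizer_W)
  then have "\<exists>q. q \<in> poly_funs \<and> (\<forall>v. antisymmetrization g v = J v * q v)"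
    unfolding divides_poly_def by blast
  from someI_ex[OF this]
  have "jtrace g \<in> poly_funs \<and> (\<forall>v. antisymmetrization g v = J v * jtrace g v)"
    unfolding jtrace_def .
  then show "jtrace g \<in> poly_funs" "J v * jtrace g v = (\<Sum>w\<in>W. cdet w * g (w v))"
    unfolding antisymmetrization_def by auto
qed

lemma cancel_J:
  assumes "f \<in> poly_funs" "g \<in> poly_funs" "\<And>v. J v * f v = J v * g v"
  shows "f = g"
proof (rule poly_funs_eqI[OF assms(1,2) J_poly J_nonzero])
  show "f v = g v" if "J v \<noteq> 0" for v using assms(3)[of v] that by simp
qed

lemma jtrace_eqI:
  assumes "g \<in> poly_funs" "q \<in> poly_funs" "\<And>v. (\<Sum>w\<in>W. cdet w * g (w v)) = J v * q v"
  shows "jtrace g = q"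
  by (rule cancel_J[OF jtrace_poly[OF assms(1)] assms(2)]) (simp only: J_jtrace[OF assms(1)] assms(3))

lemma jtrace_invariant:
  assumes "g \<in> poly_funs"
  shows "jtrace g \<in> invariant_polys W"
  unfolding invariant_polys_iff
proof (intro conjI ballI allI)
  show "jtrace g \<in> poly_funs" by (rule jtrace_poly[OF assms])
  fix w v assume w: "w \<in> W"
  have "(\<lambda>v. jtrace g (w v)) = jtrace g"
  proof (rule cancel_J)
    show "(\<lambda>v. jtrace g (w v)) \<in> poly_funs"
      by (rule poly_funs_compose[OF jtrace_poly[OF assms] W_linear[OF w]])
    fix v
    have "J v * jtrace g (w v) = cdet w * (J (w v) * jtrace g (w v))"
      using J_semi_invariant[OF w, of v] by (metis mult.assoc)
    also have "\<dots> = J v * jtrace g v"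
      using antisymmetrization_semi_invariant[OF w, of g v]
      by (simp add: J_jtrace[OF assms] antisymmetrization_def)
    finally show "J v * jtrace g (w v) = J v * jtrace g v" .
  qed (rule jtrace_poly[OF assms])
  then show "jtrace g (w v) = jtrace g v" by (rule fun_cong)
qed

lemma jtrace_add:
  assumes "f \<in> poly_funs" "g \<in> poly_funs"
  shows "jtrace (\<lambda>v. f v + g v) = (\<lambda>v. jtrace f v + jtrace g v)"
  by (rule jtrace_eqI)
    (simp_all add: poly_funs.add jtrace_poly assms J_jtrace distrib_left sum.distrib)

lemma jtrace_invariant_mult:
  assumes "r \<in> invariant_polys W" "g \<in> poly_funs"
  shows "jtrace (\<lambda>v. r v * g v) = (\<lambda>v. r v * jtrace g v)"
proof (rule jtrace_eqI)
  have r: "r \<in> poly_funs" using invariant_polys_poly[OF assms(1)] .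
  show "(\<lambda>v. r v * g v) \<in> poly_funs" "(\<lambda>v. r v * jtrace g v) \<in> poly_funs"
    by (intro poly_funs.mult r jtrace_poly assms)+
  fix v
  have "(\<Sum>w\<in>W. cdet w * (r (w v) * g (w v))) = r v * (\<Sum>w\<in>W. cdet w * g (w v))"
    unfolding sum_distrib_left
    by (rule sum.cong) (simp_all add: invariant_polysD[OF assms(1)])
  then show "(\<Sum>w\<in>W. cdet w * (r (w v) * g (w v))) = J v * (r v * jtrace g v)"
    by (simp add: J_jtrace[OF assms(2), symmetric])
qed

lemma const_invariant: "(\<lambda>_. c) \<in> invariant_polys W"
  by (auto simp: invariant_polys_iff intro: poly_funs.const)

lemma jtrace_cmult: "g \<in> poly_funs \<Longrightarrow> jtrace (\<lambda>v. c * g v) = (\<lambda>v. c * jtrace g v)"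
  using jtrace_invariant_mult[OF const_invariant] .

lemma jtrace_zero: "jtrace (\<lambda>_. 0) = (\<lambda>_. 0)"
  by (rule jtrace_eqI) (auto intro: poly_funs.const)

lemma jtrace_diff:
  assumes "f \<in> poly_funs" "g \<in> poly_funs"
  shows "jtrace (\<lambda>v. f v - g v) = (\<lambda>v. jtrace f v - jtrace g v)"
  using jtrace_add[OF assms(1) poly_funs_cmult[OF assms(2)], of "-1"] jtrace_cmult[OF assms(2), of "-1"]
  by simp

lemma jtrace_hom:
  assumes "g \<in> hom_polys (d + degree_J)"
  shows "jtrace g \<in> hom_polys d"
proof (rule hom_polys_divide[OF _ J_hom _ _ J_nonzero])
  have g: "g \<in> poly_funs" using hom_polys_poly[OF assms] .
  show "(\<lambda>v. \<Sum>w\<in>W. cdet w * g (w v)) \<in> hom_polys (d + degree_J)"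
    by (rule hom_polys_sum, rule hom_polys_cmult, rule hom_polys_compose[OF assms W_linear])
  show "jtrace g \<in> poly_funs" by (rule jtrace_poly[OF g])
  show "(\<Sum>w\<in>W. cdet w * g (w v)) = J v * jtrace g v" for v using J_jtrace[OF g] by simp
qed

lemma jtrace_J: "jtrace (\<lambda>v. J v * c) = (\<lambda>_. of_nat (card W) * c)"
proof (rule jtrace_eqI)
  show "(\<lambda>v. J v * c) \<in> poly_funs" by (intro poly_funs.mult J_poly poly_funs.const)
  show "(\<lambda>_. of_nat (card W) * c) \<in> poly_funs" by (rule poly_funs.const)
  fix v
  have "(\<Sum>w\<in>W. cdet w * (J (w v) * c)) = (\<Sum>w\<in>W. J v * c)"
    by (rule sum.cong) (simp_all add: J_semi_invariant mult.assoc[symmetric])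
  then show "(\<Sum>w\<in>W. cdet w * (J (w v) * c)) = J v * (of_nat (card W) * c)" by simp
qed

text \<open>
  Divided differences are adjoint to each other: the quotients by \<open>\<alpha> H\<close> absorb the character
  of \<open>J\<close> when the summation variable \<open>w\<close> is replaced by \<open>s\<^sup>-\<^sup>1 w\<close>.
\<close>

lemma jtrace_divided_difference_adjoint:
  assumes H: "H \<in> arrangement" and s: "s \<in> stabilizer H"
    and polys: "f \<in> poly_funs" "g \<in> poly_funs" "f' \<in> poly_funs" "g' \<in> poly_funs"
    and f': "\<And>v. f v - f (s v) = \<alpha> H v * f' v"
    and g': "\<And>v. g v - g (map_inv s v) = \<alpha> H v * g' v"
  shows "jtrace (\<lambda>v. g v * f' v) = jtrace (\<lambda>v. g' v * f v)"
proof (rule poly_funs_eqI[OF _ _ Q_poly Q_nonzero])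
  note sW = stabilizer_W[OF s]
  have gf: "(\<lambda>v. g v * f' v) \<in> poly_funs" "(\<lambda>v. g' v * f v) \<in> poly_funs"
    using polys by (auto intro: poly_funs.mult)
  then show "jtrace (\<lambda>v. g v * f' v) \<in> poly_funs" "jtrace (\<lambda>v. g' v * f v) \<in> poly_funs"
    by (auto intro: jtrace_poly)
  fix v assume Qv: "Q v \<noteq> 0"
  have nz: "\<alpha> H (w v) \<noteq> 0" if "w \<in> W" for w
  proof -
    have "Q (w v) \<noteq> 0" using Q_semi_invariant[OF that] cdet_nonzero[OF that] Qv by simp
    then show ?thesis using H by (auto simp: Q_eq_0_iff)
  qed
  have "(\<Sum>w\<in>W. cdet w * (g (w v) * f (s (w v)) / \<alpha> H (w v))) =
    (\<Sum>w\<in>W. cdet w * (g (map_inv s (w v)) * f (w v) / \<alpha> H (w v)))"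
  proof -
    let ?F = "\<lambda>w. cdet w * (g (map_inv s (w v)) * f (w v) / \<alpha> H (w v))"
    have "(\<Sum>w\<in>W. cdet w * (g (w v) * f (s (w v)) / \<alpha> H (w v))) = (\<Sum>w\<in>W. ?F (\<lambda>v. s (w v)))"
    proof (rule sum.cong[OF refl])
      fix w assume w: "w \<in> W"
      show "cdet w * (g (w v) * f (s (w v)) / \<alpha> H (w v)) = ?F (\<lambda>v. s (w v))"
        using cdet_nonzero[OF sW] nz[OF w]
        by (simp add: cdet_comp sW w form_stabilizer[OF H s])
    qed
    also have "\<dots> = (\<Sum>w\<in>W. ?F w)" by (rule sum_W_translate(2)[OF sW])
    finally show ?thesis .
  qed
  moreover have "(\<Sum>w\<in>W. cdet w * (g (w v) * f' (w v))) =
    (\<Sum>w\<in>W. cdet w * (g (w v) * f (w v) / \<alpha> H (w v))) -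
    (\<Sum>w\<in>W. cdet w * (g (w v) * f (s (w v)) / \<alpha> H (w v)))"
    unfolding sum_subtractf[symmetric]
  proof (rule sum.cong[OF refl])
    fix w assume w: "w \<in> W"
    have "f' (w v) = (f (w v) - f (s (w v))) / \<alpha> H (w v)" using f'[of "w v"] nz[OF w] by simp
    then show "cdet w * (g (w v) * f' (w v)) = cdet w * (g (w v) * f (w v) / \<alpha> H (w v)) -
        cdet w * (g (w v) * f (s (w v)) / \<alpha> H (w v))"
      by (simp add: right_diff_distrib diff_divide_distrib)
  qed
  moreover have "(\<Sum>w\<in>W. cdet w * (g' (w v) * f (w v))) =
    (\<Sum>w\<in>W. cdet w * (g (w v) * f (w v) / \<alpha> H (w v))) -
    (\<Sum>w\<in>W. cdet w * (g (map_inv s (w v)) * f (w v) / \<alpha> H (w v)))"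
    unfolding sum_subtractf[symmetric]
  proof (rule sum.cong[OF refl])
    fix w assume w: "w \<in> W"
    have "g' (w v) = (g (w v) - g (map_inv s (w v))) / \<alpha> H (w v)" using g'[of "w v"] nz[OF w] by simp
    then show "cdet w * (g' (w v) * f (w v)) = cdet w * (g (w v) * f (w v) / \<alpha> H (w v)) -
        cdet w * (g (map_inv s (w v)) * f (w v) / \<alpha> H (w v))"
      by (simp add: right_diff_distrib left_diff_distrib diff_divide_distrib)
  qed
  ultimately have "J v * jtrace (\<lambda>v. g v * f' v) v = J v * jtrace (\<lambda>v. g' v * f v) v"
    by (simp add: J_jtrace gf)
  then show "jtrace (\<lambda>v. g v * f' v) v = jtrace (\<lambda>v. g' v * f v) v"
    using J_nonzero_if_Q_nonzero[OF Qv] by simp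
qed

text \<open>
  The degree \<open>d\<close> part of the Hilbert ideal, which is generated by the homogeneous invariants of
  positive degree.
\<close>

inductive hilbert_ideal :: "nat \<Rightarrow> ('v \<Rightarrow> complex) \<Rightarrow> bool" for d where
  zero: "hilbert_ideal d (\<lambda>_. 0)"
| step: "hilbert_ideal d f \<Longrightarrow> r \<in> invariant_polys W \<Longrightarrow> r \<in> hom_polys k \<Longrightarrow> k > 0 \<Longrightarrow>
    g \<in> hom_polys e \<Longrightarrow> k + e = d \<Longrightarrow> hilbert_ideal d (\<lambda>v. f v + r v * g v)"

lemma hilbert_ideal_add:
  assumes "hilbert_ideal d g" "hilbert_ideal d f"
  shows "hilbert_ideal d (\<lambda>v. f v + g v)"
  using assms
proof (induction rule: hilbert_ideal.induct)
  case zero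
  then show ?case by simp
next
  case (step g r k h e)
  then show ?case using hilbert_ideal.step[of d "\<lambda>v. f v + g v" r k h e] by (simp add: add.assoc)
qed

lemma hilbert_ideal_hom: "hilbert_ideal d f \<Longrightarrow> f \<in> hom_polys d"
  by (induction rule: hilbert_ideal.induct) (auto intro: hom_polys_zero hom_polys_add hom_polys_mult)

lemma hilbert_ideal_mult:
  assumes "hilbert_ideal d f" "l \<in> hom_polys n"
  shows "hilbert_ideal (n + d) (\<lambda>v. l v * f v)"
  using assms(1)
proof (induction rule: hilbert_ideal.induct)
  case zero
  then show ?case by (simp add: hilbert_ideal.zero)
next
  case (step f r k g e)
  have "(\<lambda>v. l v * g v) \<in> hom_polys (n + e)" using assms(2) step.hyps(5) by (rule hom_polys_mult)
  then have "hilbert_ideal (n + d) (\<lambda>v. l v * f v + r v * (l v * g v))"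
    using step by (intro hilbert_ideal.step[where k = k]) auto
  then show ?case by (simp add: distrib_left mult.left_commute)
qed

lemma hilbert_ideal_cmult: "hilbert_ideal d f \<Longrightarrow> hilbert_ideal d (\<lambda>v. c * f v)"
  using hilbert_ideal_mult[OF _ hom_polys_const] by fastforce

lemma hilbert_ideal_compose:
  assumes "hilbert_ideal d f" and w: "w \<in> W"
  shows "hilbert_ideal d (\<lambda>v. f (w v))"
  using assms(1)
proof (induction rule: hilbert_ideal.induct)
  case zero
  then show ?case by (simp add: hilbert_ideal.zero)
next
  case (step f r k g e)
  have "(\<lambda>v. g (w v)) \<in> hom_polys e" using step.hyps(5) W_linear[OF w] by (rule hom_polys_compose)
  then have "hilbert_ideal d (\<lambda>v. f (w v) + r v * g (w v))"
    using step by (intro hilbert_ideal.step[where k = k])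
  then show ?case using invariant_polysD[OF step.hyps(2) w] by simp
qed

lemma hilbert_ideal_sum:
  "(\<And>i. i \<in> I \<Longrightarrow> hilbert_ideal d (f i)) \<Longrightarrow> hilbert_ideal d (\<lambda>v. \<Sum>i\<in>I. f i v)"
  by (induction I rule: infinite_finite_induct)
    (auto intro: hilbert_ideal_add hilbert_ideal.zero)

lemma divided_difference_exists:
  assumes H: "H \<in> arrangement" and s: "s \<in> stabilizer H" and f: "f \<in> hom_polys (Suc d)"
  shows "\<exists>f'\<in>hom_polys d. \<forall>v. f v - f (s v) = \<alpha> H v * f' v"
proof -
  note lin = arrangement_form(1)[OF H]
  have fs: "(\<lambda>v. f v - f (s v)) \<in> hom_polys (Suc d)"
    using f hom_polys_compose[OF f W_linear[OF stabilizer_W[OF s]]] by (rule hom_polys_diff)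
  have "f v - f (s v) = 0" if "\<alpha> H v = 0" for v
    using s that mem_arrangement[OF H] by (auto simp: stabilizer_def)
  then obtain f' where f': "f' \<in> poly_funs" "\<And>v. f v - f (s v) = \<alpha> H v * f' v"
    using vanishing_on_hyperplane_divisible[OF hom_polys_poly[OF fs] lin form_normal_vector[OF H]]
    by (auto simp: divides_poly_def)
  have "f' \<in> hom_polys d"
    using form_nonzero[OF H] hom_polys_divide[of "\<lambda>v. f v - f (s v)" d 1 "\<alpha> H" f'] fs hom_polys_linear[OF lin] f' by simp
  then show ?thesis using f'(2) by blast
qed

text \<open>
  The trace form is nondegenerate modulo the Hilbert ideal. By adjointness, the radical is stable
  under divided differences, which lower the degree; so by induction \<open>f\<close> is congruent to all its
  images under reflections, hence to its average over the group. That average is an invariant of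
  positive degree.
\<close>

lemma trace_form_nondegenerate:
  assumes "f \<in> hom_polys d"
    and "\<And>a e. e + d = degree_J \<Longrightarrow> a \<in> hom_polys e \<Longrightarrow> jtrace (\<lambda>v. a v * f v) = (\<lambda>_. 0)"
  shows "hilbert_ideal d f"
  using assms
proof (induction d arbitrary: f)
  case 0
  \<comment> \<open>A constant is detected by \<open>a = J\<close>, which has trace \<open>card W\<close>.\<close>
  have f: "f = (\<lambda>_. f 0)" using hom_polys_0_const[OF 0(1)] by (rule ext)
  have "jtrace (\<lambda>v. J v * f v) = (\<lambda>_. 0)" by (rule 0(2)[OF _ J_hom]) simp
  then have "jtrace (\<lambda>v. J v * f 0) = (\<lambda>_. 0)" by (subst (asm) f)
  then have "of_nat (card W) * f 0 = 0" unfolding jtrace_J by meson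
  then have "f 0 = 0" using finite_W W_id by auto
  then show ?case using f hilbert_ideal.zero[of 0] by simp
next
  case (Suc d)
  have reflection: "hilbert_ideal (Suc d) (\<lambda>v. f v - f (s v))" if s: "s \<in> W" "unitary_reflection s" for s
  proof -
    let ?H = "fixed_space s"
    note H = reflection_stabilizer[OF s]
    obtain f' where f': "f' \<in> hom_polys d" "\<And>v. f v - f (s v) = \<alpha> ?H v * f' v"
      using divided_difference_exists[OF H Suc.prems(1)] by blast
    have "hilbert_ideal d f'"
    proof (rule Suc.IH[OF f'(1)])
      fix a :: "'v \<Rightarrow> complex" and e
      assume e: "e + d = degree_J" and a: "a \<in> hom_polys e"
      have adj: "jtrace (\<lambda>v. a v * f' v) = jtrace (\<lambda>v. a' v * f v)"
        if "a' \<in> poly_funs" "\<And>v. a v - a (map_inv s v) = \<alpha> ?H v * a' v" for a'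
        by (rule jtrace_divided_difference_adjoint[OF H _ _ _ _ f'(2) that(2)])
          (use that(1) a f'(1) Suc.prems(1) hom_polys_poly in blast)+
      show "jtrace (\<lambda>v. a v * f' v) = (\<lambda>_. 0)"
      proof (cases e)
        case 0
        have "a v - a (map_inv s v) = \<alpha> ?H v * 0" for v
          using hom_polys_0_const[of a v] hom_polys_0_const[of a "map_inv s v"] a 0 by simp
        from adj[OF poly_funs.const this] show ?thesis by (simp add: jtrace_zero)
      next
        case (Suc e')
        obtain a' where a': "a' \<in> hom_polys e'" "\<And>v. a v - a (map_inv s v) = \<alpha> ?H v * a' v"
          using divided_difference_exists[OF H(1) stabilizer_inv[OF H(2)]] a Suc by blast
        have "jtrace (\<lambda>v. a' v * f v) = (\<lambda>_. 0)"
          using Suc.prems(2)[OF _ a'(1)] e Suc by simp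
        then show ?thesis using adj[OF hom_polys_poly[OF a'(1)] a'(2)] by simp
      qed
    qed
    then have "hilbert_ideal (1 + d) (\<lambda>v. \<alpha> ?H v * f' v)"
      using hom_polys_linear[OF arrangement_form(1)[OF H(1)]] by (rule hilbert_ideal_mult)
    then show ?thesis by (simp add: f'(2))
  qed
  have congruent: "hilbert_ideal (Suc d) (\<lambda>v. f v - f (w v))" if "w \<in> W" for w
    using that
  proof (induction rule: W_induct)
    case id
    then show ?case by (simp add: hilbert_ideal.zero)
  next
    case (reflection s)
    then show ?case by fact
  next
    case (inv u)
    have "hilbert_ideal (Suc d) (\<lambda>v. - 1 * (f (map_inv u v) - f (u (map_inv u v))))"
      by (intro hilbert_ideal_cmult hilbert_ideal_compose[OF inv.IH W_inv[OF inv.hyps]])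
    then show ?case using inv.hyps by simp
  next
    case (comp u w)
    from hilbert_ideal_add[OF hilbert_ideal_compose[OF comp.IH(1) comp.hyps(2)] comp.IH(2)]
    show ?case by simp
  qed
  define m where "m = (\<lambda>v. inverse (of_nat (card W)) * (\<Sum>w\<in>W. f (w v)))"
  have m_hom: "m \<in> hom_polys (Suc d)"
    unfolding m_def
    by (rule hom_polys_cmult, rule hom_polys_sum, rule hom_polys_compose[OF Suc.prems(1) W_linear])
  have m_inv: "m \<in> invariant_polys W"
    unfolding invariant_polys_iff
  proof (intro conjI ballI allI)
    show "m \<in> poly_funs" using hom_polys_poly[OF m_hom] .
    show "m (u v) = m v" if "u \<in> W" for u v
      using sum_W_translate(1)[OF that, of "\<lambda>w. f (w v)"] by (simp add: m_def)
  qed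
  have "hilbert_ideal (Suc d) (\<lambda>v. inverse (of_nat (card W)) * (\<Sum>w\<in>W. f v - f (w v)))"
    by (intro hilbert_ideal_cmult hilbert_ideal_sum congruent)
  from hilbert_ideal.step[OF this m_inv m_hom _ hom_polys_const[of 1]]
  have "hilbert_ideal (Suc d) (\<lambda>v. inverse (of_nat (card W)) * (\<Sum>w\<in>W. f v - f (w v)) + m v)"
    by simp
  moreover have "inverse (of_nat (card W)) * (\<Sum>w\<in>W. f v - f (w v)) + m v = f v" for v
  proof -
    have "of_nat (card W) \<noteq> (0::complex)" using finite_W W_id by auto
    then show ?thesis unfolding m_def sum_subtractf by (simp add: field_simps)
  qed
  ultimately show ?case by simp
qed

text \<open>
  Operators of the form \<open>f \<mapsto> \<Sum>i. b\<^sub>i jtrace (a\<^sub>i f)\<close>. They are linear over the invariants and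
  closed under composition, and the goal is to show that the identity is one of them.
\<close>

inductive trace_operator :: "(('v \<Rightarrow> complex) \<Rightarrow> 'v \<Rightarrow> complex) \<Rightarrow> bool" where
  zero: "trace_operator (\<lambda>f v. 0)"
| step: "trace_operator P \<Longrightarrow> a \<in> poly_funs \<Longrightarrow> b \<in> poly_funs \<Longrightarrow>
    trace_operator (\<lambda>f v. P f v + b v * jtrace (\<lambda>x. a x * f x) v)"

lemma trace_operator_poly: "trace_operator P \<Longrightarrow> f \<in> poly_funs \<Longrightarrow> P f \<in> poly_funs"
  by (induction rule: trace_operator.induct)
    (auto intro!: poly_funs.add poly_funs.const poly_funs.mult jtrace_poly)

lemma trace_operator_add:
  assumes "trace_operator P" "f \<in> poly_funs" "g \<in> poly_funs"
  shows "P (\<lambda>v. f v + g v) = (\<lambda>v. P f v + P g v)"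
  using assms(1)
proof (induction rule: trace_operator.induct)
  case (step P a b)
  have "jtrace (\<lambda>x. a x * (f x + g x)) = (\<lambda>v. jtrace (\<lambda>x. a x * f x) v + jtrace (\<lambda>x. a x * g x) v)"
    unfolding distrib_left by (intro jtrace_add poly_funs.mult step.hyps assms)
  then show ?case by (simp add: step.IH distrib_left fun_eq_iff)
qed simp

lemma trace_operator_invariant_mult:
  assumes "trace_operator P" "r \<in> invariant_polys W" "f \<in> poly_funs"
  shows "P (\<lambda>v. r v * f v) = (\<lambda>v. r v * P f v)"
  using assms(1)
proof (induction rule: trace_operator.induct)
  case (step P a b)
  have "jtrace (\<lambda>x. a x * (r x * f x)) = jtrace (\<lambda>x. r x * (a x * f x))"
    by (simp only: mult.left_commute)
  also have "\<dots> = (\<lambda>v. r v * jtrace (\<lambda>x. a x * f x) v)"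
    by (intro jtrace_invariant_mult poly_funs.mult step.hyps assms)
  finally show ?case by (simp add: step.IH distrib_left mult.left_commute)
qed simp

lemma trace_operator_cmult:
  "trace_operator P \<Longrightarrow> f \<in> poly_funs \<Longrightarrow> P (\<lambda>v. c * f v) = (\<lambda>v. c * P f v)"
  using trace_operator_invariant_mult[OF _ const_invariant] .

lemma trace_operator_zero: "trace_operator P \<Longrightarrow> P (\<lambda>_. 0) = (\<lambda>_. 0)"
  using trace_operator_cmult[of P "\<lambda>_. 0" 0] poly_funs.const[of 0] by simp

lemma trace_operator_diff:
  assumes "trace_operator P" "f \<in> poly_funs" "g \<in> poly_funs"
  shows "P (\<lambda>v. f v - g v) = (\<lambda>v. P f v - P g v)"
  using trace_operator_add[OF assms(1,2) poly_funs_cmult[OF assms(3)], of "-1"]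
    trace_operator_cmult[OF assms(1,3), of "-1"] by simp

lemma trace_operator_sum:
  assumes "trace_operator P" "\<And>i. i \<in> I \<Longrightarrow> f i \<in> poly_funs"
  shows "P (\<lambda>v. \<Sum>i\<in>I. f i v) = (\<lambda>v. \<Sum>i\<in>I. P (f i) v)"
  using assms(2)
proof (induction I rule: infinite_finite_induct)
  case (insert i I)
  then show ?case using trace_operator_add[OF assms(1), of "f i" "\<lambda>v. \<Sum>i\<in>I. f i v"]
    by (simp add: poly_funs_sum)
qed (simp_all add: trace_operator_zero[OF assms(1)])

text \<open>
  For \<open>R = S = P\<close> this is the correction of \<open>P\<close> to \<open>P + (1 - P) P\<close>, that is \<open>1 - (1 - P)\<^sup>2\<close>; the
  induction over the summands of \<open>R\<close> needs the three roles of \<open>P\<close> to be separate.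
\<close>

lemma trace_operator_correction:
  assumes P: "trace_operator P" and R: "trace_operator R" and S: "trace_operator S"
  shows "\<exists>P'. trace_operator P' \<and> (\<forall>f\<in>poly_funs. P' f = (\<lambda>v. S f v + (R f v - P (R f) v)))"
  using R
proof (induction rule: trace_operator.induct)
  case zero
  show ?case using S by (intro exI[of _ S]) (simp add: trace_operator_zero[OF P])
next
  case (step R a b)
  then obtain P' where P': "trace_operator P'"
    "\<And>f. f \<in> poly_funs \<Longrightarrow> P' f = (\<lambda>v. S f v + (R f v - P (R f) v))" by blast
  let ?b = "\<lambda>v. b v - P b v"
  have "trace_operator (\<lambda>f v. P' f v + ?b v * jtrace (\<lambda>x. a x * f x) v)"
    by (intro trace_operator.step P' step.hyps poly_funs_diff trace_operator_poly[OF P])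
  moreover have "P' f v + ?b v * jtrace (\<lambda>x. a x * f x) v =
      S f v + ((R f v + b v * jtrace (\<lambda>x. a x * f x) v) -
        P (\<lambda>v. R f v + b v * jtrace (\<lambda>x. a x * f x) v) v)"
    if f: "f \<in> poly_funs" for f v
  proof -
    have t: "jtrace (\<lambda>x. a x * f x) \<in> invariant_polys W"
      by (intro jtrace_invariant poly_funs.mult step.hyps f)
    have "P (\<lambda>v. R f v + b v * jtrace (\<lambda>x. a x * f x) v) =
        (\<lambda>v. P (R f) v + P (\<lambda>v. jtrace (\<lambda>x. a x * f x) v * b v) v)"
      using trace_operator_add[OF P trace_operator_poly[OF step.hyps(1) f]
          poly_funs.mult[OF step.hyps(3) invariant_polys_poly[OF t]]]
      by (simp add: mult.commute)
    also have "P (\<lambda>v. jtrace (\<lambda>x. a x * f x) v * b v) = (\<lambda>v. jtrace (\<lambda>x. a x * f x) v * P b v)"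
      by (rule trace_operator_invariant_mult[OF P t step.hyps(3)])
    finally show ?thesis by (simp add: P'(2)[OF f] left_diff_distrib mult.commute)
  qed
  ultimately show ?case by blast
qed

text \<open>
  The adjoint of \<open>f \<mapsto> b jtrace (c f)\<close> is \<open>a \<mapsto> jtrace (a b) c\<close>.
\<close>

lemma jtrace_trace_operator:
  assumes a: "a \<in> poly_funs" and P: "trace_operator P"
  shows "\<exists>a'\<in>poly_funs. \<forall>f\<in>poly_funs. jtrace (\<lambda>v. a v * P f v) = jtrace (\<lambda>v. a' v * f v)"
  using P
proof (induction rule: trace_operator.induct)
  case zero
  show ?case by (rule bexI[of _ "\<lambda>_. 0"]) (auto intro: poly_funs.const)
next
  case (step P c b)
  then obtain a' where a': "a' \<in> poly_funs"
    "\<And>f. f \<in> poly_funs \<Longrightarrow> jtrace (\<lambda>v. a v * P f v) = jtrace (\<lambda>v. a' v * f v)" by blast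
  let ?t = "jtrace (\<lambda>v. a v * b v)"
  have ab: "(\<lambda>v. a v * b v) \<in> poly_funs" by (intro poly_funs.mult a step.hyps)
  have t: "?t \<in> invariant_polys W" by (rule jtrace_invariant[OF ab])
  have "jtrace (\<lambda>v. a v * (P f v + b v * jtrace (\<lambda>x. c x * f x) v)) =
      jtrace (\<lambda>v. (a' v + ?t v * c v) * f v)" if f: "f \<in> poly_funs" for f
  proof -
    let ?u = "jtrace (\<lambda>x. c x * f x)"
    have cf: "(\<lambda>x. c x * f x) \<in> poly_funs" by (intro poly_funs.mult f step.hyps)
    have u: "?u \<in> invariant_polys W" by (rule jtrace_invariant[OF cf])
    have "jtrace (\<lambda>v. a v * (P f v + b v * ?u v)) = jtrace (\<lambda>v. a v * P f v + ?u v * (a v * b v))"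
      by (simp only: distrib_left mult_ac)
    also have "\<dots> = (\<lambda>v. jtrace (\<lambda>v. a v * P f v) v + ?u v * ?t v)"
      using jtrace_add[OF poly_funs.mult[OF a trace_operator_poly[OF step.hyps(1) f]]
          poly_funs.mult[OF invariant_polys_poly[OF u] ab]] jtrace_invariant_mult[OF u ab] by simp
    also have "\<dots> = (\<lambda>v. jtrace (\<lambda>v. a' v * f v) v + ?t v * ?u v)"
      by (simp add: a'(2)[OF f] mult.commute)
    also have "\<dots> = jtrace (\<lambda>v. a' v * f v + ?t v * (c v * f v))"
      using jtrace_add[OF poly_funs.mult[OF a'(1) f] poly_funs.mult[OF invariant_polys_poly[OF t] cf]]
        jtrace_invariant_mult[OF t cf] by simp
    finally show ?thesis by (simp only: distrib_right mult.assoc)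
  qed
  moreover have "(\<lambda>v. a' v + ?t v * c v) \<in> poly_funs"
    by (intro poly_funs.add poly_funs.mult a' step.hyps jtrace_poly ab)
  ultimately show ?case by (intro bexI[of _ "\<lambda>v. a' v + ?t v * c v"] ballI)
qed

definition fixes_degree :: "(('v \<Rightarrow> complex) \<Rightarrow> 'v \<Rightarrow> complex) \<Rightarrow> nat \<Rightarrow> bool" where
  "fixes_degree P k \<longleftrightarrow> (\<forall>f\<in>hom_polys k. P f = f)"

definition graded_operator :: "(('v \<Rightarrow> complex) \<Rightarrow> 'v \<Rightarrow> complex) \<Rightarrow> bool" where
  "graded_operator P \<longleftrightarrow> (\<forall>k. \<forall>f\<in>hom_polys k. P f \<in> hom_polys k)"

lemma fixes_hilbert_ideal:
  assumes P: "trace_operator P" "\<And>k. k < d \<Longrightarrow> fixes_degree P k" and "hilbert_ideal d f"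
  shows "P f = f"
  using assms(3)
proof (induction rule: hilbert_ideal.induct)
  case zero
  show ?case by (rule trace_operator_zero[OF P(1)])
next
  case (step f r k g e)
  have g: "P g = g" using P(2)[of e] step.hyps by (auto simp: fixes_degree_def)
  have gp: "g \<in> poly_funs" using hom_polys_poly[OF step.hyps(5)] .
  have "P (\<lambda>v. f v + r v * g v) = (\<lambda>v. P f v + P (\<lambda>v. r v * g v) v)"
    by (intro trace_operator_add P poly_funs.mult gp invariant_polys_poly step.hyps
        hom_polys_poly[OF hilbert_ideal_hom[OF step.hyps(1)]])
  also have "P (\<lambda>v. r v * g v) = (\<lambda>v. r v * P g v)"
    by (rule trace_operator_invariant_mult[OF P(1) step.hyps(2) gp])
  finally show ?case by (simp add: step.IH g)
qed

text \<open>
  Enlarging the fixed space by one element \<open>g\<close> of degree \<open>d\<close>. If the defect \<open>h = g - P g\<close> lies in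
  the Hilbert ideal, then \<open>P\<close> fixes it and \<open>P + (1 - P) P\<close> fixes \<open>g\<close>. Otherwise there is an \<open>a\<close> with
  \<open>jtrace (a h) = 1\<close>, and \<open>f \<mapsto> P f + h jtrace (a (f - P f))\<close> fixes \<open>g\<close> and everything that \<open>P\<close> fixes.
\<close>

lemma enlarge_fixed_space:
  assumes P: "trace_operator P" "graded_operator P" "\<And>k. k < d \<Longrightarrow> fixes_degree P k"
    and g: "g \<in> hom_polys d"
  shows "\<exists>P'. trace_operator P' \<and> graded_operator P' \<and> P' g = g \<and>
    (\<forall>f\<in>poly_funs. P f = f \<longrightarrow> P' f = f)"
proof -
  define h where "h = (\<lambda>v. g v - P g v)"
  have gp: "g \<in> poly_funs" using hom_polys_poly[OF g] .
  have Pg: "P g \<in> hom_polys d" using P(2) g by (auto simp: graded_operator_def)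
  have h: "h \<in> hom_polys d" unfolding h_def by (rule hom_polys_diff[OF g Pg])
  show ?thesis
  proof (cases "hilbert_ideal d h")
    case True
    have Ph: "P h = h" by (rule fixes_hilbert_ideal[OF P(1,3) True])
    have "P h = (\<lambda>v. P g v - P (P g) v)"
      unfolding h_def by (rule trace_operator_diff[OF P(1) gp hom_polys_poly[OF Pg]])
    then have PPg: "P g v - P (P g) v = g v - P g v" for v
      using Ph by (metis h_def)
    obtain P' where P': "trace_operator P'"
      "\<And>f. f \<in> poly_funs \<Longrightarrow> P' f = (\<lambda>v. P f v + (P f v - P (P f) v))"
      using trace_operator_correction[OF P(1) P(1) P(1)] by blast
    have "P' f \<in> hom_polys k" if f: "f \<in> hom_polys k" for f k
    proof -
      have "P f \<in> hom_polys k" "P (P f) \<in> hom_polys k"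
        using P(2) f by (auto simp: graded_operator_def)
      then show ?thesis
        unfolding P'(2)[OF hom_polys_poly[OF f]] by (intro hom_polys_add hom_polys_diff)
    qed
    moreover have "P' g = g" using P'(2)[OF gp] PPg by simp
    moreover have "P' f = f" if "f \<in> poly_funs" "P f = f" for f using P'(2)[OF that(1)] that(2) by simp
    ultimately show ?thesis using P'(1) unfolding graded_operator_def by blast
  next
    case False
    obtain a e where a: "e + d = degree_J" "a \<in> hom_polys e" "jtrace (\<lambda>v. a v * h v) \<noteq> (\<lambda>_. 0)"
      using trace_form_nondegenerate[OF h] False by blast
    have ap: "a \<in> poly_funs" using hom_polys_poly[OF a(2)] .
    have "jtrace (\<lambda>v. a v * h v) \<in> hom_polys 0"
      using jtrace_hom[of _ 0] hom_polys_mult[OF a(2) h] a(1) by simp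
    then obtain c where c: "jtrace (\<lambda>v. a v * h v) = (\<lambda>_. c)" using hom_polys_0_const by blast
    then have "c \<noteq> 0" using a(3) by auto
    obtain a' where a': "a' \<in> poly_funs"
      "\<And>f. f \<in> poly_funs \<Longrightarrow> jtrace (\<lambda>v. a v * P f v) = jtrace (\<lambda>v. a' v * f v)"
      using jtrace_trace_operator[OF ap P(1)] by blast
    define P' where "P' = (\<lambda>f v. P f v + (inverse c * h v) * jtrace (\<lambda>x. (a x - a' x) * f x) v)"
    have P'_op: "trace_operator P'"
      unfolding P'_def by (intro trace_operator.step P poly_funs_diff ap a' poly_funs_cmult hom_polys_poly[OF h])
    have P': "P' f = (\<lambda>v. P f v + (inverse c * h v) * jtrace (\<lambda>x. a x * (f x - P f x)) v)"
      if f: "f \<in> poly_funs" for f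
    proof -
      have Pf: "P f \<in> poly_funs" by (rule trace_operator_poly[OF P(1) f])
      have "jtrace (\<lambda>x. (a x - a' x) * f x) = (\<lambda>v. jtrace (\<lambda>x. a x * f x) v - jtrace (\<lambda>x. a' x * f x) v)"
        unfolding left_diff_distrib by (intro jtrace_diff poly_funs.mult ap a' f)
      also have "\<dots> = (\<lambda>v. jtrace (\<lambda>x. a x * f x) v - jtrace (\<lambda>x. a x * P f x) v)"
        by (simp add: a'(2)[OF f])
      also have "\<dots> = jtrace (\<lambda>x. a x * (f x - P f x))"
        unfolding right_diff_distrib by (intro jtrace_diff[symmetric] poly_funs.mult ap Pf f)
      finally show ?thesis by (simp add: P'_def)
    qed
    have fixed: "P' f = f" if "f \<in> poly_funs" "P f = f" for f
      using P'[OF that(1)] that(2) by (simp add: jtrace_zero)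
    moreover have "P' g = g"
    proof -
      have "P' g = (\<lambda>v. P g v + (inverse c * h v) * jtrace (\<lambda>x. a x * h x) v)"
        using P'[OF gp] by (simp add: h_def)
      also have "\<dots> = (\<lambda>v. P g v + h v)" unfolding c using \<open>c \<noteq> 0\<close> by (simp add: field_simps)
      finally show ?thesis by (simp add: h_def)
    qed
    moreover have "graded_operator P'"
      unfolding graded_operator_def
    proof (intro allI ballI)
      fix k and f :: "'v \<Rightarrow> complex"
      assume f: "f \<in> hom_polys k"
      have fp: "f \<in> poly_funs" using hom_polys_poly[OF f] .
      show "P' f \<in> hom_polys k"
      proof (cases "k < d")
        case True
        then have "P f = f" using P(3) f by (auto simp: fixes_degree_def)
        then show ?thesis using fixed[OF fp] f by simp
      next
        case False
        have Pf: "P f \<in> hom_polys k" using P(2) f by (auto simp: graded_operator_def)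
        have "(\<lambda>x. a x * (f x - P f x)) \<in> hom_polys (e + k)"
          by (intro hom_polys_mult hom_polys_diff a f Pf)
        moreover have "e + k = (k - d) + degree_J" using False a(1) by simp
        ultimately have "jtrace (\<lambda>x. a x * (f x - P f x)) \<in> hom_polys (k - d)"
          using jtrace_hom by simp
        from hom_polys_mult[OF hom_polys_cmult[OF h, of "inverse c"] this]
        have "(\<lambda>v. (inverse c * h v) * jtrace (\<lambda>x. a x * (f x - P f x)) v) \<in> hom_polys k"
          using False by simp
        then show ?thesis unfolding P'[OF fp] by (intro hom_polys_add Pf)
      qed
    qed
    ultimately show ?thesis using P'_op by blast
  qed
qed

lemma trace_operator_fixing_low_degrees:
  "\<exists>P. trace_operator P \<and> graded_operator P \<and> (\<forall>k<d. fixes_degree P k)"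
proof (induction d)
  case 0
  show ?case using trace_operator.zero
    by (intro exI[of _ "\<lambda>f v. 0"]) (auto simp: graded_operator_def hom_polys_zero)
next
  case (Suc d)
  obtain G :: "('v \<Rightarrow> complex) set" where G: "finite G" "G \<subseteq> hom_polys d"
    "\<And>f. f \<in> hom_polys d \<Longrightarrow> \<exists>c. f = (\<lambda>v. \<Sum>g\<in>G. c g * g v)"
    using hom_polys_finite_dimensional[of d] by blast
  have "\<exists>P. trace_operator P \<and> graded_operator P \<and> (\<forall>k<d. fixes_degree P k) \<and> (\<forall>g\<in>G. P g = g)"
    using G(1,2)
  proof (induction G rule: finite_induct)
    case empty
    then show ?case using Suc by simp
  next
    case (insert g G)
    then obtain P where P: "trace_operator P" "graded_operator P" "\<And>k. k < d \<Longrightarrow> fixes_degree P k"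
      "\<forall>g\<in>G. P g = g" by auto
    obtain P' where P': "trace_operator P'" "graded_operator P'" "P' g = g"
      "\<And>f. f \<in> poly_funs \<Longrightarrow> P f = f \<Longrightarrow> P' f = f"
      using enlarge_fixed_space[OF P(1-3), of d g] insert.prems by auto
    have "fixes_degree P' k" if "k < d" for k
      using P(3)[OF that] P'(4) hom_polys_poly unfolding fixes_degree_def by blast
    moreover have "\<forall>g\<in>insert g G. P' g = g"
      using P(4) P'(3,4) insert.prems hom_polys_poly by blast
    ultimately show ?case using P' by blast
  qed
  then obtain P where P: "trace_operator P" "graded_operator P" "\<forall>k<d. fixes_degree P k"
    "\<And>g. g \<in> G \<Longrightarrow> P g = g" by blast
  have "P f = f" if f: "f \<in> hom_polys d" for f
  proof -
    obtain c where c: "f = (\<lambda>v. \<Sum>g\<in>G. c g * g v)" using G(3)[OF f] by blast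
    have gp: "g \<in> poly_funs" if "g \<in> G" for g using G(2) that hom_polys_poly by blast
    have "P f = (\<lambda>v. \<Sum>g\<in>G. P (\<lambda>v. c g * g v) v)"
      unfolding c by (intro trace_operator_sum P(1) poly_funs_cmult gp)
    also have "\<dots> = f" unfolding c
      by (intro ext sum.cong refl) (simp add: trace_operator_cmult[OF P(1) gp] P(4))
    finally show ?thesis .
  qed
  then have "\<forall>k<Suc d. fixes_degree P k" using P(3) by (auto simp: fixes_degree_def less_Suc_eq)
  then show ?case using P by blast
qed

text \<open>
  In degrees above that of \<open>J\<close> nondegeneracy says that everything lies in the Hilbert ideal, so an
  operator that fixes the lower degrees is the identity.
\<close>

theorem trace_operator_identity:
  "\<exists>P. trace_operator P \<and> (\<forall>f\<in>poly_funs. P f = f)"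
proof -
  obtain P where P: "trace_operator P" "\<forall>k<Suc degree_J. fixes_degree P k"
    using trace_operator_fixing_low_degrees by blast
  have fix_k: "fixes_degree P k" for k
  proof (induction k rule: less_induct)
    case (less k)
    show ?case
    proof (cases "k < Suc degree_J")
      case True
      then show ?thesis using P by blast
    next
      case False
      show ?thesis unfolding fixes_degree_def
      proof
        fix f :: "'v \<Rightarrow> complex" assume f: "f \<in> hom_polys k"
        have "hilbert_ideal k f" by (rule trace_form_nondegenerate[OF f]) (use False in simp)
        show "P f = f" by (rule fixes_hilbert_ideal[OF P(1) less.IH \<open>hilbert_ideal k f\<close>])
      qed
    qed
  qed
  have "P f = f" if "f \<in> poly_funs" for f
  proof -
    obtain F n where F: "\<And>k. F k \<in> hom_polys k" "f = (\<lambda>v. \<Sum>k<n. F k v)"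
      using poly_funs_sum_homogeneous[OF \<open>f \<in> poly_funs\<close>] by blast
    have "P f = (\<lambda>v. \<Sum>k<n. P (F k) v)"
      unfolding F(2) using F(1) hom_polys_poly by (intro trace_operator_sum P(1)) blast
    moreover have "P (F k) = F k" for k using fix_k[of k] F(1)[of k] by (auto simp: fixes_degree_def)
    ultimately show ?thesis by (simp only: F(2))
  qed
  then show ?thesis using P(1) by blast
qed

corollary dual_bases_exist:
  "\<exists>(n::nat) a b. (\<forall>i<n. a i \<in> poly_funs \<and> b i \<in> poly_funs) \<and>
    (\<forall>f\<in>poly_funs. \<forall>v. f v = (\<Sum>i<n. b i v * jtrace (\<lambda>x. a i x * f x) v))"
proof -
  have *: "\<exists>(n::nat) a b. (\<forall>i<n. a i \<in> poly_funs \<and> b i \<in> poly_funs) \<and>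
    (\<forall>f v. P f v = (\<Sum>i<n. b i v * jtrace (\<lambda>x. a i x * f x) v))" if "trace_operator P" for P
    using that
  proof (induction rule: trace_operator.induct)
    case zero
    show ?case by (intro exI[of _ 0]) simp
  next
    case (step P a' b')
    then obtain n a b where ab: "\<forall>i<n::nat. a i \<in> poly_funs \<and> b i \<in> poly_funs"
      "\<And>f v. P f v = (\<Sum>i<n. b i v * jtrace (\<lambda>x. a i x * f x) v)" by blast
    show ?case
      by (intro exI[of _ "Suc n"] exI[of _ "a(n := a')"] exI[of _ "b(n := b')"])
        (use ab step.hyps in \<open>auto simp: less_Suc_eq\<close>)
  qed
  obtain P where P: "trace_operator P" "\<And>f. f \<in> poly_funs \<Longrightarrow> P f = f"
    using trace_operator_identity by blast
  obtain n a b where ab: "\<forall>i<n::nat. a i \<in> poly_funs \<and> b i \<in> poly_funs"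
    "\<forall>f v. P f v = (\<Sum>i<n. b i v * jtrace (\<lambda>x. a i x * f x) v)" using *[OF P(1)] by blast
  have "f v = (\<Sum>i<n. b i v * jtrace (\<lambda>x. a i x * f x) v)" if "f \<in> poly_funs" for f v
    using P(2)[OF that] ab(2)[rule_format, of f v] by simp
  then have "\<forall>f\<in>poly_funs. \<forall>v. f v = (\<Sum>i<n. b i v * jtrace (\<lambda>x. a i x * f x) v)" by blast
  with ab(1) show ?thesis by (intro exI[of _ n] exI[of _ a] exI[of _ b] conjI)
qed

text \<open>
  At a point whose orbit is free, evaluations at the points of the orbit are linearly independent,
  so the reproducing identity may be read off orbit point by orbit point.
\<close>

lemma dual_bases_orthogonality:
  assumes ab: "\<And>i. i < n \<Longrightarrow> a i \<in> poly_funs \<and> b i \<in> poly_funs"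
    and rep: "\<And>f v. f \<in> poly_funs \<Longrightarrow> f v = (\<Sum>i<n::nat. b i v * jtrace (\<lambda>x. a i x * f x) v)"
    and u: "u \<in> W"
  shows "(\<Sum>i<n. b i v * a i (u v)) = (if u = (\<lambda>v. v) then J v else 0)"
proof -
  \<comment> \<open>Each \<open>l (w, w')\<close> is a linear form that is nonzero only at points separated by \<open>w\<close> and \<open>w'\<close>, so
    the orbit of a point is free where the product \<open>?h\<close> does not vanish.\<close>
  let ?pairs = "{(w, w'). w \<in> W \<and> w' \<in> W \<and> w \<noteq> w'}"
  have fin: "finite ?pairs" by (rule finite_subset[OF _ finite_cartesian_product[OF finite_W finite_W]]) auto
  have sep: "\<exists>x. w x \<noteq> w' x" if "w \<noteq> w'" for w w' :: "'v \<Rightarrow> 'v" using that by auto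
  define pt where "pt = (\<lambda>w w' :: 'v \<Rightarrow> 'v. SOME x. w x \<noteq> w' x)"
  have pt: "w (pt w w') \<noteq> w' (pt w w')" if "w \<noteq> w'" for w w'
    unfolding pt_def by (rule someI_ex[OF sep[OF that]])
  define l where "l = (\<lambda>(w, w') v. cinner (w v - w' v) (w (pt w w') - w' (pt w w')))"
  have l_poly: "l p \<in> poly_funs" if pp: "p \<in> ?pairs" for p
  proof -
    obtain w w' where p: "p = (w, w')" "w \<in> W" "w' \<in> W" using pp by auto
    have "clinear (\<lambda>v. w v - w' v)"
      by (rule clinearI) (simp_all add: clinear_add clinear_scale W_linear p
          complex_vector.scale_right_diff_distrib)
    then show ?thesis
      unfolding l_def p using poly_funs_compose[OF poly_funs.linear[OF clinear_form_cinner]] by auto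
  qed
  let ?h = "\<lambda>v. \<Prod>p\<in>?pairs. l p v"
  have h_poly: "?h \<in> poly_funs" by (rule poly_funs_prod[OF l_poly])
  have "\<exists>v\<in>UNIV. ?h v \<noteq> 0"
  proof (rule poly_funs_prod_nonzero[OF complex_vector.subspace_UNIV fin l_poly])
    fix p assume "p \<in> ?pairs"
    then obtain w w' where p: "p = (w, w')" "w \<noteq> w'" by auto
    then have "l p (pt w w') \<noteq> 0"
      using pt[OF p(2)] cinner_self_eq_0[of "w (pt w w') - w' (pt w w')"] by (auto simp: l_def)
    then show "\<exists>v\<in>UNIV. l p v \<noteq> 0" by blast
  qed
  then have h_nz: "\<exists>v. ?h v \<noteq> 0" by blast
  have "(\<lambda>v. \<Sum>i<n. b i v * a i (u v)) = (\<lambda>v. if u = (\<lambda>v. v) then J v else 0)"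
  proof (rule poly_funs_eqI[OF _ _ h_poly h_nz])
    show "(\<lambda>v. \<Sum>i<n. b i v * a i (u v)) \<in> poly_funs"
    proof (rule poly_funs_sum)
      fix i assume "i \<in> {..<n}"
      then show "(\<lambda>v. b i v * a i (u v)) \<in> poly_funs"
        using ab poly_funs_compose[OF _ W_linear[OF u], of "a i"] by (intro poly_funs.mult) auto
    qed
    show "(\<lambda>v. if u = (\<lambda>v. v) then J v else 0) \<in> poly_funs"
      using J_poly poly_funs.const[of 0] by (cases "u = (\<lambda>v. v)") simp_all
    fix v assume "?h v \<noteq> 0"
    then have distinct: "w v \<noteq> w' v" if "w \<in> W" "w' \<in> W" "w \<noteq> w'" for w w'
    proof -
      have "l (w, w') v \<noteq> 0" using \<open>?h v \<noteq> 0\<close> fin that by auto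
      moreover have "cinner 0 x = 0" for x :: 'v
        using clinear_form_zero[OF clinear_form_cinner] by blast
      ultimately show ?thesis by (auto simp: l_def)
    qed
    \<comment> \<open>a polynomial that vanishes at all points of the orbit except \<open>u v\<close>\<close>
    define f where "f = (\<lambda>x. \<Prod>w\<in>W - {u}. cinner (x - w v) (u v - w v))"
    have f_poly: "f \<in> poly_funs"
      unfolding f_def
    proof (rule poly_funs_prod)
      fix w
      have "(\<lambda>x. cinner x (u v - w v) - cinner (w v) (u v - w v)) \<in> poly_funs"
        by (intro poly_funs_diff poly_funs.linear clinear_form_cinner poly_funs.const)
      then show "(\<lambda>x. cinner (x - w v) (u v - w v)) \<in> poly_funs"
        by (simp add: clinear_form_diff[OF clinear_form_cinner])
    qed
    have f_u: "f (u v) \<noteq> 0"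
    proof -
      have "cinner (u v - w v) (u v - w v) \<noteq> 0" if "w \<in> W - {u}" for w
        using cinner_self_eq_0[of "u v - w v"] distinct[OF u, of w] that by auto
      then show ?thesis unfolding f_def using finite_W by simp
    qed
    have f_other: "f (w v) = 0" if "w \<in> W" "w \<noteq> u" for w
    proof -
      have "cinner 0 x = 0" for x :: 'v using clinear_form_zero[OF clinear_form_cinner] by blast
      then show ?thesis unfolding f_def using that finite_W
        by (intro prod_zero) (auto intro!: bexI[of _ w])
    qed
    have "J v * f v = (\<Sum>i<n. b i v * (J v * jtrace (\<lambda>x. a i x * f x) v))"
      by (subst rep[OF f_poly]) (simp add: sum_distrib_left mult.left_commute)
    also have "\<dots> = (\<Sum>i<n. b i v * (cdet u * (a i (u v) * f (u v))))"
    proof (rule sum.cong[OF refl])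
      fix i assume "i \<in> {..<n}"
      then have "J v * jtrace (\<lambda>x. a i x * f x) v = (\<Sum>w\<in>W. cdet w * (a i (w v) * f (w v)))"
        using ab f_poly by (intro J_jtrace poly_funs.mult) auto
      also have "\<dots> = (\<Sum>w\<in>{u}. cdet w * (a i (w v) * f (w v)))"
        by (rule sum.mono_neutral_right) (auto simp: finite_W u f_other)
      finally show "b i v * (J v * jtrace (\<lambda>x. a i x * f x) v) = b i v * (cdet u * (a i (u v) * f (u v)))"
        by simp
    qed
    also have "\<dots> = (\<Sum>i<n. b i v * a i (u v)) * (cdet u * f (u v))"
      unfolding sum_distrib_right by (rule sum.cong) (simp_all only: mult_ac)
    finally have eq: "J v * f v = (\<Sum>i<n. b i v * a i (u v)) * (cdet u * f (u v))" .
    show "(\<Sum>i<n. b i v * a i (u v)) = (if u = (\<lambda>v. v) then J v else 0)"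
    proof (cases "u = (\<lambda>v. v)")
      case True
      then show ?thesis using eq f_u by (simp add: cdet_id)
    next
      case False
      then have "f v = 0" using f_other[OF W_id] by simp
      then show ?thesis using eq f_u cdet_nonzero[OF u] False by simp
    qed
  qed
  then show ?thesis by (rule fun_cong)
qed

end

section \<open>Alternating forms\<close>

lemma clinear_form_cmult: "clinear_form f \<Longrightarrow> clinear_form (\<lambda>x. c * f x)"
  by (rule clinear_formI) (simp_all add: clinear_form_add clinear_form_scale distrib_left mult.left_commute)

lemma clinear_form_plus: "clinear_form f \<Longrightarrow> clinear_form g \<Longrightarrow> clinear_form (\<lambda>x. f x + g x)"
  by (rule clinear_formI) (simp_all add: clinear_form_add clinear_form_scale distrib_left)

lemma clinear_form_sum_fun:
  "(\<And>i. i \<in> I \<Longrightarrow> clinear_form (f i)) \<Longrightarrow> clinear_form (\<lambda>x. \<Sum>i\<in>I. f i x)"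
  by (induction I rule: infinite_finite_induct) (auto intro: clinear_form_plus clinear_form_0)

lemma alternating_form_length: "alternating_form p \<phi> \<Longrightarrow> length us \<noteq> p \<Longrightarrow> \<phi> us = 0"
  by (simp add: alternating_form_def)

lemma alternating_form_linear:
  assumes "alternating_form p \<phi>"
  shows "clinear_form (\<lambda>x. \<phi> (A @ x # B))"
proof (cases "length A + Suc (length B) = p")
  case True
  have "\<forall>us i. length us = p \<longrightarrow> i < p \<longrightarrow> clinear_form (\<lambda>x. \<phi> (us[i := x]))"
    using assms unfolding alternating_form_def by blast
  from this[rule_format, of "A @ 0 # B" "length A"] show ?thesis using True by simp
next
  case False
  then have "(\<lambda>x. \<phi> (A @ x # B)) = (\<lambda>x. 0)"
    using alternating_form_length[OF assms] by auto
  then show ?thesis using clinear_form_0 by simp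
qed

lemma alternating_form_repeat:
  assumes "alternating_form p \<phi>"
  shows "\<phi> (A @ x # B @ x # C) = 0"
proof (cases "length (A @ x # B @ x # C) = p")
  case True
  let ?us = "A @ x # B @ x # C"
  have "?us ! length A = x" "?us ! Suc (length A + length B) = x"
    by (simp_all add: nth_append)
  moreover have "length A < Suc (length A + length B)" "Suc (length A + length B) < p"
    using True by auto
  ultimately show ?thesis using assms True unfolding alternating_form_def by metis
qed (rule alternating_form_length[OF assms])

lemma alternating_formI:
  assumes "\<And>us. length us \<noteq> p \<Longrightarrow> \<phi> us = 0"
    and lin: "\<And>A B. length A + Suc (length B) = p \<Longrightarrow> clinear_form (\<lambda>x. \<phi> (A @ x # B))"
    and rep: "\<And>A B C x. length A + length B + length C + 2 = p \<Longrightarrow> \<phi> (A @ x # B @ x # C) = 0"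
  shows "alternating_form p \<phi>"
  unfolding alternating_form_def
proof (intro conjI allI impI)
  show "\<phi> us = 0" if "length us \<noteq> p" for us using assms(1)[OF that] .
  show "clinear_form (\<lambda>x. \<phi> (us[i := x]))" if "length us = p" "i < p" for us i
    using lin[of "take i us" "drop (Suc i) us"] that by (simp add: upd_conv_take_nth_drop)
  show "\<phi> us = 0" if us: "length us = p" "i < j" "j < p" "us ! i = us ! j" for us i j
  proof -
    have "us = take i us @ us ! i # drop (Suc i) us" using us by (intro id_take_nth_drop) simp
    moreover have "drop (Suc i) us = take (j - Suc i) (drop (Suc i) us) @ us ! j # drop (Suc j) us"
      using us id_take_nth_drop[of "j - Suc i" "drop (Suc i) us"] by simp
    ultimately have eq: "us = take i us @ us ! i # take (j - Suc i) (drop (Suc i) us) @ us ! i # drop (Suc j) us"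
      using us(4) by metis
    show ?thesis
      by (subst eq) (rule rep, use us in simp)
  qed
qed

lemma alternating_form_cmult: "alternating_form p \<phi> \<Longrightarrow> alternating_form p (\<lambda>us. c * \<phi> us)"
  by (rule alternating_formI)
    (auto intro: clinear_form_cmult alternating_form_linear
      simp: alternating_form_length alternating_form_repeat)

lemma alternating_form_add:
  "alternating_form p \<phi> \<Longrightarrow> alternating_form p \<psi> \<Longrightarrow> alternating_form p (\<lambda>us. \<phi> us + \<psi> us)"
  by (rule alternating_formI)
    (auto intro: clinear_form_plus alternating_form_linear
      simp: alternating_form_length alternating_form_repeat)

lemma alternating_form_zero: "alternating_form p (\<lambda>us. 0)"
  unfolding alternating_form_def by (simp add: clinear_form_0)

lemma alternating_form_map:
  assumes "alternating_form p \<phi>" "clinear g"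
  shows "alternating_form p (\<lambda>us. \<phi> (map g us))"
proof (rule alternating_formI)
  show "\<phi> (map g us) = 0" if "length us \<noteq> p" for us
    using alternating_form_length[OF assms(1)] that by simp
  show "clinear_form (\<lambda>x. \<phi> (map g (A @ x # B)))" for A B
    using clinear_form_compose[OF alternating_form_linear[OF assms(1)] assms(2)] by simp
  show "\<phi> (map g (A @ x # B @ x # C)) = 0" for A B C x
    using alternating_form_repeat[OF assms(1)] by simp
qed

lemma alternating_form_move:
  assumes "alternating_form p \<phi>"
  shows "\<phi> (A @ x # B @ C) = (-1) ^ length B * \<phi> (A @ B @ x # C)"
proof (induction B arbitrary: A)
  case Nil
  then show ?case by simp
next
  case (Cons y B)
  note lin1 = alternating_form_linear[OF assms, of A]
  have lin2: "clinear_form (\<lambda>y. \<phi> (A @ x # y # B @ C))" for x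
    using alternating_form_linear[OF assms, of "A @ [x]"] by simp
  have "\<phi> (A @ (x + y) # (x + y) # B @ C) = 0"
    using alternating_form_repeat[OF assms, of A "x + y" "[]"] by simp
  moreover have "\<phi> (A @ x # x # B @ C) = 0" "\<phi> (A @ y # y # B @ C) = 0"
    using alternating_form_repeat[OF assms, of A _ "[]"] by auto
  ultimately have "\<phi> (A @ x # y # B @ C) = - \<phi> (A @ y # x # B @ C)"
    by (simp add: clinear_form_add[OF lin1] clinear_form_add[OF lin2] add_eq_0_iff2)
  also have "\<phi> (A @ y # x # B @ C) = (-1) ^ length B * \<phi> (A @ y # B @ x # C)"
    using Cons.IH[of "A @ [y]"] by simp
  finally show ?case by simp
qed

text \<open>
  The alternating sum that occurs both in the exterior derivative and in the product of a linear
  form with an alternating form.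
\<close>

definition wedge_sum :: "('v \<Rightarrow> 'v list \<Rightarrow> complex) \<Rightarrow> 'v list \<Rightarrow> complex" where
  "wedge_sum \<psi> us = (\<Sum>i<length us. (-1) ^ i * \<psi> (us ! i) (take i us @ drop (Suc i) us))"

text \<open>
  If two of the arguments agree, only the two terms survive in which one of them is omitted; moving
  the remaining one across the arguments in between shows that they cancel.
\<close>

lemma wedge_sum_alternating:
  assumes alt: "\<And>x. alternating_form p (\<psi> x)" and lin: "\<And>us. clinear_form (\<lambda>x. \<psi> x us)"
  shows "alternating_form (Suc p) (wedge_sum \<psi>)"
proof (rule alternating_formI)
  fix us :: "'a list" assume us: "length us \<noteq> Suc p"
  have "\<psi> (us ! i) (take i us @ drop (Suc i) us) = 0" if "i < length us" for i
    by (rule alternating_form_length[OF alt]) (use us that in auto)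
  then show "wedge_sum \<psi> us = 0" by (simp add: wedge_sum_def)
next
  fix A B :: "'a list" assume len: "length A + Suc (length B) = Suc p"
  have term_lin: "clinear_form (\<lambda>x. \<psi> ((A @ x # B) ! i) (take i (A @ x # B) @ drop (Suc i) (A @ x # B)))"
    (is "clinear_form (?t i)") for i
  proof -
    consider "i < length A" | "i = length A" | "i > length A" by linarith
    then show ?thesis
    proof cases
      case 1
      then have "?t i = (\<lambda>x. \<psi> (A ! i) ((take i A @ drop (Suc i) A) @ x # B))"
        by (auto simp: nth_append)
      then show ?thesis using alternating_form_linear[OF alt] by metis
    next
      case 2
      then have "?t i = (\<lambda>x. \<psi> x (A @ B))" by simp
      then show ?thesis using lin by simp
    next
      case 3
      define k where "k = i - Suc (length A)"
      have i: "i = Suc (length A + k)" using 3 by (simp add: k_def)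
      have "?t i = (\<lambda>x. \<psi> (B ! k) (A @ x # (take k B @ drop (Suc k) B)))"
        unfolding i by (auto simp: nth_append)
      then show ?thesis using alternating_form_linear[OF alt] by metis
    qed
  qed
  show "clinear_form (\<lambda>x. wedge_sum \<psi> (A @ x # B))"
    unfolding wedge_sum_def length_append length_Cons
    by (rule clinear_form_sum_fun, rule clinear_form_cmult, rule term_lin)
next
  fix A B C :: "'a list" and x :: 'a
  let ?us = "A @ x # B @ x # C"
  let ?i = "length A" and ?j = "Suc (length A + length B)"
  let ?t = "\<lambda>k. (-1) ^ k * \<psi> (?us ! k) (take k ?us @ drop (Suc k) ?us)"
  have zero: "?t k = 0" if k: "k < length ?us" "k \<noteq> ?i" "k \<noteq> ?j" for k
  proof -
    let ?y = "?us ! k"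
    consider "k < ?i" | "k > ?i" "k < ?j" | "k > ?j" using k by linarith
    then have "\<psi> ?y (take k ?us @ drop (Suc k) ?us) = 0"
    proof cases
      case 1
      then show ?thesis
        using alternating_form_repeat[OF alt, of ?y "take k A @ drop (Suc k) A" x B C] by simp
    next
      case 2
      define m where "m = k - Suc (length A)"
      have m: "k = Suc (length A + m)" "m < length B" using 2 by (auto simp: m_def)
      have "take k ?us @ drop (Suc k) ?us = A @ x # (take m B @ drop (Suc m) B) @ x # C"
        using m by simp
      then show ?thesis using alternating_form_repeat[OF alt] by metis
    next
      case 3
      define m where "m = k - Suc (Suc (length A + length B))"
      have m: "k = length (A @ x # B @ [x]) + m" using 3 by (auto simp: m_def)
      have "take k ((A @ x # B @ [x]) @ C) @ drop (Suc k) ((A @ x # B @ [x]) @ C) =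
          (A @ x # B @ [x]) @ (take m C @ drop (Suc m) C)"
        unfolding m take_append drop_append by simp
      then have "take k ?us @ drop (Suc k) ?us = A @ x # B @ x # (take m C @ drop (Suc m) C)"
        by simp
      then show ?thesis using alternating_form_repeat[OF alt] by metis
    qed
    then show ?thesis by simp
  qed
  have "wedge_sum \<psi> ?us = (\<Sum>k\<in>{?i, ?j}. ?t k)"
    unfolding wedge_sum_def by (rule sum.mono_neutral_right) (use zero in auto)
  also have "\<dots> = ?t ?i + ?t ?j" by simp
  also have "?t ?i = (-1) ^ length A * \<psi> x (A @ B @ x # C)" by simp
  also have "?t ?j = (-1) ^ Suc (length A + length B) * \<psi> x (A @ x # B @ C)"
    by (simp add: nth_append)
  also have "\<psi> x (A @ x # B @ C) = (-1) ^ length B * \<psi> x (A @ B @ x # C)"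
    by (rule alternating_form_move[OF alt])
  finally have "wedge_sum \<psi> ?us = (-1) ^ length A * \<psi> x (A @ B @ x # C) -
      (-1) ^ length A * ((-1) ^ length B * (-1) ^ length B) * \<psi> x (A @ B @ x # C)"
    by (simp add: power_add)
  then show "wedge_sum \<psi> ?us = 0" by (simp add: power_mult_distrib[symmetric])
qed

text \<open>
  A property of argument lists that is stable under linear combinations in each slot need only be
  checked when all arguments lie in the hyperplane or are equal to the normal vector.
\<close>

lemma arguments_adapted_to_hyperplane:
  assumes dec: "\<And>u. \<exists>c. u - c *\<^sub>C a \<in> H"
    and base: "\<And>us. length us = p \<Longrightarrow> set us \<subseteq> insert a H \<Longrightarrow> P us"
    and step: "\<And>A B h c. length A + Suc (length B) = p \<Longrightarrow> P (A @ h # B) \<Longrightarrow> P (A @ a # B) \<Longrightarrow>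
      P (A @ (h + c *\<^sub>C a) # B)"
    and len: "length us = p"
  shows "P us"
proof -
  have "P (A @ B)" if "length (A @ B) = p" "set B \<subseteq> insert a H" for A B
    using that
  proof (induction A arbitrary: B rule: rev_induct)
    case Nil
    then show ?case using base by simp
  next
    case (snoc u A)
    obtain c where c: "u - c *\<^sub>C a \<in> H" using dec by blast
    have "P (A @ (u - c *\<^sub>C a) # B)" "P (A @ a # B)"
      using snoc.prems c by (auto intro!: snoc.IH)
    then have "P (A @ ((u - c *\<^sub>C a) + c *\<^sub>C a) # B)"
      using snoc.prems by (intro step) auto
    then show ?case by simp
  qed
  from this[of us "[]"] show ?thesis using len by simp
qed

section \<open>Polynomial differential forms\<close>

lemma poly_forms_alternating: "\<eta> \<in> poly_forms p \<Longrightarrow> alternating_form p (\<eta> v)"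
  and poly_forms_poly: "\<eta> \<in> poly_forms p \<Longrightarrow> (\<lambda>v. \<eta> v us) \<in> poly_funs"
  by (auto simp: poly_forms_def)

lemma poly_forms_add:
  "\<eta> \<in> poly_forms p \<Longrightarrow> \<theta> \<in> poly_forms p \<Longrightarrow> (\<lambda>v us. \<eta> v us + \<theta> v us) \<in> poly_forms p"
  by (auto simp: poly_forms_def intro: alternating_form_add poly_funs.add)

lemma poly_forms_scale:
  "f \<in> poly_funs \<Longrightarrow> \<eta> \<in> poly_forms p \<Longrightarrow> (\<lambda>v us. f v * \<eta> v us) \<in> poly_forms p"
  by (auto simp: poly_forms_def intro: alternating_form_cmult poly_funs.mult)

lemma poly_forms_zero: "(\<lambda>v us. 0) \<in> poly_forms p"
  by (auto simp: poly_forms_def intro: alternating_form_zero poly_funs.const)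

lemma poly_forms_sum:
  "(\<And>i. i \<in> I \<Longrightarrow> \<eta> i \<in> poly_forms p) \<Longrightarrow> (\<lambda>v us. \<Sum>i\<in>I. \<eta> i v us) \<in> poly_forms p"
  by (induction I rule: infinite_finite_induct) (auto intro: poly_forms_add poly_forms_zero)

lemma poly_forms_pullback:
  assumes "\<eta> \<in> poly_forms p" "clinear g"
  shows "(\<lambda>v us. \<eta> (g v) (map g us)) \<in> poly_forms p"
  using poly_forms_alternating[OF assms(1)] poly_funs_compose[OF poly_forms_poly[OF assms(1)] assms(2)]
  by (simp add: poly_forms_def alternating_form_map[OF _ assms(2)])

text \<open>Being alternating is an identity in the point, so it extends from a dense set.\<close>

lemma poly_formsI_generic:
  assumes poly: "\<And>us. (\<lambda>v. \<eta> v us) \<in> poly_funs"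
    and F: "F \<in> poly_funs" "\<exists>v. F v \<noteq> 0"
    and alt: "\<And>v. F v \<noteq> 0 \<Longrightarrow> alternating_form p (\<eta> v)"
  shows "\<eta> \<in> poly_forms p"
proof -
  have "alternating_form p (\<eta> v)" for v
  proof (rule alternating_formI)
    fix us :: "'a list" assume us: "length us \<noteq> p"
    have "(\<lambda>v. \<eta> v us) = (\<lambda>v. 0)"
      by (rule poly_funs_eqI[OF poly poly_funs.const F]) (use alternating_form_length[OF alt] us in blast)
    then show "\<eta> v us = 0" by (rule fun_cong)
  next
    fix A B :: "'a list"
    show "clinear_form (\<lambda>x. \<eta> v (A @ x # B))"
    proof (rule clinear_formI)
      fix x y c
      have "(\<lambda>v. \<eta> v (A @ (x + y) # B)) = (\<lambda>v. \<eta> v (A @ x # B) + \<eta> v (A @ y # B))"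
        by (rule poly_funs_eqI[OF poly poly_funs.add[OF poly poly] F])
          (rule clinear_form_add[OF alternating_form_linear[OF alt]])
      then show "\<eta> v (A @ (x + y) # B) = \<eta> v (A @ x # B) + \<eta> v (A @ y # B)" by (rule fun_cong)
      have "(\<lambda>v. \<eta> v (A @ (c *\<^sub>C x) # B)) = (\<lambda>v. c * \<eta> v (A @ x # B))"
        by (rule poly_funs_eqI[OF poly poly_funs_cmult[OF poly] F])
          (rule clinear_form_scale[OF alternating_form_linear[OF alt]])
      then show "\<eta> v (A @ (c *\<^sub>C x) # B) = c * \<eta> v (A @ x # B)" by (rule fun_cong)
    qed
  next
    fix A B C :: "'a list" and x
    have "(\<lambda>v. \<eta> v (A @ x # B @ x # C)) = (\<lambda>v. 0)"
      by (rule poly_funs_eqI[OF poly poly_funs.const F]) (rule alternating_form_repeat[OF alt])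
    then show "\<eta> v (A @ x # B @ x # C) = 0" by (rule fun_cong)
  qed
  then show ?thesis using poly by (simp add: poly_forms_def)
qed

lemma poly_forms_divide:
  assumes alt: "\<And>v. alternating_form p (E v)" and F: "F \<in> poly_funs" "\<exists>v. F v \<noteq> 0"
    and div: "\<And>us. divides_poly F (\<lambda>v. E v us)"
  shows "\<exists>\<eta>\<in>poly_forms p. \<forall>v us. E v us = F v * \<eta> v us"
proof -
  have "\<forall>us. \<exists>q. q \<in> poly_funs \<and> (\<forall>v. E v us = F v * q v)"
    using div unfolding divides_poly_def by blast
  then obtain q where q: "\<And>us. q us \<in> poly_funs" "\<And>us v. E v us = F v * q us v"
    using choice[of "\<lambda>us q. q \<in> poly_funs \<and> (\<forall>v. E v us = F v * q v)"] by blast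
  have "(\<lambda>v us. q us v) \<in> poly_forms p"
  proof (rule poly_formsI_generic[OF _ F])
    show "(\<lambda>v. q us v) \<in> poly_funs" for us using q(1) .
    fix v assume "F v \<noteq> 0"
    then have "(\<lambda>us. q us v) = (\<lambda>us. inverse (F v) * E v us)"
      by (simp add: q(2) mult.assoc[symmetric])
    then show "alternating_form p (\<lambda>us. q us v)" using alternating_form_cmult[OF alt] by metis
  qed
  then show ?thesis using q(2) by (intro bexI[of _ "\<lambda>v us. q us v"]) auto
qed

definition dir_deriv :: "'v \<Rightarrow> ('v::unitary_space \<Rightarrow> complex) \<Rightarrow> 'v \<Rightarrow> complex" where
  "dir_deriv x f v = deriv (\<lambda>t. f (v + t *\<^sub>C x)) 0"

lemma poly_funs_derivative:
  assumes "f \<in> poly_funs"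
  shows "\<exists>D. (\<forall>x. D x \<in> poly_funs) \<and> (\<forall>v. clinear_form (\<lambda>x. D x v)) \<and>
    (\<forall>v x. ((\<lambda>t. f (v + t *\<^sub>C x)) has_field_derivative D x v) (at 0))"
  using assms
proof (induction rule: poly_funs.induct)
  case (const c)
  show ?case by (rule exI[of _ "\<lambda>x v. 0"]) (auto intro: poly_funs.const clinear_form_0)
next
  case (linear f)
  have "((\<lambda>t. f (v + t *\<^sub>C x)) has_field_derivative f x) (at 0)" for v x
    by (simp add: clinear_form_add[OF linear] clinear_form_scale[OF linear])
      (auto intro!: derivative_eq_intros)
  then show ?case
    by (intro exI[of _ "\<lambda>x v. f x"]) (auto intro: poly_funs.const linear)
next
  case (add f g)
  then obtain D E where D: "\<And>x. D x \<in> poly_funs" "\<And>v. clinear_form (\<lambda>x. D x v)"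
      "\<And>v x. ((\<lambda>t. f (v + t *\<^sub>C x)) has_field_derivative D x v) (at 0)"
    and E: "\<And>x. E x \<in> poly_funs" "\<And>v. clinear_form (\<lambda>x. E x v)"
      "\<And>v x. ((\<lambda>t. g (v + t *\<^sub>C x)) has_field_derivative E x v) (at 0)"
    by blast
  show ?case
  proof (intro exI[of _ "\<lambda>x v. D x v + E x v"] conjI allI)
    show "(\<lambda>v. D x v + E x v) \<in> poly_funs" for x by (rule poly_funs.add[OF D(1) E(1)])
    show "clinear_form (\<lambda>x. D x v + E x v)" for v
      by (rule clinear_formI)
        (simp_all add: clinear_form_add[OF D(2)] clinear_form_add[OF E(2)]
          clinear_form_scale[OF D(2)] clinear_form_scale[OF E(2)] distrib_left)
    show "((\<lambda>t. f (v + t *\<^sub>C x) + g (v + t *\<^sub>C x)) has_field_derivative D x v + E x v) (at 0)" for v x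
      by (rule DERIV_add[OF D(3) E(3)])
  qed
next
  case (mult f g)
  then obtain D E where D: "\<And>x. D x \<in> poly_funs" "\<And>v. clinear_form (\<lambda>x. D x v)"
      "\<And>v x. ((\<lambda>t. f (v + t *\<^sub>C x)) has_field_derivative D x v) (at 0)"
    and E: "\<And>x. E x \<in> poly_funs" "\<And>v. clinear_form (\<lambda>x. E x v)"
      "\<And>v x. ((\<lambda>t. g (v + t *\<^sub>C x)) has_field_derivative E x v) (at 0)"
    by blast
  show ?case
  proof (intro exI[of _ "\<lambda>x v. D x v * g v + E x v * f v"] conjI allI)
    show "(\<lambda>v. D x v * g v + E x v * f v) \<in> poly_funs" for x
      by (intro poly_funs.add poly_funs.mult D E mult.hyps)
    show "clinear_form (\<lambda>x. D x v * g v + E x v * f v)" for v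
      by (rule clinear_formI)
        (simp_all add: clinear_form_add[OF D(2)] clinear_form_add[OF E(2)]
          clinear_form_scale[OF D(2)] clinear_form_scale[OF E(2)] distrib_left distrib_right)
    show "((\<lambda>t. f (v + t *\<^sub>C x) * g (v + t *\<^sub>C x)) has_field_derivative
        D x v * g v + E x v * f v) (at 0)" for v x
      using DERIV_mult[OF D(3) E(3), of v x v x] by simp
  qed
qed

lemma dir_deriv:
  assumes "f \<in> poly_funs"
  shows dir_deriv_poly: "dir_deriv x f \<in> poly_funs"
    and dir_deriv_linear: "clinear_form (\<lambda>x. dir_deriv x f v)"
    and dir_deriv_has_derivative:
      "((\<lambda>t. f (v + t *\<^sub>C x)) has_field_derivative dir_deriv x f v) (at 0)"
proof -
  obtain D where D: "\<And>x. D x \<in> poly_funs" "\<And>v. clinear_form (\<lambda>x. D x v)"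
    "\<And>v x. ((\<lambda>t. f (v + t *\<^sub>C x)) has_field_derivative D x v) (at 0)"
    using poly_funs_derivative[OF assms] by blast
  have eq: "(\<lambda>v. dir_deriv x f v) = D x" for x
    unfolding dir_deriv_def using DERIV_imp_deriv[OF D(3)] by auto
  then have eq': "dir_deriv x f v = D x v" for x v by metis
  show "dir_deriv x f \<in> poly_funs" using eq D(1) by simp
  show "clinear_form (\<lambda>x. dir_deriv x f v)" unfolding eq' by (rule D(2))
  show "((\<lambda>t. f (v + t *\<^sub>C x)) has_field_derivative dir_deriv x f v) (at 0)"
    unfolding eq' by (rule D(3))
qed

lemma dir_deriv_eqI:
  "((\<lambda>t. f (v + t *\<^sub>C x)) has_field_derivative d) (at 0) \<Longrightarrow> dir_deriv x f v = d"
  unfolding dir_deriv_def by (rule DERIV_imp_deriv)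

lemma dir_deriv_add:
  assumes "f \<in> poly_funs" "g \<in> poly_funs"
  shows "dir_deriv x (\<lambda>v. f v + g v) v = dir_deriv x f v + dir_deriv x g v"
  by (rule dir_deriv_eqI, rule DERIV_add) (rule dir_deriv_has_derivative[OF assms(1)]
      dir_deriv_has_derivative[OF assms(2)])+

lemma dir_deriv_cmult:
  assumes "f \<in> poly_funs"
  shows "dir_deriv x (\<lambda>v. c * f v) v = c * dir_deriv x f v"
  by (rule dir_deriv_eqI, rule DERIV_cmult, rule dir_deriv_has_derivative[OF assms])

lemma dir_deriv_mult:
  assumes "f \<in> poly_funs" "g \<in> poly_funs"
  shows "dir_deriv x (\<lambda>v. f v * g v) v = dir_deriv x f v * g v + dir_deriv x g v * f v"
  using DERIV_mult[OF dir_deriv_has_derivative[OF assms(1)] dir_deriv_has_derivative[OF assms(2)], of v x v x]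
  by (intro dir_deriv_eqI) simp

lemma dir_deriv_form:
  assumes "clinear_form f"
  shows "dir_deriv x f v = f x"
proof (rule dir_deriv_eqI)
  show "((\<lambda>t. f (v + t *\<^sub>C x)) has_field_derivative f x) (at 0)"
    by (simp add: clinear_form_add[OF assms] clinear_form_scale[OF assms])
      (auto intro!: derivative_eq_intros)
qed

lemma dir_deriv_alternating:
  assumes \<eta>: "\<eta> \<in> poly_forms p"
  shows "alternating_form p (\<lambda>us. dir_deriv x (\<lambda>v. \<eta> v us) v)"
proof (rule alternating_formI)
  have zero: "dir_deriv x (\<lambda>v. 0) v = 0" by (rule dir_deriv_eqI) simp
  show "dir_deriv x (\<lambda>v. \<eta> v us) v = 0" if "length us \<noteq> p" for us
    using alternating_form_length[OF poly_forms_alternating[OF \<eta>] that] zero by simp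
  show "clinear_form (\<lambda>y. dir_deriv x (\<lambda>v. \<eta> v (A @ y # B)) v)" for A B
    by (rule clinear_formI)
      (simp_all add: clinear_form_add[OF alternating_form_linear[OF poly_forms_alternating[OF \<eta>]]]
        clinear_form_scale[OF alternating_form_linear[OF poly_forms_alternating[OF \<eta>]]]
        dir_deriv_add dir_deriv_cmult poly_forms_poly[OF \<eta>])
  show "dir_deriv x (\<lambda>v. \<eta> v (A @ y # B @ y # C)) v = 0" for A B C y
    using alternating_form_repeat[OF poly_forms_alternating[OF \<eta>]] zero by simp
qed

text \<open>The numerator of \<open>d (\<eta>/Q)\<close> over the denominator \<open>Q\<^sup>2\<close>, that is \<open>Q d\<eta> - dQ \<and> \<eta>\<close>.\<close>

definition quotient_rule_form :: "('v::unitary_space \<Rightarrow> complex) \<Rightarrow> 'v dform \<Rightarrow> 'v dform" where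
  "quotient_rule_form F \<eta> v =
    wedge_sum (\<lambda>x us. dir_deriv x (\<lambda>v. \<eta> v us) v * F v - dir_deriv x F v * \<eta> v us)"

lemma quotient_rule_form_alternating:
  assumes \<eta>: "\<eta> \<in> poly_forms p" and F: "F \<in> poly_funs"
  shows "alternating_form (Suc p) (quotient_rule_form F \<eta> v)"
  unfolding quotient_rule_form_def
proof (rule wedge_sum_alternating)
  fix x
  have "alternating_form p (\<lambda>us. F v * dir_deriv x (\<lambda>v. \<eta> v us) v + (- dir_deriv x F v) * \<eta> v us)"
    by (intro alternating_form_add alternating_form_cmult dir_deriv_alternating[OF \<eta>]
        poly_forms_alternating[OF \<eta>])
  then show "alternating_form p (\<lambda>us. dir_deriv x (\<lambda>v. \<eta> v us) v * F v - dir_deriv x F v * \<eta> v us)"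
    by (simp add: mult.commute)
next
  fix us
  show "clinear_form (\<lambda>x. dir_deriv x (\<lambda>v. \<eta> v us) v * F v - dir_deriv x F v * \<eta> v us)"
    by (rule clinear_formI)
      (simp_all add: clinear_form_add[OF dir_deriv_linear[OF poly_forms_poly[OF \<eta>]]]
        clinear_form_add[OF dir_deriv_linear[OF F]]
        clinear_form_scale[OF dir_deriv_linear[OF poly_forms_poly[OF \<eta>]]]
        clinear_form_scale[OF dir_deriv_linear[OF F]] algebra_simps)
qed

lemma quotient_rule_form_poly:
  assumes \<eta>: "\<eta> \<in> poly_forms p" and F: "F \<in> poly_funs"
  shows "(\<lambda>v. quotient_rule_form F \<eta> v us) \<in> poly_funs"
  unfolding quotient_rule_form_def wedge_sum_def
  by (rule poly_funs_sum, rule poly_funs_cmult, rule poly_funs_diff; rule poly_funs.mult)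
    (auto intro: dir_deriv_poly F poly_forms_poly[OF \<eta>])

lemma ext_deriv_over:
  assumes \<eta>: "\<eta> \<in> poly_forms p" and F: "F \<in> poly_funs" and v: "F v \<noteq> 0"
  shows "ext_deriv (over F \<eta>) v us = quotient_rule_form F \<eta> v us / (F v * F v)"
proof -
  have "deriv (\<lambda>t. over F \<eta> (v + t *\<^sub>C x) ws) 0 =
      (dir_deriv x (\<lambda>v. \<eta> v ws) v * F v - dir_deriv x F v * \<eta> v ws) / (F v * F v)" for x ws
  proof (rule DERIV_imp_deriv)
    show "((\<lambda>t. over F \<eta> (v + t *\<^sub>C x) ws) has_field_derivative
        (dir_deriv x (\<lambda>v. \<eta> v ws) v * F v - dir_deriv x F v * \<eta> v ws) / (F v * F v)) (at 0)"
      using DERIV_divide[OF dir_deriv_has_derivative[OF poly_forms_poly[OF \<eta>]]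
          dir_deriv_has_derivative[OF F], of v x v x ws] v
      by (simp add: over_def mult.commute)
  qed
  then show ?thesis
    by (simp add: ext_deriv_def quotient_rule_form_def wedge_sum_def sum_divide_distrib)
qed

section \<open>Logarithmic forms and anti-invariant forms\<close>

context reflection_group
begin

text \<open>
  The pullback of the form to each hyperplane of the arrangement is zero.
\<close>

definition tangentially_zero :: "'v dform \<Rightarrow> bool" where
  "tangentially_zero \<eta> \<longleftrightarrow> (\<forall>H\<in>arrangement. \<forall>v\<in>H. \<forall>us. set us \<subseteq> H \<longrightarrow> \<eta> v us = 0)"

lemma decompose_along_normal:
  "H \<in> arrangement \<Longrightarrow> \<exists>c. u - c *\<^sub>C normal_vector H \<in> H"
  by (rule exI[of _ "\<alpha> H u"])
    (simp add: mem_arrangement clinear_form_diff[OF arrangement_form(1)]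
      clinear_form_scale[OF arrangement_form(1)] form_normal_vector)

lemma quotient_rule_form_on_hyperplane:
  assumes H: "H \<in> arrangement" and v: "v \<in> H"
  shows "quotient_rule_form Q \<eta> v us =
    - (\<Prod>K\<in>arrangement - {H}. \<alpha> K v) * wedge_sum (\<lambda>x ws. \<alpha> H x * \<eta> v ws) us"
proof -
  let ?G = "\<lambda>v. \<Prod>K\<in>arrangement - {H}. \<alpha> K v"
  have G: "?G \<in> poly_funs" by (intro poly_funs_prod poly_funs.linear arrangement_form) auto
  have Q: "Q = (\<lambda>v. \<alpha> H v * ?G v)"
    unfolding Q_def defining_polynomial_def using prod.remove[OF finite_arrangement H] by auto
  have \<alpha>v: "\<alpha> H v = 0" using v mem_arrangement[OF H] by simp
  then have "Q v = 0" by (simp add: Q)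
  moreover have "dir_deriv x Q v = \<alpha> H x * ?G v" for x
    unfolding Q using dir_deriv_mult[OF poly_funs.linear[OF arrangement_form(1)[OF H]] G, of x v] \<alpha>v
    by (simp add: dir_deriv_form[OF arrangement_form(1)[OF H]])
  ultimately show ?thesis
    unfolding quotient_rule_form_def wedge_sum_def sum_distrib_left
    by (intro sum.cong) (auto simp: mult_ac)
qed

text \<open>
  Along \<open>H\<close> the numerator \<open>Q d\<eta> - dQ \<and> \<eta>\<close> is a multiple of \<open>\<alpha>\<^sub>H \<and> \<eta>\<close>, which vanishes at a point
  exactly if the restriction of \<open>\<eta>\<close> to the tangent space of \<open>H\<close> does.
\<close>

lemma logarithmic_iff_tangentially_zero:
  assumes \<eta>: "\<eta> \<in> poly_forms p"
  shows "(\<exists>\<theta>\<in>poly_forms (Suc p). \<forall>v. Q v \<noteq> 0 \<longrightarrow> ext_deriv (over Q \<eta>) v = over Q \<theta> v) \<longleftrightarrow>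
    tangentially_zero \<eta>" (is "?log \<longleftrightarrow> _")
proof
  assume ?log
  then obtain \<theta> where \<theta>: "\<theta> \<in> poly_forms (Suc p)"
    "\<And>v. Q v \<noteq> 0 \<Longrightarrow> ext_deriv (over Q \<eta>) v = over Q \<theta> v" by blast
  have E: "quotient_rule_form Q \<eta> v us = Q v * \<theta> v us" for v us
  proof -
    have "(\<lambda>v. quotient_rule_form Q \<eta> v us) = (\<lambda>v. Q v * \<theta> v us)"
    proof (rule poly_funs_eqI[OF quotient_rule_form_poly[OF \<eta> Q_poly] _ Q_poly Q_nonzero])
      show "(\<lambda>v. Q v * \<theta> v us) \<in> poly_funs" by (intro poly_funs.mult Q_poly poly_forms_poly[OF \<theta>(1)])
      fix v assume v: "Q v \<noteq> 0"
      have "quotient_rule_form Q \<eta> v us / (Q v * Q v) = \<theta> v us / Q v"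
        using ext_deriv_over[OF \<eta> Q_poly v, of us] \<theta>(2)[OF v] by (simp add: over_def)
      then show "quotient_rule_form Q \<eta> v us = Q v * \<theta> v us" using v by (simp add: field_simps)
    qed
    then show ?thesis by (rule fun_cong)
  qed
  show "tangentially_zero \<eta>"
    unfolding tangentially_zero_def
  proof (intro ballI allI impI)
    fix H v us assume H: "H \<in> arrangement" and v: "v \<in> H" and us: "set us \<subseteq> H"
    let ?G = "\<lambda>v. \<Prod>K\<in>arrangement - {H}. \<alpha> K v"
    have "?G v * \<eta> v us = 0" if v: "v \<in> H" for v
    proof -
      have "Q v = 0" using v H mem_arrangement[OF H] by (auto simp: Q_eq_0_iff)
      then have "?G v * wedge_sum (\<lambda>x ws. \<alpha> H x * \<eta> v ws) (normal_vector H # us) = 0"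
        using E[of v "normal_vector H # us"] quotient_rule_form_on_hyperplane[OF H v, of \<eta>] by simp
      moreover have "wedge_sum (\<lambda>x ws. \<alpha> H x * \<eta> v ws) (normal_vector H # us) = \<eta> v us"
      proof -
        have "\<alpha> H (us ! i) = 0" if "i < length us" for i
          using us that mem_arrangement[OF H] nth_mem by blast
        then show ?thesis
          unfolding wedge_sum_def length_Cons sum.lessThan_Suc_shift
          by (simp add: form_normal_vector[OF H])
      qed
      ultimately show ?thesis by simp
    qed
    moreover have "?G \<in> poly_funs" by (intro poly_funs_prod poly_funs.linear arrangement_form) auto
    moreover have "\<exists>w\<in>H. ?G w \<noteq> 0" using arrangement_generic_point[OF H, of "\<lambda>_. 1"] by simp
    ultimately show "\<eta> v us = 0"
      using poly_funs_eq_zero_on[OF arrangement_subspace[OF H] poly_forms_poly[OF \<eta>], of ?G us v] v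
      by (metis (no_types, lifting) mult_eq_0_iff)
  qed
next
  assume tz: "tangentially_zero \<eta>"
  have div: "divides_poly Q (\<lambda>v. quotient_rule_form Q \<eta> v us)" for us
    unfolding Q_eq
  proof (rule arrangement_prod_divides)
    show "(\<lambda>v. quotient_rule_form (arrangement_prod (\<lambda>_. 1)) \<eta> v us) \<in> poly_funs"
      using quotient_rule_form_poly[OF \<eta> Q_poly] by (simp add: Q_eq)
    fix H assume H: "H \<in> arrangement"
    note lin = arrangement_form(1)[OF H]
    let ?a = "normal_vector H"
    have wedge_zero: "wedge_sum (\<lambda>x ws. \<alpha> H x * \<eta> v ws) us = 0" if v: "v \<in> H" for v us
    proof -
      have alt: "alternating_form (Suc p) (wedge_sum (\<lambda>x ws. \<alpha> H x * \<eta> v ws))"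
      proof (rule wedge_sum_alternating)
        show "alternating_form p (\<lambda>ws. \<alpha> H x * \<eta> v ws)" for x
          by (rule alternating_form_cmult[OF poly_forms_alternating[OF \<eta>]])
        show "clinear_form (\<lambda>x. \<alpha> H x * \<eta> v us)" for us
          by (rule clinear_formI)
            (simp_all add: clinear_form_add[OF lin] clinear_form_scale[OF lin] distrib_right)
      qed
      show ?thesis
      proof (cases "length us = Suc p")
        case False
        then show ?thesis by (rule alternating_form_length[OF alt])
      next
        case True
        have dec: "\<exists>c. u - c *\<^sub>C ?a \<in> H" for u by (rule decompose_along_normal[OF H])
        show ?thesis
        proof (rule arguments_adapted_to_hyperplane[OF dec _ _ True])
          show "wedge_sum (\<lambda>x ws. \<alpha> H x * \<eta> v ws) (A @ (h + c *\<^sub>C ?a) # B) = 0"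
            if "wedge_sum (\<lambda>x ws. \<alpha> H x * \<eta> v ws) (A @ h # B) = 0"
              "wedge_sum (\<lambda>x ws. \<alpha> H x * \<eta> v ws) (A @ ?a # B) = 0" for A B h c
            using that by (simp add: clinear_form_add[OF alternating_form_linear[OF alt]]
                clinear_form_scale[OF alternating_form_linear[OF alt]])
        next
          fix us assume len: "length us = Suc p" and us: "set us \<subseteq> insert ?a H"
          show "wedge_sum (\<lambda>x ws. \<alpha> H x * \<eta> v ws) us = 0"
          proof (cases "?a \<in> set us")
            case False
            then have "set us \<subseteq> H" using us by blast
            then have "\<alpha> H (us ! i) = 0" if "i < length us" for i
              using nth_mem[OF that] mem_arrangement[OF H, of "us ! i"] by auto
            then show ?thesis by (simp add: wedge_sum_def)
          next
            case True
            then obtain A B where AB: "us = A @ ?a # B" by (auto simp: in_set_conv_decomp)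
            show ?thesis
            proof (cases "?a \<in> set (A @ B)")
              case True
              then have "(\<exists>C D. us = C @ ?a # D @ ?a # B) \<or> (\<exists>C D. us = A @ ?a # C @ ?a # D)"
                unfolding AB by (auto simp: in_set_conv_decomp)
              then show ?thesis using alternating_form_repeat[OF alt] by auto
            next
              case False
              then have ABH: "set (A @ B) \<subseteq> H" using us AB by auto
              have "\<alpha> H (us ! i) * \<eta> v (take i us @ drop (Suc i) us) = 0" if i: "i < length us" for i
              proof (cases "i = length A")
                case True
                then have "take i us @ drop (Suc i) us = A @ B" by (simp add: AB)
                then show ?thesis using tz H v ABH by (auto simp: tangentially_zero_def)
              next
                case False
                then have "us ! i \<in> set (A @ B)"
                  using i by (auto simp: AB nth_append nth_Cons' split: if_splits)
                then show ?thesis using ABH mem_arrangement[OF H] by auto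
              qed
              then show ?thesis unfolding wedge_sum_def by (intro sum.neutral) auto
            qed
          qed
        qed
      qed
    qed
    have "divides_poly (\<alpha> H) (\<lambda>v. quotient_rule_form Q \<eta> v us)"
    proof (rule vanishing_on_hyperplane_divisible[OF quotient_rule_form_poly[OF \<eta> Q_poly] lin form_normal_vector[OF H]])
      fix v assume "\<alpha> H v = 0"
      then have "v \<in> H" using mem_arrangement[OF H] by simp
      then show "quotient_rule_form Q \<eta> v us = 0"
        using quotient_rule_form_on_hyperplane[OF H] wedge_zero by simp
    qed
    then show "divides_poly (\<lambda>v. \<alpha> H v ^ 1) (\<lambda>v. quotient_rule_form (arrangement_prod (\<lambda>_. 1)) \<eta> v us)"
      by (simp add: Q_eq)
  qed
  obtain \<theta> where \<theta>: "\<theta> \<in> poly_forms (Suc p)" "\<And>v us. quotient_rule_form Q \<eta> v us = Q v * \<theta> v us"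
    using poly_forms_divide[where E = "quotient_rule_form Q \<eta>",
        OF quotient_rule_form_alternating[OF \<eta> Q_poly] Q_poly Q_nonzero div] by blast
  have "ext_deriv (over Q \<eta>) v = over Q \<theta> v" if v: "Q v \<noteq> 0" for v
  proof
    fix us
    show "ext_deriv (over Q \<eta>) v us = over Q \<theta> v us"
      using ext_deriv_over[OF \<eta> Q_poly v, of us] \<theta>(2)[of v us] v by (simp add: over_def)
  qed
  then show ?log using \<theta>(1) by blast
qed

lemma log_forms_eq: "log_forms Q p = {over Q \<eta> | \<eta>. \<eta> \<in> poly_forms p \<and> tangentially_zero \<eta>}"
  unfolding log_forms_def using logarithmic_iff_tangentially_zero by blast

lemma anti_invariant_forms_iff:
  "\<eta> \<in> anti_invariant_forms W p \<longleftrightarrow>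
    \<eta> \<in> poly_forms p \<and> (\<forall>w\<in>W. \<forall>v us. \<eta> (w v) (map w us) = cdet w * \<eta> v us)"
proof -
  have "(\<forall>w\<in>W. act_form w \<eta> = scale_form (\<lambda>_. inverse (cdet w)) \<eta>) \<longleftrightarrow>
      (\<forall>w\<in>W. \<forall>v us. \<eta> (w v) (map w us) = cdet w * \<eta> v us)" (is "?l \<longleftrightarrow> ?r")
  proof (intro iffI ballI allI)
    fix w v us assume ?l and w: "w \<in> W"
    then have "act_form w \<eta> (w v) (map w us) = scale_form (\<lambda>_. inverse (cdet w)) \<eta> (w v) (map w us)"
      by simp
    moreover have "map (map_inv w) (map w us) = us" using w by (simp add: o_def)
    ultimately have "\<eta> v us = inverse (cdet w) * \<eta> (w v) (map w us)"
      unfolding act_form_def scale_form_def using w by simp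
    then show "\<eta> (w v) (map w us) = cdet w * \<eta> v us"
      using cdet_nonzero[OF w] by (simp add: field_simps)
  next
    fix w assume r: ?r and w: "w \<in> W"
    show "act_form w \<eta> = scale_form (\<lambda>_. inverse (cdet w)) \<eta>"
    proof (intro ext)
      fix v us
      have "\<eta> (map_inv w v) (map (map_inv w) us) = cdet (map_inv w) * \<eta> v us"
        using r W_inv[OF w] by blast
      then show "act_form w \<eta> v us = scale_form (\<lambda>_. inverse (cdet w)) \<eta> v us"
        by (simp add: act_form_def scale_form_def cdet_inv w)
    qed
  qed
  then show ?thesis by (simp add: anti_invariant_forms_def)
qed

text \<open>
  A reflection with hyperplane \<open>H\<close> fixes the point and all the arguments, so the value is multiplied
  by a determinant other than \<open>1\<close> and yet remains the same.
\<close>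

lemma anti_invariant_tangentially_zero:
  assumes "\<eta> \<in> anti_invariant_forms W p"
  shows "tangentially_zero \<eta>"
  unfolding tangentially_zero_def
proof (intro ballI allI impI)
  fix H v us assume H: "H \<in> arrangement" and v: "v \<in> H" and us: "set us \<subseteq> H"
  obtain s where s: "s \<in> stabilizer H" "cdet s \<noteq> 1" using stabilizer_nontrivial[OF H] by blast
  have "s v = v" "map s us = us" using s v us by (auto simp: stabilizer_def intro!: map_idI)
  moreover have "\<eta> (s v) (map s us) = cdet s * \<eta> v us"
    using assms stabilizer_W[OF s(1)] unfolding anti_invariant_forms_iff by blast
  ultimately have "(cdet s - 1) * \<eta> v us = 0" by (simp add: left_diff_distrib)
  then show "\<eta> v us = 0" using s(2) by simp
qed

text \<open>
  For arguments in \<open>H\<close> the coefficient of an invariant form is invariant under the stabilizer of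
  \<open>H\<close>, and it vanishes on \<open>H\<close> by hypothesis; dividing by \<open>\<alpha> H\<close> once yields the inverse
  determinant as character. One argument equal to the normal vector yields this character at once.
\<close>

lemma invariant_tangentially_zero_divisible:
  assumes E: "E \<in> poly_forms p" "tangentially_zero E"
    and inv: "\<And>w v us. w \<in> W \<Longrightarrow> E (w v) (map w us) = E v us"
  shows "\<exists>\<eta>\<in>poly_forms p. \<forall>v us. E v us = J v * \<eta> v us"
proof (rule poly_forms_divide[OF poly_forms_alternating[OF E(1)] J_poly J_nonzero])
  fix us
  show "divides_poly J (\<lambda>v. E v us)"
    unfolding J_def
  proof (rule arrangement_prod_divides[OF poly_forms_poly[OF E(1)]])
    fix H assume H: "H \<in> arrangement"
    note lin = arrangement_form(1)[OF H]
    let ?a = "normal_vector H" and ?m = "ramification H - 1"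
    have a_notin: "?a \<notin> H" using mem_arrangement[OF H] form_normal_vector[OF H] by simp
    have m: "?m < ramification H" using ramification_pos[OF H] by simp
    have zero: "divides_poly (\<lambda>v. \<alpha> H v ^ ?m) (\<lambda>v. 0)"
      unfolding divides_poly_def by (intro bexI[of _ "\<lambda>_. 0"]) (auto intro: poly_funs.const)
    show "divides_poly (\<lambda>v. \<alpha> H v ^ ?m) (\<lambda>v. E v us)"
    proof (cases "length us = p")
      case False
      then have "(\<lambda>v. E v us) = (\<lambda>v. 0)"
        using alternating_form_length[OF poly_forms_alternating[OF E(1)]] by blast
      then show ?thesis using zero by simp
    next
      case True
      have dec: "\<exists>c. u - c *\<^sub>C ?a \<in> H" for u by (rule decompose_along_normal[OF H])
      show ?thesis
      proof (rule arguments_adapted_to_hyperplane[OF dec _ _ True])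
        fix A B h c
        assume "divides_poly (\<lambda>v. \<alpha> H v ^ ?m) (\<lambda>v. E v (A @ h # B))"
          "divides_poly (\<lambda>v. \<alpha> H v ^ ?m) (\<lambda>v. E v (A @ ?a # B))"
        then obtain f g where fg: "f \<in> poly_funs" "\<And>v. E v (A @ h # B) = \<alpha> H v ^ ?m * f v"
          "g \<in> poly_funs" "\<And>v. E v (A @ ?a # B) = \<alpha> H v ^ ?m * g v"
          by (auto simp: divides_poly_def)
        have "E v (A @ (h + c *\<^sub>C ?a) # B) = \<alpha> H v ^ ?m * (f v + c * g v)" for v
        proof -
          note l = alternating_form_linear[OF poly_forms_alternating[OF E(1)], of v A B]
          show ?thesis
            by (simp add: clinear_form_add[OF l] clinear_form_scale[OF l] fg distrib_left)
        qed
        moreover have "(\<lambda>v. f v + c * g v) \<in> poly_funs"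
          by (rule poly_funs.add[OF fg(1) poly_funs_cmult[OF fg(3)]])
        ultimately show "divides_poly (\<lambda>v. \<alpha> H v ^ ?m) (\<lambda>v. E v (A @ (h + c *\<^sub>C ?a) # B))"
          unfolding divides_poly_def by (intro bexI[of _ "\<lambda>v. f v + c * g v"] allI)
      next
        fix us assume us: "set us \<subseteq> insert ?a H"
        show "divides_poly (\<lambda>v. \<alpha> H v ^ ?m) (\<lambda>v. E v us)"
        proof (cases "?a \<in> set us")
          case False
          then have usH: "set us \<subseteq> H" using us by blast
          then have "E v us = 0" if "\<alpha> H v = 0" for v
            using E(2) H that mem_arrangement[OF H] by (auto simp: tangentially_zero_def)
          then obtain g where g: "g \<in> poly_funs" "\<And>v. E v us = \<alpha> H v * g v"
            using vanishing_on_hyperplane_divisible[OF poly_forms_poly[OF E(1)] lin form_normal_vector[OF H]]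
            unfolding divides_poly_def by blast
          have "g (w v) = cdet w ^ ?m * g v" if w: "w \<in> stabilizer H" for w v
          proof -
            have fix_us: "map w us = us" using w usH by (auto simp: stabilizer_def intro!: map_idI)
            have "(\<lambda>v. cdet w * g (w v)) = g"
            proof (rule poly_funs_eqI[where h = "\<alpha> H"])
              show "(\<lambda>v. cdet w * g (w v)) \<in> poly_funs"
                by (rule poly_funs_cmult, rule poly_funs_compose[OF g(1) W_linear[OF stabilizer_W[OF w]]])
              show "\<alpha> H \<in> poly_funs" by (rule poly_funs.linear[OF lin])
              show "\<exists>w. \<alpha> H w \<noteq> 0" by (rule form_nonzero[OF H])
              fix v assume nz: "\<alpha> H v \<noteq> 0"
              have "\<alpha> H v * (cdet w * g (w v)) = E (w v) us"
                using g(2)[of "w v"] form_stabilizer[OF H w, of v] by simp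
              also have "\<dots> = \<alpha> H v * g v"
                using inv[OF stabilizer_W[OF w], of v us] g(2)[of v] by (simp add: fix_us)
              finally show "cdet w * g (w v) = g v" using nz by simp
            qed (rule g(1))
            then have "cdet w * g (w v) = g v" by (rule fun_cong)
            then have "g (w v) = inverse (cdet w) * g v"
              using cdet_nonzero[OF stabilizer_W[OF w]] by (simp add: field_simps)
            then show ?thesis using cdet_power_ramification_minus_1[OF H w] by simp
          qed
          then have "divides_poly (\<lambda>v. \<alpha> H v ^ ?m) g"
            by (rule semi_invariant_divisible[OF H m g(1)])
          then obtain f where "f \<in> poly_funs" "\<And>v. g v = \<alpha> H v ^ ?m * f v"
            by (auto simp: divides_poly_def)
          then show ?thesis
            unfolding divides_poly_def using g(2) poly_funs.linear[OF lin]
            by (intro bexI[of _ "\<lambda>v. \<alpha> H v * f v"]) (auto intro: poly_funs.mult)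
        next
          case True
          then obtain A B where AB: "us = A @ ?a # B" by (auto simp: in_set_conv_decomp)
          show ?thesis
          proof (cases "?a \<in> set (A @ B)")
            case True
            then have "(\<exists>C D. us = C @ ?a # D @ ?a # B) \<or> (\<exists>C D. us = A @ ?a # C @ ?a # D)"
              unfolding AB by (auto simp: in_set_conv_decomp)
            then have "(\<lambda>v. E v us) = (\<lambda>v. 0)"
              using alternating_form_repeat[OF poly_forms_alternating[OF E(1)]] by auto
            then show ?thesis using zero by simp
          next
            case False
            then have ABH: "set A \<subseteq> H" "set B \<subseteq> H" using us AB by auto
            have "E (w v) us = cdet w ^ ?m * E v us" if w: "w \<in> stabilizer H" for w v
            proof -
              have "map w us = A @ (cdet w *\<^sub>C ?a) # B"
                using w ABH stabilizer_normal_vector[OF H w]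
                by (auto simp: AB stabilizer_def intro!: map_idI)
              then have "E v us = cdet w * E (w v) us"
                using inv[OF stabilizer_W[OF w], of v us]
                  clinear_form_scale[OF alternating_form_linear[OF poly_forms_alternating[OF E(1)]],
                    of "w v" A "cdet w" ?a B]
                by (simp add: AB)
              then have "E (w v) us = inverse (cdet w) * E v us"
                using cdet_nonzero[OF stabilizer_W[OF w]] by simp
              then show ?thesis using cdet_power_ramification_minus_1[OF H w] by simp
            qed
            then show ?thesis
              by (rule semi_invariant_divisible[OF H m poly_forms_poly[OF E(1)]])
          qed
        qed
      qed
    qed
  qed
qed

text \<open>
  The dual bases expand every logarithmic form: its coefficient along \<open>b i\<close> is the trace of the
  form multiplied by \<open>a i / J\<close>. The product has higher poles, but the trace does not.
\<close>

lemma tangentially_zero_expansion: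
  assumes ab: "\<And>i. i < n \<Longrightarrow> a i \<in> poly_funs \<and> b i \<in> poly_funs"
    and orth: "\<And>u v. u \<in> W \<Longrightarrow> (\<Sum>i<n::nat. b i v * a i (u v)) = (if u = (\<lambda>v. v) then J v else 0)"
    and \<eta>: "\<eta> \<in> poly_forms p" "tangentially_zero \<eta>"
  shows "\<exists>\<theta>. (\<forall>i<n. \<theta> i \<in> anti_invariant_forms W p) \<and> (\<forall>v us. \<eta> v us = (\<Sum>i<n. b i v * \<theta> i v us))"
proof -
  define E where "E = (\<lambda>i v us. \<Sum>w\<in>W. a i (w v) * \<eta> (w v) (map w us))"
  have ex: "\<exists>\<theta>\<in>anti_invariant_forms W p. \<forall>v us. E i v us = J v * \<theta> v us" if i: "i < n" for i
  proof -
    have E_poly: "E i \<in> poly_forms p"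
      unfolding E_def
    proof (rule poly_forms_sum)
      fix w assume w: "w \<in> W"
      have "a i \<in> poly_funs" using ab i by blast
      then show "(\<lambda>v us. a i (w v) * \<eta> (w v) (map w us)) \<in> poly_forms p"
        using poly_forms_scale[OF poly_funs_compose[OF _ W_linear[OF w]]
            poly_forms_pullback[OF \<eta>(1) W_linear[OF w]]] by blast
    qed
    have E_inv: "E i (u v) (map u us) = E i v us" if "u \<in> W" for u v us
      using sum_W_translate(1)[OF that, of "\<lambda>w. a i (w v) * \<eta> (w v) (map w us)"]
      by (simp add: E_def o_def)
    have E_tz: "tangentially_zero (E i)"
      unfolding tangentially_zero_def
    proof (intro ballI allI impI)
      fix H v us assume H: "H \<in> arrangement" and v: "v \<in> H" and us: "set us \<subseteq> H"
      have "\<eta> (w v) (map w us) = 0" if w: "w \<in> W" for w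
      proof -
        have "map_inv w -` H \<in> arrangement" by (rule vimage_arrangement(1)[OF W_inv[OF w] H])
        moreover have "w v \<in> map_inv w -` H" "set (map w us) \<subseteq> map_inv w -` H" using w v us by auto
        ultimately show ?thesis using \<eta>(2) unfolding tangentially_zero_def by blast
      qed
      then show "E i v us = 0" by (simp add: E_def)
    qed
    obtain \<theta> where \<theta>: "\<theta> \<in> poly_forms p" "\<And>v us. E i v us = J v * \<theta> v us"
      using invariant_tangentially_zero_divisible[OF E_poly E_tz E_inv] by blast
    have "\<theta> (w v) (map w us) = cdet w * \<theta> v us" if w: "w \<in> W" for w v us
    proof -
      have "(\<lambda>v. \<theta> (w v) (map w us)) = (\<lambda>v. cdet w * \<theta> v us)"
      proof (rule cancel_J)
        show "(\<lambda>v. \<theta> (w v) (map w us)) \<in> poly_funs"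
          by (rule poly_funs_compose[OF poly_forms_poly[OF \<theta>(1)] W_linear[OF w]])
        show "(\<lambda>v. cdet w * \<theta> v us) \<in> poly_funs" by (rule poly_funs_cmult[OF poly_forms_poly[OF \<theta>(1)]])
        fix v
        have "J v * \<theta> (w v) (map w us) = cdet w * E i (w v) (map w us)"
          using J_semi_invariant[OF w, of v] \<theta>(2)[of "w v" "map w us"] by (metis mult.assoc)
        also have "\<dots> = cdet w * E i v us" by (simp only: E_inv[OF w])
        also have "\<dots> = J v * (cdet w * \<theta> v us)" by (simp only: \<theta>(2) mult.left_commute)
        finally show "J v * \<theta> (w v) (map w us) = J v * (cdet w * \<theta> v us)" .
      qed
      then show ?thesis by (rule fun_cong)
    qed
    then show ?thesis using \<theta> by (intro bexI[of _ \<theta>]) (auto simp: anti_invariant_forms_iff)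
  qed
  define \<theta> where "\<theta> = (\<lambda>i. SOME \<theta>. \<theta> \<in> anti_invariant_forms W p \<and> (\<forall>v us. E i v us = J v * \<theta> v us))"
  have \<theta>: "\<theta> i \<in> anti_invariant_forms W p \<and> (\<forall>v us. E i v us = J v * \<theta> i v us)" if "i < n" for i
  proof -
    have "\<exists>\<theta>. \<theta> \<in> anti_invariant_forms W p \<and> (\<forall>v us. E i v us = J v * \<theta> v us)"
      using ex[OF that] by blast
    then show ?thesis unfolding \<theta>_def by (rule someI_ex)
  qed
  have "\<eta> v us = (\<Sum>i<n. b i v * \<theta> i v us)" for v us
  proof -
    have "(\<lambda>v. \<eta> v us) = (\<lambda>v. \<Sum>i<n. b i v * \<theta> i v us)"
    proof (rule cancel_J)
      show "(\<lambda>v. \<eta> v us) \<in> poly_funs" by (rule poly_forms_poly[OF \<eta>(1)])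
      show "(\<lambda>v. \<Sum>i<n. b i v * \<theta> i v us) \<in> poly_funs"
      proof (rule poly_funs_sum)
        fix i assume i: "i \<in> {..<n}"
        then have "\<theta> i \<in> poly_forms p" using \<theta> by (simp add: anti_invariant_forms_iff)
        then show "(\<lambda>v. b i v * \<theta> i v us) \<in> poly_funs"
          using ab[of i] i poly_funs.mult[OF _ poly_forms_poly, of "b i" "\<theta> i" p us] by simp
      qed
      fix v
      have "J v * (\<Sum>i<n. b i v * \<theta> i v us) = (\<Sum>i<n. b i v * E i v us)"
        unfolding sum_distrib_left by (rule sum.cong) (auto simp: \<theta>)
      also have "\<dots> = (\<Sum>i<n. \<Sum>w\<in>W. (b i v * a i (w v)) * \<eta> (w v) (map w us))"
        by (simp add: E_def sum_distrib_left mult.assoc)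
      also have "\<dots> = (\<Sum>w\<in>W. (\<Sum>i<n. b i v * a i (w v)) * \<eta> (w v) (map w us))"
        by (subst sum.swap) (simp add: sum_distrib_right)
      also have "\<dots> = (\<Sum>w\<in>W. if w = (\<lambda>v. v) then J v * \<eta> v us else 0)"
        by (rule sum.cong) (auto simp: orth)
      also have "\<dots> = J v * \<eta> v us" using finite_W W_id by simp
      finally show "J v * \<eta> v us = J v * (\<Sum>i<n. b i v * \<theta> i v us)" by (rule sym)
    qed
    then show ?thesis by (rule fun_cong)
  qed
  then show ?thesis using \<theta> by blast
qed

end

section \<open>The tensor product\<close>

definition int_combination :: "('x \<Rightarrow> complex) \<Rightarrow> ('x \<Rightarrow>\<^sub>0 int) \<Rightarrow> complex" where
  "int_combination g c = (\<Sum>x\<in>Poly_Mapping.keys c. of_int (Poly_Mapping.lookup c x) * g x)"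

lemma int_combination_superset:
  assumes "finite S" "Poly_Mapping.keys c \<subseteq> S"
  shows "int_combination g c = (\<Sum>x\<in>S. of_int (Poly_Mapping.lookup c x) * g x)"
  unfolding int_combination_def
  by (rule sum.mono_neutral_left) (use assms in \<open>auto simp: in_keys_iff\<close>)

lemma int_combination_0: "int_combination g 0 = 0"
  by (simp add: int_combination_def)

lemma int_combination_frag_of: "int_combination g (frag_of x) = g x"
  by (simp add: int_combination_def)

lemma int_combination_add: "int_combination g (c + d) = int_combination g c + int_combination g d"
proof -
  let ?S = "Poly_Mapping.keys c \<union> Poly_Mapping.keys d"
  have "Poly_Mapping.keys (c + d) \<subseteq> ?S" by (rule Poly_Mapping.keys_add)
  then show ?thesis
    using int_combination_superset[of ?S c g] int_combination_superset[of ?S d g]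
      int_combination_superset[of ?S "c + d" g]
    by (simp add: lookup_add distrib_right sum.distrib)
qed

lemma int_combination_diff: "int_combination g (c - d) = int_combination g c - int_combination g d"
  using int_combination_add[of g "c - d" d] by simp

lemma int_combination_sum: "int_combination g (\<Sum>i\<in>I. c i) = (\<Sum>i\<in>I. int_combination g (c i))"
  by (induction I rule: infinite_finite_induct) (simp_all add: int_combination_0 int_combination_add)

lemma int_combination_cong:
  "(\<And>x. x \<in> Poly_Mapping.keys c \<Longrightarrow> g x = h x) \<Longrightarrow> int_combination g c = int_combination h c"
  unfolding int_combination_def by (rule sum.cong) auto

lemma int_combination_cmult: "int_combination (\<lambda>x. k * g x) c = k * int_combination g c"
  by (simp add: int_combination_def sum_distrib_left mult.left_commute)

lemma int_combination_sum_fun: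
  "int_combination (\<lambda>x. \<Sum>i\<in>I. g i x) c = (\<Sum>i\<in>I. int_combination (g i) c)"
  unfolding int_combination_def sum_distrib_left by (rule sum.swap)

lemma mult_combination_eq:
  "mult_combination c v us = int_combination (\<lambda>x. snd x v * fst x v us) c"
  unfolding mult_combination_def int_combination_def scale_form_def
  by (rule sum.cong) (auto simp: case_prod_beta)

lemma poly_funs_plus: "f \<in> poly_funs \<Longrightarrow> g \<in> poly_funs \<Longrightarrow> f + g \<in> poly_funs"
  using poly_funs.add[of f g] by (simp add: plus_fun_def)

lemma poly_funs_times: "f \<in> poly_funs \<Longrightarrow> g \<in> poly_funs \<Longrightarrow> f * g \<in> poly_funs"
  using poly_funs.mult[of f g] by (simp add: times_fun_def)

lemma poly_funs_zero: "0 \<in> poly_funs"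
  using poly_funs.const[of 0] by (simp add: zero_fun_def)

locale reflection_group_tensor = reflection_group W \<alpha> for W :: "('v::unitary_space \<Rightarrow> 'v) set" and \<alpha> +
  fixes p :: nat
begin

abbreviation invariant_forms :: "'v dform set" where
  "invariant_forms \<equiv> over Q ` anti_invariant_forms W p"

abbreviation pairs_group :: "('v dform \<times> ('v \<Rightarrow> complex) \<Rightarrow>\<^sub>0 int) monoid" where
  "pairs_group \<equiv> free_Abelian_group (invariant_forms \<times> poly_funs)"

definition relations_subgroup :: "('v dform \<times> ('v \<Rightarrow> complex) \<Rightarrow>\<^sub>0 int) set" where
  "relations_subgroup = generate pairs_group
    (tensor_relations (invariant_polys W) scale_form (*) invariant_forms poly_funs)"

lemma anti_invariant_tensor_eq: "anti_invariant_tensor W Q p = pairs_group Mod relations_subgroup"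
  by (simp add: anti_invariant_tensor_def tensor_product_def relations_subgroup_def)

lemma invariant_forms_diff:
  assumes "\<omega> \<in> invariant_forms" "\<omega>' \<in> invariant_forms"
  shows "\<omega> - \<omega>' \<in> invariant_forms"
proof -
  obtain \<eta> \<eta>' where e: "\<eta> \<in> anti_invariant_forms W p" "\<omega> = over Q \<eta>"
    "\<eta>' \<in> anti_invariant_forms W p" "\<omega>' = over Q \<eta>'" using assms by blast
  let ?d = "\<lambda>v us. \<eta> v us + (-1) * \<eta>' v us"
  have "?d \<in> anti_invariant_forms W p"
    using e poly_forms_add[OF _ poly_forms_scale[OF poly_funs.const[of "-1"]], of \<eta> p \<eta>']
    by (simp add: anti_invariant_forms_iff right_diff_distrib)
  moreover have "\<omega> - \<omega>' = over Q ?d"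
    by (simp add: e over_def fun_eq_iff diff_divide_distrib)
  ultimately show ?thesis by blast
qed

lemma invariant_forms_zero: "0 \<in> invariant_forms"
proof -
  have "(\<lambda>v us. 0) \<in> anti_invariant_forms W p"
    by (simp add: anti_invariant_forms_iff poly_forms_zero)
  moreover have "0 = over Q (\<lambda>v us. 0)" by (simp add: over_def fun_eq_iff)
  ultimately show ?thesis by (intro image_eqI[of _ "over Q" "\<lambda>v us. 0"])
qed

lemma invariant_forms_add:
  assumes "\<omega> \<in> invariant_forms" "\<omega>' \<in> invariant_forms"
  shows "\<omega> + \<omega>' \<in> invariant_forms"
  using invariant_forms_diff[OF assms(1) invariant_forms_diff[OF invariant_forms_zero assms(2)]] by simp

lemma invariant_forms_scale:
  assumes "\<omega> \<in> invariant_forms" "r \<in> invariant_polys W"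
  shows "scale_form r \<omega> \<in> invariant_forms"
proof -
  obtain \<eta> where e: "\<eta> \<in> anti_invariant_forms W p" "\<omega> = over Q \<eta>" using assms by blast
  have "r (w v) * \<eta> (w v) (map w us) = cdet w * (r v * \<eta> v us)" if "w \<in> W" for w v us
  proof -
    have "\<eta> (w v) (map w us) = cdet w * \<eta> v us" using e(1) that by (simp add: anti_invariant_forms_iff)
    then show ?thesis using invariant_polysD[OF assms(2) that, of v] by simp
  qed
  moreover have "(\<lambda>v us. r v * \<eta> v us) \<in> poly_forms p"
    using e(1) poly_forms_scale[OF invariant_polys_poly[OF assms(2)]]
    by (simp add: anti_invariant_forms_iff)
  ultimately have "(\<lambda>v us. r v * \<eta> v us) \<in> anti_invariant_forms W p"
    by (simp add: anti_invariant_forms_iff)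
  moreover have "scale_form r \<omega> = over Q (\<lambda>v us. r v * \<eta> v us)"
    by (simp add: e over_def scale_form_def)
  ultimately show ?thesis by (intro image_eqI[of _ "over Q" "\<lambda>v us. r v * \<eta> v us"])
qed

lemma invariant_forms_invariant:
  assumes "\<omega> \<in> invariant_forms" "w \<in> W"
  shows "\<omega> (w v) (map w us) = \<omega> v us"
proof -
  obtain \<eta> where e: "\<eta> \<in> anti_invariant_forms W p" "\<omega> = over Q \<eta>" using assms by blast
  have "\<eta> (w v) (map w us) = cdet w * \<eta> v us" using e(1) assms(2) by (simp add: anti_invariant_forms_iff)
  then show ?thesis
    using Q_semi_invariant[OF assms(2), of v] cdet_nonzero[OF assms(2)] by (simp add: e(2) over_def)
qed

lemma invariant_forms_pole: "\<omega> \<in> invariant_forms \<Longrightarrow> Q v = 0 \<Longrightarrow> \<omega> v us = 0"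
  by (auto simp: over_def)

lemma tensor_relations_carrier:
  "tensor_relations (invariant_polys W) scale_form (*) invariant_forms poly_funs \<subseteq> carrier pairs_group"
proof
  interpret group pairs_group by (rule group_free_Abelian_group)
  have diff: "a - b \<in> carrier pairs_group" if "a \<in> carrier pairs_group" "b \<in> carrier pairs_group" for a b
    using that keys_diff[of a b] by auto
  fix c assume "c \<in> tensor_relations (invariant_polys W) scale_form (*) invariant_forms poly_funs"
  then consider
    x x' y where "c = frag_of (x + x', y) - frag_of (x, y) - frag_of (x', y)"
      "x \<in> invariant_forms" "x' \<in> invariant_forms" "y \<in> poly_funs"
  | x y y' where "c = frag_of (x, y + y') - frag_of (x, y) - frag_of (x, y')"
      "x \<in> invariant_forms" "y \<in> poly_funs" "y' \<in> poly_funs"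
  | r x y where "c = frag_of (scale_form r x, y) - frag_of (x, r * y)"
      "r \<in> invariant_polys W" "x \<in> invariant_forms" "y \<in> poly_funs"
    unfolding tensor_relations_def by blast
  then show "c \<in> carrier pairs_group"
  proof cases
    case 1
    show ?thesis unfolding 1(1) by (intro diff) (use 1 invariant_forms_add in simp_all)
  next
    case 2
    show ?thesis unfolding 2(1) by (intro diff) (use 2 poly_funs_plus in simp_all)
  next
    case 3
    show ?thesis unfolding 3(1)
      by (intro diff) (use 3 invariant_forms_scale poly_funs_times[OF invariant_polys_poly] in simp_all)
  qed
qed

lemma relations_subgroup: "subgroup relations_subgroup pairs_group"
  unfolding relations_subgroup_def
  by (rule group.generate_is_subgroup[OF group_free_Abelian_group tensor_relations_carrier])

lemma relations_zero: "0 \<in> relations_subgroup"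
  using subgroup.one_closed[OF relations_subgroup] by simp

lemma relations_keys: "c \<in> relations_subgroup \<Longrightarrow> c \<in> carrier pairs_group"
  using subgroup.subset[OF relations_subgroup] by blast

lemma relations_add: "c \<in> relations_subgroup \<Longrightarrow> d \<in> relations_subgroup \<Longrightarrow> c + d \<in> relations_subgroup"
  using subgroup.m_closed[OF relations_subgroup, of c d] by simp

lemma relations_minus: "c \<in> relations_subgroup \<Longrightarrow> - c \<in> relations_subgroup"
  using subgroup.m_inv_closed[OF relations_subgroup, of c] relations_keys[of c]
  by (simp only: carrier_free_Abelian_group_iff inv_free_Abelian_group)

lemma relations_diff: "c \<in> relations_subgroup \<Longrightarrow> d \<in> relations_subgroup \<Longrightarrow> c - d \<in> relations_subgroup"
  using relations_add[of c "- d"] relations_minus[of d] by simp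

lemma relations_sum:
  "(\<And>i. i \<in> I \<Longrightarrow> c i \<in> relations_subgroup) \<Longrightarrow> (\<Sum>i\<in>I. c i) \<in> relations_subgroup"
  by (induction I rule: infinite_finite_induct) (simp_all add: relations_zero relations_add)

lemma relations_incl:
  "c \<in> tensor_relations (invariant_polys W) scale_form (*) invariant_forms poly_funs \<Longrightarrow>
    c \<in> relations_subgroup"
  unfolding relations_subgroup_def by (rule generate.incl)

lemma relation_left:
  "x \<in> invariant_forms \<Longrightarrow> x' \<in> invariant_forms \<Longrightarrow> y \<in> poly_funs \<Longrightarrow>
    frag_of (x + x', y) - frag_of (x, y) - frag_of (x', y) \<in> relations_subgroup"
  by (rule relations_incl) (unfold tensor_relations_def, blast)

lemma relation_right:
  "x \<in> invariant_forms \<Longrightarrow> y \<in> poly_funs \<Longrightarrow> y' \<in> poly_funs \<Longrightarrow>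
    frag_of (x, y + y') - frag_of (x, y) - frag_of (x, y') \<in> relations_subgroup"
  by (rule relations_incl) (unfold tensor_relations_def, blast)

lemma relation_scale:
  "r \<in> invariant_polys W \<Longrightarrow> x \<in> invariant_forms \<Longrightarrow> y \<in> poly_funs \<Longrightarrow>
    frag_of (scale_form r x, y) - frag_of (x, r * y) \<in> relations_subgroup"
  by (rule relations_incl) (unfold tensor_relations_def, blast)

lemma tensor_zero_left: "y \<in> poly_funs \<Longrightarrow> frag_of (0, y) \<in> relations_subgroup"
  using relations_minus[OF relation_left[OF invariant_forms_zero invariant_forms_zero, of y]] by simp

lemma tensor_zero_right: "x \<in> invariant_forms \<Longrightarrow> frag_of (x, 0) \<in> relations_subgroup"
  using relations_minus[OF relation_right[OF _ poly_funs_zero poly_funs_zero, of x]] by simp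

lemma tensor_diff_left:
  assumes "x \<in> invariant_forms" "x' \<in> invariant_forms" "y \<in> poly_funs"
  shows "frag_of (x, y) - frag_of (x', y) - frag_of (x - x', y) \<in> relations_subgroup"
  using relation_left[OF invariant_forms_diff[OF assms(1,2)] assms(2,3)]
  by (simp add: diff_diff_eq add.commute)

lemma tensor_sum_right:
  assumes "x \<in> invariant_forms" "\<And>i. i \<in> I \<Longrightarrow> y i \<in> poly_funs" "finite I"
  shows "frag_of (x, \<Sum>i\<in>I. y i) - (\<Sum>i\<in>I. frag_of (x, y i)) \<in> relations_subgroup"
  using assms(3,2)
proof (induction I rule: finite_induct)
  case empty
  then show ?case using tensor_zero_right[OF assms(1)] by (simp add: zero_fun_def)
next
  case (insert i I)
  have poly: "(\<Sum>i\<in>I. y i) \<in> poly_funs" if "\<And>i. i \<in> I \<Longrightarrow> y i \<in> poly_funs" for I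
    using that by (induction I rule: infinite_finite_induct) (simp_all add: poly_funs_zero poly_funs_plus)
  have "frag_of (x, y i + (\<Sum>i\<in>I. y i)) - frag_of (x, y i) - frag_of (x, \<Sum>i\<in>I. y i) \<in> relations_subgroup"
    using insert.prems by (intro relation_right assms(1) poly) auto
  moreover have "frag_of (x, \<Sum>i\<in>I. y i) - (\<Sum>i\<in>I. frag_of (x, y i)) \<in> relations_subgroup"
    using insert by auto
  ultimately have "(frag_of (x, y i + (\<Sum>i\<in>I. y i)) - frag_of (x, y i) - frag_of (x, \<Sum>i\<in>I. y i)) +
      (frag_of (x, \<Sum>i\<in>I. y i) - (\<Sum>i\<in>I. frag_of (x, y i))) \<in> relations_subgroup"
    by (rule relations_add)
  then show ?case using insert.hyps by (simp add: algebra_simps plus_fun_def)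
qed

lemma mult_combination_relations:
  assumes "c \<in> relations_subgroup"
  shows "mult_combination c v us = 0"
  using assms unfolding relations_subgroup_def
proof (induction rule: generate.induct)
  case one
  show ?case by (simp add: mult_combination_eq int_combination_0)
next
  case (incl h)
  then show ?case unfolding tensor_relations_def
    by (auto simp: mult_combination_eq int_combination_diff int_combination_frag_of scale_form_def
        distrib_left distrib_right)
next
  case (inv h)
  have h: "mult_combination h v us = 0"
    using inv unfolding tensor_relations_def
    by (auto simp: mult_combination_eq int_combination_diff int_combination_frag_of scale_form_def
        distrib_left distrib_right)
  have "Poly_Mapping.keys h \<subseteq> invariant_forms \<times> poly_funs"
    using subsetD[OF tensor_relations_carrier inv] by (simp only: carrier_free_Abelian_group_iff)
  then have "inv\<^bsub>pairs_group\<^esub> h = 0 - h" by (simp only: inv_free_Abelian_group diff_0)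
  then show ?case using h by (simp add: mult_combination_eq int_combination_diff int_combination_0 del: diff_0)
next
  case (eng h1 h2)
  then show ?case by (simp add: mult_combination_eq int_combination_add)
qed

lemma mult_map_coset:
  "mult_map (relations_subgroup #>\<^bsub>pairs_group\<^esub> c) = mult_combination c"
proof -
  have "mult_combination (k + c) = mult_combination c" if "k \<in> relations_subgroup" for k
  proof (intro ext)
    fix v us
    show "mult_combination (k + c) v us = mult_combination c v us"
      using mult_combination_relations[OF that, of v us] by (simp add: mult_combination_eq int_combination_add)
  qed
  then have "mult_combination ` (relations_subgroup #>\<^bsub>pairs_group\<^esub> c) = {mult_combination c}"
    using relations_zero by (auto simp: r_coset_def)
  then show ?thesis by (simp add: mult_map_def)
qed

lemma mult_combination_log_form:
  assumes "Poly_Mapping.keys c \<subseteq> invariant_forms \<times> poly_funs"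
  shows "mult_combination c \<in> log_forms Q p"
  using assms
proof (induction rule: free_Abelian_group_induct[consumes 1, case_names zero diff frag])
  case zero
  have "mult_combination 0 = over Q (\<lambda>v us. 0)"
    by (simp add: fun_eq_iff mult_combination_eq int_combination_0 over_def)
  moreover have "tangentially_zero (\<lambda>v us. 0)" by (simp add: tangentially_zero_def)
  ultimately show ?case unfolding log_forms_eq using poly_forms_zero by blast
next
  case (diff c d)
  then obtain \<eta> \<theta> where e: "\<eta> \<in> poly_forms p" "tangentially_zero \<eta>" "mult_combination c = over Q \<eta>"
    "\<theta> \<in> poly_forms p" "tangentially_zero \<theta>" "mult_combination d = over Q \<theta>"
    unfolding log_forms_eq by blast
  let ?d = "\<lambda>v us. \<eta> v us + (-1) * \<theta> v us"
  have "?d \<in> poly_forms p" by (intro poly_forms_add poly_forms_scale e poly_funs.const)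
  moreover have "tangentially_zero ?d" using e(2,5) by (simp add: tangentially_zero_def)
  moreover have "mult_combination (c - d) = over Q ?d"
  proof (intro ext)
    fix v us
    have "mult_combination (c - d) v us = mult_combination c v us - mult_combination d v us"
      by (simp add: mult_combination_eq int_combination_diff)
    then show "mult_combination (c - d) v us = over Q ?d v us"
      by (simp add: e over_def diff_divide_distrib)
  qed
  ultimately show ?case unfolding log_forms_eq by blast
next
  case (frag x)
  then obtain \<eta> f where x: "x = (over Q \<eta>, f)" "\<eta> \<in> anti_invariant_forms W p" "f \<in> poly_funs" by blast
  have \<eta>: "\<eta> \<in> poly_forms p" using x(2) by (simp add: anti_invariant_forms_iff)
  have "tangentially_zero (\<lambda>v us. f v * \<eta> v us)"
    using anti_invariant_tangentially_zero[OF x(2)] by (simp add: tangentially_zero_def)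
  moreover have "mult_combination (frag_of x) = over Q (\<lambda>v us. f v * \<eta> v us)"
    by (simp add: fun_eq_iff mult_combination_eq int_combination_frag_of x(1) over_def)
  ultimately show ?case unfolding log_forms_eq using poly_forms_scale[OF x(3) \<eta>] by blast
qed

text \<open>
  Modulo the bilinear relations, every element is \<open>\<Sum>i. \<nu>\<^sub>i \<otimes> b\<^sub>i\<close>, where the pure tensor of \<open>\<omega>\<close> and
  \<open>f = \<Sum>i. jtrace (a\<^sub>i f) b\<^sub>i\<close> contributes \<open>jtrace (a\<^sub>i f) \<omega>\<close> to \<open>\<nu>\<^sub>i\<close>. Since \<open>\<omega>\<close> is
  invariant, it may be moved into the trace, so \<open>\<nu>\<^sub>i\<close> depends on the image of the element only.
\<close>

lemma mult_combination_kernel: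
  assumes ab: "\<And>i. i < n \<Longrightarrow> a i \<in> poly_funs \<and> b i \<in> poly_funs"
    and rep: "\<And>f v. f \<in> poly_funs \<Longrightarrow> f v = (\<Sum>i<n::nat. b i v * jtrace (\<lambda>x. a i x * f x) v)"
    and c: "Poly_Mapping.keys c \<subseteq> invariant_forms \<times> poly_funs"
    and vanish: "\<And>v us. mult_combination c v us = 0"
  shows "c \<in> relations_subgroup"
proof -
  define \<nu> :: "nat \<Rightarrow> ('v dform \<times> ('v \<Rightarrow> complex) \<Rightarrow>\<^sub>0 int) \<Rightarrow> 'v dform" where "\<nu> = (\<lambda>i c v us.
    int_combination (\<lambda>x. jtrace (\<lambda>y. a i y * snd x y) v * fst x v us) c)"
  have af: "(\<lambda>y. a i y * f y) \<in> poly_funs" if "i < n" "f \<in> poly_funs" for i f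
    using ab[OF that(1)] that(2) by (auto intro: poly_funs.mult)
  have "(\<forall>i<n. \<nu> i c \<in> invariant_forms) \<and>
      c - (\<Sum>i<n. frag_of (\<nu> i c, b i)) \<in> relations_subgroup"
    using c
  proof (induction rule: free_Abelian_group_induct[consumes 1, case_names zero diff frag])
    case zero
    have "\<nu> i 0 = 0" for i by (simp add: \<nu>_def int_combination_0 fun_eq_iff)
    moreover have "(\<Sum>i<n. frag_of (0, b i)) \<in> relations_subgroup"
      using ab by (intro relations_sum tensor_zero_left) auto
    ultimately show ?case using invariant_forms_zero relations_minus by (simp add: zero_fun_def)
  next
    case (diff x y)
    have \<nu>: "\<nu> i (x - y) = \<nu> i x - \<nu> i y" for i
      by (simp add: \<nu>_def int_combination_diff fun_eq_iff)
    have "(\<Sum>i<n. frag_of (\<nu> i x, b i) - frag_of (\<nu> i y, b i) - frag_of (\<nu> i x - \<nu> i y, b i))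
        \<in> relations_subgroup"
      using diff ab by (intro relations_sum tensor_diff_left) auto
    moreover have "(x - (\<Sum>i<n. frag_of (\<nu> i x, b i))) - (y - (\<Sum>i<n. frag_of (\<nu> i y, b i)))
        \<in> relations_subgroup"
      by (rule relations_diff) (use diff in auto)
    ultimately have total: "((x - (\<Sum>i<n. frag_of (\<nu> i x, b i))) - (y - (\<Sum>i<n. frag_of (\<nu> i y, b i)))) +
        (\<Sum>i<n. frag_of (\<nu> i x, b i) - frag_of (\<nu> i y, b i) - frag_of (\<nu> i x - \<nu> i y, b i))
        \<in> relations_subgroup" by (intro relations_add)
    have "x - y - (\<Sum>i<n. frag_of (\<nu> i (x - y), b i)) \<in> relations_subgroup"
    proof -
      have "(x - P) - (y - P') + (P - P' - R) = x - y - R"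
        for P P' R :: "'v dform \<times> ('v \<Rightarrow> complex) \<Rightarrow>\<^sub>0 int" by simp
      from total[unfolded sum_subtractf this] show ?thesis by (simp only: \<nu>)
    qed
    moreover have "\<forall>i<n. \<nu> i (x - y) \<in> invariant_forms"
      unfolding \<nu> using diff invariant_forms_diff by blast
    ultimately show ?case by (intro conjI)
  next
    case (frag x)
    then obtain \<omega> f where x: "x = (\<omega>, f)" "\<omega> \<in> invariant_forms" "f \<in> poly_funs" by blast
    define r where "r = (\<lambda>i. jtrace (\<lambda>y. a i y * f y))"
    have r: "r i \<in> invariant_polys W" if "i < n" for i
      unfolding r_def using jtrace_invariant[OF af[OF that x(3)]] .
    have \<nu>: "\<nu> i (frag_of x) = scale_form (r i) \<omega>" for i
      by (simp add: \<nu>_def int_combination_frag_of x(1) scale_form_def r_def)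
    have rb: "r i * b i \<in> poly_funs" if "i < n" for i
      using ab[OF that] invariant_polys_poly[OF r[OF that]] by (auto intro: poly_funs_times)
    have "f v = (\<Sum>i<n. r i * b i) v" for v
    proof -
      have "(\<Sum>i<n. r i * b i) v = (\<Sum>i<n. (r i * b i) v)"
        by (induction n) simp_all
      then show ?thesis using rep[OF x(3), of v] by (simp add: r_def mult.commute)
    qed
    then have f: "f = (\<Sum>i<n. r i * b i)" by (rule ext)
    have "frag_of (\<omega>, \<Sum>i<n. r i * b i) - (\<Sum>i<n. frag_of (\<omega>, r i * b i)) \<in> relations_subgroup"
      by (rule tensor_sum_right[OF x(2)]) (use rb in auto)
    moreover have "(\<Sum>i<n. frag_of (scale_form (r i) \<omega>, b i) - frag_of (\<omega>, r i * b i)) \<in> relations_subgroup"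
      using ab r x(2) by (intro relations_sum relation_scale) auto
    ultimately have total: "(frag_of (\<omega>, \<Sum>i<n. r i * b i) - (\<Sum>i<n. frag_of (\<omega>, r i * b i))) -
        (\<Sum>i<n. frag_of (scale_form (r i) \<omega>, b i) - frag_of (\<omega>, r i * b i)) \<in> relations_subgroup"
      by (rule relations_diff)
    have "frag_of x - (\<Sum>i<n. frag_of (\<nu> i (frag_of x), b i)) \<in> relations_subgroup"
    proof -
      have "(P - S) - (P' - S) = P - P'"
        for P P' S :: "'v dform \<times> ('v \<Rightarrow> complex) \<Rightarrow>\<^sub>0 int" by simp
      from total[unfolded sum_subtractf this, folded f] show ?thesis
        unfolding \<nu> by (simp only: x(1))
    qed
    moreover have "\<forall>i<n. \<nu> i (frag_of x) \<in> invariant_forms"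
      unfolding \<nu> using invariant_forms_scale[OF x(2) r] by blast
    ultimately show ?case by (intro conjI)
  qed
  then have c_eq: "c - (\<Sum>i<n. frag_of (\<nu> i c, b i)) \<in> relations_subgroup" by blast
  have "\<nu> i c v us = 0" if i: "i < n" for i v us
  proof (cases "Q v = 0")
    case True
    \<comment> \<open>Here every form with denominator \<open>Q\<close> has the default value \<open>0\<close>.\<close>
    have "\<nu> i c v us = int_combination (\<lambda>x. 0) c"
      unfolding \<nu>_def
    proof (rule int_combination_cong)
      fix x assume "x \<in> Poly_Mapping.keys c"
      then have "fst x \<in> invariant_forms" using c by auto
      then show "jtrace (\<lambda>y. a i y * snd x y) v * fst x v us = 0"
        using invariant_forms_pole[OF _ True] by simp
    qed
    then show ?thesis by (simp add: int_combination_def)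
  next
    case False
    have "J v * \<nu> i c v us = int_combination (\<lambda>x. J v * (jtrace (\<lambda>y. a i y * snd x y) v * fst x v us)) c"
      by (simp add: \<nu>_def int_combination_cmult)
    also have "\<dots> = int_combination (\<lambda>x. \<Sum>w\<in>W. (cdet w * a i (w v)) *
        (snd x (w v) * fst x (w v) (map w us))) c"
    proof (rule int_combination_cong)
      fix x assume x: "x \<in> Poly_Mapping.keys c"
      then have form: "fst x \<in> invariant_forms" and poly: "snd x \<in> poly_funs" using c by auto
      have "J v * (jtrace (\<lambda>y. a i y * snd x y) v * fst x v us) =
          (\<Sum>w\<in>W. cdet w * (a i (w v) * snd x (w v))) * fst x v us"
        unfolding J_jtrace[OF af[OF i poly], symmetric] by simp
      also have "\<dots> = (\<Sum>w\<in>W. (cdet w * a i (w v)) * (snd x (w v) * fst x (w v) (map w us)))"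
        unfolding sum_distrib_right
        by (rule sum.cong) (simp_all add: invariant_forms_invariant[OF form] mult.assoc)
      finally show "J v * (jtrace (\<lambda>y. a i y * snd x y) v * fst x v us) =
          (\<Sum>w\<in>W. (cdet w * a i (w v)) * (snd x (w v) * fst x (w v) (map w us)))" .
    qed
    also have "\<dots> = (\<Sum>w\<in>W. (cdet w * a i (w v)) * mult_combination c (w v) (map w us))"
      by (simp add: int_combination_sum_fun int_combination_cmult mult_combination_eq)
    also have "\<dots> = 0" by (simp add: vanish)
    finally show ?thesis using J_nonzero_if_Q_nonzero[OF False] by simp
  qed
  then have "\<nu> i c = 0" if "i < n" for i using that by (simp add: fun_eq_iff)
  then have "(\<Sum>i<n. frag_of (\<nu> i c, b i)) = (\<Sum>i<n. frag_of (0, b i))" by simp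
  moreover have "(\<Sum>i<n. frag_of (0, b i)) \<in> relations_subgroup"
    using ab by (intro relations_sum tensor_zero_left) auto
  ultimately have "(c - (\<Sum>i<n. frag_of (\<nu> i c, b i))) + (\<Sum>i<n. frag_of (\<nu> i c, b i)) \<in> relations_subgroup"
    using c_eq by (intro relations_add) simp_all
  then show ?thesis by simp
qed

lemma mult_map_inj: "inj_on mult_map (carrier (anti_invariant_tensor W Q p))"
proof (rule inj_onI)
  fix X Y assume "X \<in> carrier (anti_invariant_tensor W Q p)" "Y \<in> carrier (anti_invariant_tensor W Q p)"
    and eq: "mult_map X = mult_map Y"
  then obtain c d where c: "c \<in> carrier pairs_group" "X = relations_subgroup #>\<^bsub>pairs_group\<^esub> c"
    and d: "d \<in> carrier pairs_group" "Y = relations_subgroup #>\<^bsub>pairs_group\<^esub> d"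
    unfolding anti_invariant_tensor_eq carrier_FactGroup by blast
  obtain n a b where ab: "\<forall>i<n::nat. a i \<in> poly_funs \<and> b i \<in> poly_funs"
    "\<forall>f\<in>poly_funs. \<forall>v. f v = (\<Sum>i<n. b i v * jtrace (\<lambda>x. a i x * f x) v)"
    using dual_bases_exist by blast
  have "c - d \<in> relations_subgroup"
  proof (rule mult_combination_kernel)
    show "i < n \<Longrightarrow> a i \<in> poly_funs \<and> b i \<in> poly_funs" for i using ab(1) by blast
    show "f \<in> poly_funs \<Longrightarrow> f v = (\<Sum>i<n. b i v * jtrace (\<lambda>x. a i x * f x) v)" for f v
      using ab(2) by blast
    show "Poly_Mapping.keys (c - d) \<subseteq> invariant_forms \<times> poly_funs"
      using c(1) d(1) keys_diff[of c d] by auto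
    fix v us
    have "mult_combination c = mult_combination d" using eq by (simp add: c(2) d(2) mult_map_coset)
    moreover have "mult_combination (c - d) v us = mult_combination c v us - mult_combination d v us"
      by (simp add: mult_combination_eq int_combination_diff)
    ultimately show "mult_combination (c - d) v us = 0" by simp
  qed
  then have "c \<in> relations_subgroup #>\<^bsub>pairs_group\<^esub> d"
    unfolding r_coset_def by (auto intro: bexI[of _ "c - d"])
  then show "X = Y"
    unfolding c(2) d(2)
    by (rule group.repr_independence[OF group_free_Abelian_group _ d(1) relations_subgroup, symmetric])
qed

lemma mult_map_image: "mult_map ` carrier (anti_invariant_tensor W Q p) = log_forms Q p"
proof -
  have "mult_map ` carrier (anti_invariant_tensor W Q p) = mult_combination ` carrier pairs_group"
    unfolding anti_invariant_tensor_eq carrier_FactGroup image_image mult_map_coset ..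
  also have "\<dots> = log_forms Q p"
  proof
    show "mult_combination ` carrier pairs_group \<subseteq> log_forms Q p"
      using mult_combination_log_form by auto
    show "log_forms Q p \<subseteq> mult_combination ` carrier pairs_group"
    proof
      fix \<omega> assume "\<omega> \<in> log_forms Q p"
      then obtain \<eta> where \<eta>: "\<omega> = over Q \<eta>" "\<eta> \<in> poly_forms p" "tangentially_zero \<eta>"
        unfolding log_forms_eq by blast
      obtain n a b where ab: "\<forall>i<n::nat. a i \<in> poly_funs \<and> b i \<in> poly_funs"
        "\<forall>f\<in>poly_funs. \<forall>v. f v = (\<Sum>i<n. b i v * jtrace (\<lambda>x. a i x * f x) v)"
        using dual_bases_exist by blast
      have ab1: "a i \<in> poly_funs \<and> b i \<in> poly_funs" if "i < n" for i using ab(1) that by blast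
      have ab2: "f v = (\<Sum>i<n. b i v * jtrace (\<lambda>x. a i x * f x) v)" if "f \<in> poly_funs" for f v
        using ab(2) that by blast
      obtain \<theta> where \<theta>: "\<forall>i<n. \<theta> i \<in> anti_invariant_forms W p"
        "\<forall>v us. \<eta> v us = (\<Sum>i<n. b i v * \<theta> i v us)"
        using tangentially_zero_expansion[OF ab1 dual_bases_orthogonality[OF ab1 ab2] \<eta>(2,3)] by blast
      let ?c = "\<Sum>i<n. frag_of (over Q (\<theta> i), b i)"
      have "?c \<in> carrier pairs_group"
        using \<theta>(1) ab1 by (intro sum_closed_free_Abelian_group) auto
      moreover have "\<omega> v us = mult_combination ?c v us" for v us
        by (simp add: \<eta>(1) over_def \<theta>(2) mult_combination_eq int_combination_sum
            int_combination_frag_of sum_divide_distrib)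
      then have "\<omega> = mult_combination ?c" by blast
      ultimately show "\<omega> \<in> mult_combination ` carrier pairs_group" by blast
    qed
  qed
  finally show ?thesis .
qed

end

theorem theorem1:
  fixes W :: "('v::unitary_space \<Rightarrow> 'v) set"
    and \<alpha> :: "'v set \<Rightarrow> 'v \<Rightarrow> complex"
    and Q :: "'v \<Rightarrow> complex"
    and l p :: nat
  assumes "complex_vector.dim (UNIV :: 'v set) = l"
    and "finite_unitary_reflection_group W"
    and "defining_forms (reflecting_hyperplanes W) \<alpha>"
    and "Q = defining_polynomial (reflecting_hyperplanes W) \<alpha>"
    and "0 \<le> p" and "p \<le> l"
  shows "inj_on mult_map (carrier (anti_invariant_tensor W Q p)) \<and>
         mult_map ` carrier (anti_invariant_tensor W Q p) = log_forms Q p"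
proof -
  interpret reflection_group_tensor W \<alpha> p
    by unfold_locales (rule assms)+
  have "Q = reflection_group.Q W \<alpha>"
    unfolding assms(4) Q_def arrangement_def ..
  then show ?thesis using mult_map_inj mult_map_image by simp
qed

end
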